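(* Let $d\ge3$, and consider on $\mathbb{R}^d$, with coordinates $(x^1,\dots,x^d)$ and indices taken modulo $d$, the vector field $$Y=\sum_{k=1}^d\Big(\sum_{j=1}^d(x^j)^2\Big)x^k\,\partial_{k+1}=\|x\|^2\sum_{k=1}^d x^k\,\partial_{k+1}.$$ For every $n\ge1$, let $\mathcal{M}=\mathcal{M}^n(\mathbb{R}^d)$ be the $n$-landmark manifold and let $\mathcal{E}=\operatorname{span}\{\ell\partial_1,\ell Y\}\subseteq T\mathcal{M}$. Then there is complete controllability on $\mathcal{M}$ with respect to $\mathcal{E}$ (for every $n$).
   Context: Write $\partial_j=\partial_{x^j}$; indices are modulo $d$, so $\partial_{d+1}=\partial_1$. The landmark manifold is the open set $\mathcal{M}^n(\mathbb{R}^d)=\{\mathbf{x}=(x_1,\dots,x_n): x_i\in\mathbb{R}^d,\ x_{i_1}\ne x_{i_2}\text{ whenever } i_1\neq i_2\}\subseteq(\mathbb{R}^d)^n$. For a vector field $X$ on $\mathbb{R}^d$, $\ell X$ is the vector field on $\mathcal{M}^n(\mathbb{R}^d)$ given by $\ell X(x_1,\dots,x_n)=(X(x_1),\dots,X(x_n))$. The span of vector fields is taken pointwise: $\mathcal{E}_{\mathbf{x}}=\operatorname{span}_{\mathbb{R}}\{\ell\partial_1(\mathbf{x}),\ell Y(\mathbf{x})\}$. An absolutely continuous curve $\gamma:[0,1]\to M$ in a manifold $M$ is horizontal with respect to $\mathcal{E}\subseteq TM$ if $\dot\gamma(t)\in\mathcal{E}_{\gamma(t)}$ for almost every $t$. The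 orbit $O_q$ of $\mathcal{E}$ at $q\in M$ is the set of $p\in M$ for which there is a horizontal curve $\gamma$ with $\gamma(0)=q$, $\gamma(1)=p$. Complete controllability on $M$ with respect to $\mathcal{E}$ means $O_q=M$ for every $q\in M$. When $\mathcal{E}$ is spanned by vector fields $Z_1,\dots,Z_m$, the orbit $O_q$ is also described as the set of all points $e^{t_1Z_{i_1}}\circ\cdots\circ e^{t_lZ_{i_l}}(q)$ with $t_j\in\mathbb{R}$, $i_j\in\{1,\dots,m\}$, $l\ge1$, where $e^{tZ}$ is the (local) flow of $Z$. *)

theory Defs
  imports "HOL-Analysis.Analysis"
begin

text \<open>
  \<open>\<real>\<^sup>d\<close> is \<open>real ^ 'd\<close> with \<open>d = CARD('d)\<close>. The index type \<open>'d\<close> carries no order, so the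
  coordinates are numbered by a bijection \<open>e\<close> from the residues \<open>{..<d}\<close> onto \<open>'d\<close>; the \<open>k\<close>-th
  coordinate, for any \<open>k :: nat\<close>, is the one numbered \<open>k mod d\<close> (so the \<open>d\<close>-th one is \<open>e 0\<close>).
\<close>

definition cyclic_numbering :: "(nat \<Rightarrow> 'd::finite) \<Rightarrow> bool" where
  "cyclic_numbering e \<longleftrightarrow> bij_betw e {..<CARD('d)} UNIV"

definition coord :: "(nat \<Rightarrow> 'd::finite) \<Rightarrow> nat \<Rightarrow> real ^ 'd \<Rightarrow> real" where
  "coord e k x = x $ e (k mod CARD('d))"

definition coord_field :: "(nat \<Rightarrow> 'd::finite) \<Rightarrow> nat \<Rightarrow> real ^ 'd \<Rightarrow> real ^ 'd" where
  "coord_field e k = (\<lambda>x. axis (e (k mod CARD('d))) 1)"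

definition Y_field :: "(nat \<Rightarrow> 'd::finite) \<Rightarrow> real ^ 'd \<Rightarrow> real ^ 'd" where
  "Y_field e x =
     (\<Sum>k = 1..CARD('d). ((\<Sum>j = 1..CARD('d). (coord e j x)\<^sup>2) * coord e k x) *\<^sub>R coord_field e (k + 1) x)"

definition landmark_manifold :: "((real ^ 'd::finite) ^ 'n::finite) set" where
  "landmark_manifold = {x. \<forall>i j. i \<noteq> j \<longrightarrow> x $ i \<noteq> x $ j}"

definition landmark_lift ::
    "(real ^ 'd::finite \<Rightarrow> real ^ 'd) \<Rightarrow> (real ^ 'd) ^ 'n::finite \<Rightarrow> (real ^ 'd) ^ 'n" where
  "landmark_lift X x = (\<chi> i. X (x $ i))"

text \<open>
  All manifolds here are open subsets \<open>M\<close> of a Euclidean space, with every tangent space identified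
  with that space; a family of tangent subspaces is then a map \<open>'a \<Rightarrow> 'a set\<close>.
\<close>

definition absolutely_continuous_curve :: "(real \<Rightarrow> 'a::euclidean_space) \<Rightarrow> real \<Rightarrow> real \<Rightarrow> bool" where
  "absolutely_continuous_curve g s t \<longleftrightarrow>
     (\<forall>\<epsilon>>0. \<exists>\<delta>>0. \<forall>(N::nat) a b.
        (\<forall>k<N. s \<le> a k \<and> a k \<le> b k \<and> b k \<le> t) \<longrightarrow>
        (\<forall>k<N. \<forall>l<N. k \<noteq> l \<longrightarrow> {a k<..<b k} \<inter> {a l<..<b l} = {}) \<longrightarrow>
        (\<Sum>k<N. b k - a k) < \<delta> \<longrightarrow>
        (\<Sum>k<N. norm (g (b k) - g (a k))) < \<epsilon>)"

definition horizontal_curve ::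
    "'a::euclidean_space set \<Rightarrow> ('a \<Rightarrow> 'a set) \<Rightarrow> (real \<Rightarrow> 'a) \<Rightarrow> bool" where
  "horizontal_curve M E g \<longleftrightarrow>
     g ` {0..1} \<subseteq> M \<and> absolutely_continuous_curve g 0 1 \<and>
     (AE t in lebesgue_on {0..1}.
        \<exists>v. (g has_vector_derivative v) (at t within {0..1}) \<and> v \<in> E (g t))"

definition horizontal_orbit ::
    "'a::euclidean_space set \<Rightarrow> ('a \<Rightarrow> 'a set) \<Rightarrow> 'a \<Rightarrow> 'a set" where
  "horizontal_orbit M E q = {p \<in> M. \<exists>g. horizontal_curve M E g \<and> g 0 = q \<and> g 1 = p}"

definition completely_controllable :: "'a::euclidean_space set \<Rightarrow> ('a \<Rightarrow> 'a set) \<Rightarrow> bool" where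
  "completely_controllable M E \<longleftrightarrow> (\<forall>q\<in>M. horizontal_orbit M E q = M)"

end

theory Submission
  imports Defs
begin

text \<open>
  The orbit relation is an equivalence relation and the landmark manifold is connected, so it is enough
  that every orbit contains a neighbourhood of its base point. This is a Chow--Rashevskii argument, but
  carried out without smooth dependence of flows on initial data: a field \<open>V\<close> is called approximable if
  \<open>x \<mapsto> x + h V x\<close> agrees up to \<open>o(h)\<close>, uniformly on compact sets, with a continuous map that sends each
  point into its own orbit. Conjugating by the local flow of a generator \<open>Z\<close> for a small time \<open>s\<close> turns
  \<open>V\<close> into \<open>V + s [V, Z] + O(s\<^sup>2)\<close>, so the approximable fields are closed under brackets with generators,
  and by the Jacobi identity the whole Lie algebra generated is approximable. Where it spans the tangent
  space, Brouwer's theorem makes the approximations cover a neighbourhood.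

  On \<open>\<real>\<^sup>d\<close> put \<open>Y x = \<parallel>x\<parallel>\<^sup>2 S x\<close> with the cyclic shift \<open>S\<close>. For a constant field \<open>a\<close> the third derivative
  of \<open>Y\<close> along \<open>a\<close> is \<open>6 \<parallel>a\<parallel>\<^sup>2 S a\<close>, which yields all constant fields; the second derivatives generate all
  linear fields, the first derivatives the quadratic shears, and hence all shears \<open>(u \<bullet> x)\<^sup>m v\<close> with
  \<open>u \<bullet> v = 0\<close> appear. Two independent linear forms that separate the landmarks then interpolate arbitrary
  velocities.
\<close>

subsection \<open>Horizontal curves\<close>

text \<open>The cubic field blows up in finite time, so flows exist only on balls and for short
  times, and every estimate has to be uniform on a compact set. The delicate point is the order of
  limits: the conjugation time \<open>s\<close> is fixed first and \<open>h\<close> tends to 0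
  afterwards, so each error must carry a factor \<open>h\<close>. A bound of order
  \<open>s\<^sup>2\<close> on the second-order remainder of the flow has no such factor. What helps
  is that the remainder is Lipschitz in the initial point with a constant of order
  \<open>s\<^sup>2\<close>, because the two points compared are at distance of order
  \<open>h\<close>. An approximated field carries a parameter \<open>l\<close> in
  \<open>{-1..1}\<close>: its sign supplies \<open>- V\<close>, and continuity in it is what lets
  Brouwer's theorem be applied to combinations. Polynomial fields are a convenient class since they
  are closed under brackets and their Taylor estimates follow by structural induction. The condition
  \<open>d \<ge> 3\<close> supplies vectors orthogonal to two given ones and keeps
  \<open>b i\<close> and \<open>b (i + 2)\<close> orthogonal.\<close>

text \<open>The scalar \<open>c\<close> is a signed flow time rescaled to the unit interval, so
  reversing a step only changes its sign. Asking for a solution curve instead of a flow map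
  sidesteps the blow-up of the cubic field.\<close>

definition flow_step :: "'a::euclidean_space set \<Rightarrow> ('a \<Rightarrow> 'a) set \<Rightarrow> 'a \<Rightarrow> 'a \<Rightarrow> bool" where
  "flow_step M \<Z> p q \<longleftrightarrow>
     (\<exists>Z\<in>\<Z>. \<exists>c u. u 0 = p \<and> u 1 = q \<and> u ` {0..1} \<subseteq> M \<and>
        (\<forall>t\<in>{0..1::real}. (u has_vector_derivative c *\<^sub>R Z (u t)) (at t within {0..1})))"

definition reachable :: "'a::euclidean_space set \<Rightarrow> ('a \<Rightarrow> 'a) set \<Rightarrow> 'a \<Rightarrow> 'a \<Rightarrow> bool" where
  "reachable M \<Z> = (flow_step M \<Z>)\<^sup>*\<^sup>*"

lemma flow_step_sym:
  assumes "flow_step M \<Z> p q"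
  shows "flow_step M \<Z> q p"
proof -
  obtain Z c u where Z: "Z \<in> \<Z>" and u: "u 0 = p" "u 1 = q" "u ` {0..1} \<subseteq> M"
    and du: "\<And>t. t \<in> {0..1::real} \<Longrightarrow> (u has_vector_derivative c *\<^sub>R Z (u t)) (at t within {0..1})"
    using assms unfolding flow_step_def by blast
  let ?w = "\<lambda>t. u (1 - t)"
  have "(?w has_vector_derivative (-c) *\<^sub>R Z (?w t)) (at t within {0..1})" if "t \<in> {0..1}" for t
  proof -
    have "((\<lambda>t. 1 - t) has_vector_derivative -1) (at t within {0..1::real})"
      by (auto intro!: derivative_eq_intros)
    moreover have "(\<lambda>t. 1 - t) ` {0..1::real} = {0..1}"
      by (auto simp: image_iff intro: bexI[of _ "1 - _"])
    ultimately have "((u \<circ> (\<lambda>t. 1 - t)) has_vector_derivative (-1) *\<^sub>R (c *\<^sub>R Z (u (1 - t))))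
        (at t within {0..1})"
      using du[of "1 - t"] that by (intro vector_diff_chain_within) auto
    then show ?thesis
      by (simp add: o_def)
  qed
  moreover have "?w ` {0..1} \<subseteq> M"
    using u(3) by force
  ultimately show ?thesis
    using Z u unfolding flow_step_def by (intro bexI[of _ Z] exI[of _ "-c"] exI[of _ ?w]) auto
qed

lemma reachable_refl [simp]: "reachable M \<Z> p p"
  by (simp add: reachable_def)

lemma reachable_trans: "reachable M \<Z> p q \<Longrightarrow> reachable M \<Z> q r \<Longrightarrow> reachable M \<Z> p r"
  unfolding reachable_def by (rule rtranclp_trans)

lemma reachable_sym: "reachable M \<Z> p q \<Longrightarrow> reachable M \<Z> q p"
proof -
  have "symp (flow_step M \<Z>)"
    by (blast intro: sympI flow_step_sym)
  then show "reachable M \<Z> p q \<Longrightarrow> reachable M \<Z> q p"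
    unfolding reachable_def by (metis symp_rtranclp sympD)
qed

lemma lipschitz_imp_absolutely_continuous_curve:
  fixes g :: "real \<Rightarrow> 'a::euclidean_space"
  assumes "L-lipschitz_on {s..t} g"
  shows "absolutely_continuous_curve g s t"
  unfolding absolutely_continuous_curve_def
proof (intro allI impI)
  fix \<epsilon> :: real assume "\<epsilon> > 0"
  have L: "L \<ge> 0"
    using assms lipschitz_on_nonneg by blast
  show "\<exists>\<delta>>0. \<forall>(N::nat) a b.
        (\<forall>k<N. s \<le> a k \<and> a k \<le> b k \<and> b k \<le> t) \<longrightarrow>
        (\<forall>k<N. \<forall>l<N. k \<noteq> l \<longrightarrow> {a k<..<b k} \<inter> {a l<..<b l} = {}) \<longrightarrow>
        (\<Sum>k<N. b k - a k) < \<delta> \<longrightarrow>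
        (\<Sum>k<N. norm (g (b k) - g (a k))) < \<epsilon>"
  proof (intro exI[of _ "\<epsilon> / (L + 1)"] conjI allI impI)
    show "0 < \<epsilon> / (L + 1)"
      using \<open>\<epsilon> > 0\<close> L by simp
  next
    fix N :: nat and a b :: "nat \<Rightarrow> real"
    assume ab: "\<forall>k<N. s \<le> a k \<and> a k \<le> b k \<and> b k \<le> t"
      and small: "(\<Sum>k<N. b k - a k) < \<epsilon> / (L + 1)"
    have "(\<Sum>k<N. norm (g (b k) - g (a k))) \<le> (\<Sum>k<N. L * (b k - a k))"
    proof (rule sum_mono)
      fix k assume "k \<in> {..<N}"
      with ab have k: "s \<le> a k" "a k \<le> b k" "b k \<le> t" by auto
      then have "dist (g (b k)) (g (a k)) \<le> L * dist (b k) (a k)"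
        by (intro lipschitz_onD[OF assms]) auto
      then show "norm (g (b k) - g (a k)) \<le> L * (b k - a k)"
        using k by (simp add: dist_norm)
    qed
    also have "\<dots> = L * (\<Sum>k<N. b k - a k)"
      by (simp add: sum_distrib_left)
    also have "\<dots> \<le> L * (\<epsilon> / (L + 1))"
      using small L by (intro mult_left_mono) auto
    also have "\<dots> < \<epsilon>"
      using \<open>\<epsilon> > 0\<close> L by (simp add: field_simps)
    finally show "(\<Sum>k<N. norm (g (b k) - g (a k))) < \<epsilon>" .
  qed
qed

text \<open>A working notion that survives concatenation: the Lipschitz bound yields absolute
  continuity, and the finite exceptional set, which collects the junctions, is null.\<close>

definition piecewise_horizontal ::
    "'a::euclidean_space set \<Rightarrow> ('a \<Rightarrow> 'a set) \<Rightarrow> (real \<Rightarrow> 'a) \<Rightarrow> bool" where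
  "piecewise_horizontal M E g \<longleftrightarrow>
     g ` {0..1} \<subseteq> M \<and> (\<exists>L. L-lipschitz_on {0..1} g) \<and>
     (\<exists>S. finite S \<and> (\<forall>t\<in>{0<..<1} - S. \<exists>v\<in>E (g t). (g has_vector_derivative v) (at t)))"

lemma piecewise_horizontal_imp_horizontal_curve:
  assumes "piecewise_horizontal M E g"
  shows "horizontal_curve M E g"
proof -
  obtain L S where g: "g ` {0..1} \<subseteq> M" "L-lipschitz_on {0..1} g" "finite S"
    and dg: "\<And>t. t \<in> {0<..<1} - S \<Longrightarrow> \<exists>v\<in>E (g t). (g has_vector_derivative v) (at t)"
    using assms unfolding piecewise_horizontal_def by blast
  let ?N = "(S \<union> {0, 1}) \<inter> {0..1::real}"
  have "?N \<in> null_sets (lebesgue_on {0..1})"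
    using g(3) by (subst null_sets_restrict_space) (auto intro!: finite_imp_null_set_lborel null_sets_completionI)
  then have "AE t in lebesgue_on {0..1}.
        \<exists>v. (g has_vector_derivative v) (at t within {0..1}) \<and> v \<in> E (g t)"
  proof (rule AE_I')
    show "{t \<in> space (lebesgue_on {0..1}).
        \<not> (\<exists>v. (g has_vector_derivative v) (at t within {0..1}) \<and> v \<in> E (g t))} \<subseteq> ?N"
    proof
      fix t assume t: "t \<in> {t \<in> space (lebesgue_on {0..1}).
        \<not> (\<exists>v. (g has_vector_derivative v) (at t within {0..1}) \<and> v \<in> E (g t))}"
      then have t01: "t \<in> {0..1}" by simp
      show "t \<in> ?N"
      proof (rule ccontr)
        assume "t \<notin> ?N"
        then have "t \<in> {0<..<1} - S" using t01 by auto
        from dg[OF this] t show False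
          by (auto intro: has_vector_derivative_at_within)
      qed
    qed
  qed
  then show ?thesis
    unfolding horizontal_curve_def
    using g lipschitz_imp_absolutely_continuous_curve by blast
qed

text \<open>The curve stays in \<open>M\<close> over a compact time interval, so continuity of
  \<open>Z\<close> on \<open>M\<close> bounds its speed, and the speed bound is a Lipschitz
  constant.\<close>

lemma flow_step_imp_piecewise_horizontal:
  fixes \<Z> :: "('a::euclidean_space \<Rightarrow> 'a) set"
  assumes "flow_step M \<Z> p q" and cont: "\<And>Z. Z \<in> \<Z> \<Longrightarrow> continuous_on M Z"
  shows "\<exists>g. piecewise_horizontal M (\<lambda>x. span ((\<lambda>Z. Z x) ` \<Z>)) g \<and> g 0 = p \<and> g 1 = q"
proof -
  obtain Z c u where Z: "Z \<in> \<Z>" and u: "u 0 = p" "u 1 = q" "u ` {0..1} \<subseteq> M"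
    and du: "\<And>t. t \<in> {0..1::real} \<Longrightarrow> (u has_vector_derivative c *\<^sub>R Z (u t)) (at t within {0..1})"
    using assms(1) unfolding flow_step_def by blast
  have "continuous_on {0..1} u"
    using du by (meson continuous_on_eq_continuous_within has_vector_derivative_continuous)
  then have "continuous_on {0..1} (\<lambda>t. c *\<^sub>R Z (u t))"
    using cont[OF Z] u(3)
    by (intro continuous_intros) (auto intro: continuous_on_compose2)
  then have "bounded ((\<lambda>t. c *\<^sub>R Z (u t)) ` {0..1})"
    by (intro compact_imp_bounded compact_continuous_image) auto
  then obtain B where "B > 0" and B: "\<And>t. t \<in> {0..1} \<Longrightarrow> norm (c *\<^sub>R Z (u t)) \<le> B"
    by (force simp: bounded_pos)
  have "B-lipschitz_on {0..1} u"
  proof (rule lipschitz_onI)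
    fix x y :: real assume xy: "x \<in> {0..1}" "y \<in> {0..1}"
    have "norm (u x - u y) \<le> B * norm (x - y)"
    proof (rule differentiable_bound)
      show "(u has_derivative (\<lambda>h. h *\<^sub>R (c *\<^sub>R Z (u t)))) (at t within {0..1})" if "t \<in> {0..1}" for t
        using du[OF that] unfolding has_vector_derivative_def .
      show "onorm (\<lambda>h. h *\<^sub>R (c *\<^sub>R Z (u t))) \<le> B" if "t \<in> {0..1}" for t
      proof (rule onorm_bound)
        show "norm (h *\<^sub>R (c *\<^sub>R Z (u t))) \<le> B * norm h" for h :: real
          using mult_left_mono[OF B[OF that], of "\<bar>h\<bar>"] by (simp add: abs_mult mult.assoc mult.commute[of B])
      qed (use \<open>B > 0\<close> in simp)
    qed (use xy in auto)
    then show "dist (u x) (u y) \<le> B * dist x y"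
      by (simp add: dist_norm)
  qed (use \<open>B > 0\<close> in simp)
  moreover have "\<exists>v\<in>span ((\<lambda>Z. Z (u t)) ` \<Z>). (u has_vector_derivative v) (at t)"
    if "t \<in> {0<..<1} - {}" for t
  proof
    show "(u has_vector_derivative c *\<^sub>R Z (u t)) (at t)"
      using du[of t] that at_within_interior[of t "{0..1::real}"] by auto
    show "c *\<^sub>R Z (u t) \<in> span ((\<lambda>Z. Z (u t)) ` \<Z>)"
      using Z by (auto intro: span_scale span_base)
  qed
  ultimately have "piecewise_horizontal M (\<lambda>x. span ((\<lambda>Z. Z x) ` \<Z>)) u"
    using u(3) unfolding piecewise_horizontal_def by (blast intro: finite.emptyI)
  with u show ?thesis by blast
qed

text \<open>Each half is run at double speed; \<open>subspace (E x)\<close> keeps the doubled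
  velocity inside \<open>E\<close>. The new exceptional set consists of the junction time and the
  rescaled exceptional times of both pieces.\<close>

lemma piecewise_horizontal_concat:
  assumes g: "piecewise_horizontal M E g" and k: "piecewise_horizontal M E k"
    and "g 1 = k 0" and sub: "\<And>x. subspace (E x)"
  shows "piecewise_horizontal M E (\<lambda>t. if t \<le> 1/2 then g (2 * t) else k (2 * t - 1))" (is "piecewise_horizontal M E ?f")
proof -
  obtain L S where g: "g ` {0..1} \<subseteq> M" "L-lipschitz_on {0..1} g" "finite S"
    and dg: "\<And>t. t \<in> {0<..<1} - S \<Longrightarrow> \<exists>v\<in>E (g t). (g has_vector_derivative v) (at t)"
    using assms(1) unfolding piecewise_horizontal_def by blast
  obtain L' S' where k: "k ` {0..1} \<subseteq> M" "L'-lipschitz_on {0..1} k" "finite S'"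
    and dk: "\<And>t. t \<in> {0<..<1} - S' \<Longrightarrow> \<exists>v\<in>E (k t). (k has_vector_derivative v) (at t)"
    using assms(2) unfolding piecewise_horizontal_def by blast
  let ?S = "{1/2} \<union> (\<lambda>s. s / 2) ` S \<union> (\<lambda>s. (s + 1) / 2) ` S'"
  have 1: "?f ` {0..1} \<subseteq> M"
    using g(1) k(1) by (auto simp: image_subset_iff)
  have 2: "\<exists>L. L-lipschitz_on {0..1} ?f"
  proof -
    have two: "2-lipschitz_on T (\<lambda>t::real. 2 * t - c)" for T c
    proof (rule lipschitz_onI)
      show "dist (2 * x - c) (2 * y - c) \<le> 2 * dist x y" for x y :: real
        using abs_mult[of 2 "x - y"] by (simp add: dist_real_def algebra_simps)
    qed simp
    have "(L * 2)-lipschitz_on {0..1/2} (\<lambda>t. g (2 * t - 0))"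
      by (rule lipschitz_on_compose2[where f="\<lambda>t. 2 * t - 0", OF two])
         (auto intro!: lipschitz_on_subset[OF g(2)])
    moreover have "(L' * 2)-lipschitz_on {1/2..1} (\<lambda>t. k (2 * t - 1))"
      by (rule lipschitz_on_compose2[where f="\<lambda>t. 2 * t - 1", OF two])
         (auto intro!: lipschitz_on_subset[OF k(2)])
    ultimately have "(max (L * 2) (L' * 2))-lipschitz_on {0..1} (\<lambda>t. if t \<le> 1/2 then g (2 * t - 0) else k (2 * t - 1))"
      by (intro lipschitz_on_concat_max) (use assms(3) in auto)
    then show ?thesis unfolding diff_zero by blast
  qed
  have 3: "\<exists>v\<in>E (?f t). (?f has_vector_derivative v) (at t)" if t: "t \<in> {0<..<1} - ?S" for t
  proof (cases "t < 1/2")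
    case True
    have "2 * t \<notin> S"
    proof
      assume "2 * t \<in> S"
      then have "(2 * t) / 2 \<in> (\<lambda>s. s / 2) ` S" by (rule imageI)
      with t show False by simp
    qed
    then obtain v where v: "v \<in> E (g (2 * t))" "(g has_vector_derivative v) (at (2 * t))"
      using dg[of "2 * t"] True t by auto
    have "((g \<circ> (\<lambda>t. 2 * t)) has_vector_derivative 2 *\<^sub>R v) (at t)"
      by (rule vector_diff_chain_at) (use v in \<open>auto intro!: derivative_eq_intros\<close>)
    then have "(?f has_vector_derivative 2 *\<^sub>R v) (at t)"
      by (rule has_vector_derivative_transform_within_open[where S="{..<1/2}"]) (use True in auto)
    moreover have "2 *\<^sub>R v \<in> E (?f t)"
      using v(1) sub True by (simp add: subspace_scale)
    ultimately show ?thesis by blast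
  next
    case False
    with t have gt: "t > 1/2" by auto
    have "2 * t - 1 \<notin> S'"
    proof
      assume "2 * t - 1 \<in> S'"
      then have "((2 * t - 1) + 1) / 2 \<in> (\<lambda>s. (s + 1) / 2) ` S'" by (rule imageI)
      with t show False by simp
    qed
    then obtain v where v: "v \<in> E (k (2 * t - 1))" "(k has_vector_derivative v) (at (2 * t - 1))"
      using dk[of "2 * t - 1"] gt t by auto
    have "((k \<circ> (\<lambda>t. 2 * t - 1)) has_vector_derivative 2 *\<^sub>R v) (at t)"
      by (rule vector_diff_chain_at) (use v in \<open>auto intro!: derivative_eq_intros\<close>)
    then have "(?f has_vector_derivative 2 *\<^sub>R v) (at t)"
      by (rule has_vector_derivative_transform_within_open[where S="{1/2<..}"]) (use gt in auto)
    moreover have "2 *\<^sub>R v \<in> E (?f t)"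
      using v(1) sub gt by (simp add: subspace_scale)
    ultimately show ?thesis by blast
  qed
  have 4: "finite ?S" using g(3) k(3) by simp
  show ?thesis
    unfolding piecewise_horizontal_def
    by (intro conjI 1 2 exI[of _ ?S] 4 ballI 3)
qed

lemma reachable_imp_horizontal_orbit:
  fixes \<Z> :: "('a::euclidean_space \<Rightarrow> 'a) set"
  assumes "reachable M \<Z> p q" "p \<in> M" and cont: "\<And>Z. Z \<in> \<Z> \<Longrightarrow> continuous_on M Z"
  shows "q \<in> horizontal_orbit M (\<lambda>x. span ((\<lambda>Z. Z x) ` \<Z>)) p"
proof -
  let ?E = "\<lambda>x. span ((\<lambda>Z. Z x) ` \<Z>)"
  have "\<exists>g. piecewise_horizontal M ?E g \<and> g 0 = p \<and> g 1 = q"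
    using assms(1) unfolding reachable_def
  proof (induction rule: rtranclp_induct)
    case base
    have "piecewise_horizontal M ?E (\<lambda>t. p)"
      unfolding piecewise_horizontal_def using \<open>p \<in> M\<close>
      by (auto intro!: exI[of _ 0] exI[of _ "{}"] bexI[of _ 0] lipschitz_onI span_zero)
    then show ?case by force
  next
    case (step y z)
    then obtain g where g: "piecewise_horizontal M ?E g" "g 0 = p" "g 1 = y" by blast
    obtain k where k: "piecewise_horizontal M ?E k" "k 0 = y" "k 1 = z"
      using flow_step_imp_piecewise_horizontal[OF step(2) cont] by blast
    have "piecewise_horizontal M ?E (\<lambda>t. if t \<le> 1/2 then g (2 * t) else k (2 * t - 1))"
      by (rule piecewise_horizontal_concat) (use g k in auto)
    with g k show ?case by (intro exI[of _ "\<lambda>t. if t \<le> 1/2 then g (2 * t) else k (2 * t - 1)"]) auto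
  qed
  then obtain g where g: "piecewise_horizontal M ?E g" "g 0 = p" "g 1 = q" by blast
  then have "q \<in> M" unfolding piecewise_horizontal_def by force
  with g show ?thesis
    unfolding horizontal_orbit_def using piecewise_horizontal_imp_horizontal_curve by blast
qed

subsection \<open>Polynomial vector fields\<close>

definition dirderiv :: "('a::euclidean_space \<Rightarrow> 'a) \<Rightarrow> ('a \<Rightarrow> 'b::euclidean_space) \<Rightarrow> 'a \<Rightarrow> 'b" where
  "dirderiv V f x = frechet_derivative f (at x) (V x)"

text \<open>With this sign the bracket acts on scalar polynomials as V(W f) - W(V f), and for a
  constant field \<open>V\<close> it is the derivative of \<open>W\<close> along
  \<open>V\<close>.\<close>

definition bracket :: "('a::euclidean_space \<Rightarrow> 'a) \<Rightarrow> ('a \<Rightarrow> 'a) \<Rightarrow> 'a \<Rightarrow> 'a" where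
  "bracket V W x = dirderiv V W x - dirderiv W V x"

lemma dirderiv_eq: "(f has_derivative f') (at x) \<Longrightarrow> dirderiv V f x = f' (V x)"
  unfolding dirderiv_def using frechet_derivative_at by metis

lemma polynomial_function_has_derivative:
  fixes f :: "'a::euclidean_space \<Rightarrow> 'b::euclidean_space"
  assumes "polynomial_function f"
  shows "(f has_derivative frechet_derivative f (at x)) (at x within S)"
  by (metis assms differentiable_at_polynomial_function frechet_derivative_works has_derivative_at_withinI)

lemma real_polynomial_function_has_derivative:
  fixes f :: "'a::euclidean_space \<Rightarrow> real"
  assumes "real_polynomial_function f"
  shows "(f has_derivative frechet_derivative f (at x)) (at x within S)"
  using assms by (simp add: polynomial_function_has_derivative real_polynomial_function_eq)

lemma dirderiv_linear: "bounded_linear f \<Longrightarrow> dirderiv V f x = f (V x)"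
  by (rule dirderiv_eq) (rule bounded_linear_imp_has_derivative)

lemma dirderiv_const: "dirderiv V (\<lambda>x. c) x = 0"
  by (rule dirderiv_eq[where f'="\<lambda>_. 0"]) simp

lemma dirderiv_add:
  assumes "polynomial_function f" "polynomial_function g"
  shows "dirderiv V (\<lambda>x. f x + g x) x = dirderiv V f x + dirderiv V g x"
  unfolding dirderiv_def[of V f] dirderiv_def[of V g]
  by (rule dirderiv_eq) (intro derivative_intros polynomial_function_has_derivative assms)

lemma dirderiv_diff:
  assumes "polynomial_function f" "polynomial_function g"
  shows "dirderiv V (\<lambda>x. f x - g x) x = dirderiv V f x - dirderiv V g x"
  unfolding dirderiv_def[of V f] dirderiv_def[of V g]
  by (rule dirderiv_eq) (intro derivative_intros polynomial_function_has_derivative assms)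

lemma dirderiv_scaleR:
  assumes "polynomial_function f"
  shows "dirderiv V (\<lambda>x. c *\<^sub>R f x) x = c *\<^sub>R dirderiv V f x"
  unfolding dirderiv_def[of V f]
  by (rule dirderiv_eq) (intro derivative_intros polynomial_function_has_derivative assms)

lemma dirderiv_mult:
  fixes f g :: "'a::euclidean_space \<Rightarrow> real"
  assumes "real_polynomial_function f" "real_polynomial_function g"
  shows "dirderiv V (\<lambda>x. f x * g x) x = f x * dirderiv V g x + dirderiv V f x * g x"
  unfolding dirderiv_def[of V f] dirderiv_def[of V g]
  by (rule dirderiv_eq) (intro derivative_intros real_polynomial_function_has_derivative assms)

lemma dirderiv_linear_compose:
  assumes "bounded_linear l" "polynomial_function f"
  shows "dirderiv V (\<lambda>x. l (f x)) x = l (dirderiv V f x)"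
  unfolding dirderiv_def[of V f]
  by (rule dirderiv_eq)
     (intro bounded_linear.has_derivative[OF assms(1)] polynomial_function_has_derivative assms)

lemma real_polynomial_function_dirderiv:
  fixes f :: "'a::euclidean_space \<Rightarrow> real"
  assumes "real_polynomial_function f" "polynomial_function V"
  shows "real_polynomial_function (dirderiv V f)"
  using assms(1)
proof induction
  case (linear f)
  have "dirderiv V f = f \<circ> V"
    by (simp add: fun_eq_iff dirderiv_linear linear)
  then show ?case
    using assms(2) linear unfolding polynomial_function_def by metis
next
  case (const c)
  then show ?case
    by (simp add: dirderiv_const[abs_def] real_polynomial_function.intros(2))
next
  case (add f g)
  then have "dirderiv V (\<lambda>x. f x + g x) = (\<lambda>x. dirderiv V f x + dirderiv V g x)"
    by (intro ext dirderiv_add) (simp_all add: real_polynomial_function_eq[symmetric])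
  with add show ?case
    by (simp add: real_polynomial_function.intros(3))
next
  case (mult f g)
  then have "dirderiv V (\<lambda>x. f x * g x) = (\<lambda>x. f x * dirderiv V g x + dirderiv V f x * g x)"
    by (intro ext dirderiv_mult)
  with mult show ?case
    by (simp add: real_polynomial_function.intros(3) real_polynomial_function.intros(4))
qed

lemma polynomial_function_dirderiv:
  fixes f :: "'a::euclidean_space \<Rightarrow> 'b::euclidean_space"
  assumes "polynomial_function f" "polynomial_function V"
  shows "polynomial_function (dirderiv V f)"
  unfolding polynomial_function_def
proof (intro allI impI)
  fix l :: "'b \<Rightarrow> real" assume l: "bounded_linear l"
  have "l \<circ> dirderiv V f = dirderiv V (\<lambda>x. l (f x))"
    by (simp add: fun_eq_iff dirderiv_linear_compose[OF l assms(1)])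
  moreover have "real_polynomial_function (\<lambda>x. l (f x))"
    using l assms(1) unfolding polynomial_function_def o_def by blast
  ultimately show "real_polynomial_function (l \<circ> dirderiv V f)"
    by (simp add: real_polynomial_function_dirderiv assms(2))
qed

lemma polynomial_function_bracket:
  assumes "polynomial_function V" "polynomial_function W"
  shows "polynomial_function (bracket V W)"
  unfolding bracket_def[abs_def]
  by (intro polynomial_function_diff polynomial_function_dirderiv assms)

text \<open>
  Reading a field as a derivation on polynomial functions makes the Jacobi identity a formal
  consequence, with no appeal to the symmetry of second derivatives.
\<close>

lemma dirderiv_bracket:
  fixes f :: "'a::euclidean_space \<Rightarrow> real"
  assumes "real_polynomial_function f" and V: "polynomial_function V" and W: "polynomial_function W"
  shows "dirderiv (bracket V W) f x = dirderiv V (dirderiv W f) x - dirderiv W (dirderiv V f) x"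
  using assms(1)
proof (induction arbitrary: x)
  case (linear f)
  have "dirderiv U f = (\<lambda>x. f (U x))" for U
    by (simp add: fun_eq_iff dirderiv_linear linear)
  then show ?case
    by (simp add: dirderiv_linear_compose[OF linear] V W bracket_def linear_diff bounded_linear.linear[OF linear])
next
  case (const c)
  show ?case
    by (simp add: dirderiv_const[abs_def])
next
  case (add f g)
  have D: "dirderiv U (\<lambda>x. f x + g x) = (\<lambda>x. dirderiv U f x + dirderiv U g x)" for U
    using add by (intro ext dirderiv_add) (simp_all add: real_polynomial_function_eq[symmetric])
  have p: "polynomial_function (dirderiv U f)" "polynomial_function (dirderiv U g)"
    if "polynomial_function U" for U
    using add that by (auto simp: real_polynomial_function_eq[symmetric] intro: real_polynomial_function_dirderiv)
  show ?case
    unfolding D by (simp add: dirderiv_add p V W add.IH)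
next
  case (mult f g)
  have D: "dirderiv U (\<lambda>x. f x * g x) = (\<lambda>x. f x * dirderiv U g x + dirderiv U f x * g x)" for U
    using mult by (intro ext dirderiv_mult)
  have p: "real_polynomial_function (dirderiv U f)" "real_polynomial_function (dirderiv U g)"
    if "polynomial_function U" for U
    using mult that by (auto intro: real_polynomial_function_dirderiv)
  have D2: "dirderiv U' (\<lambda>x. f x * dirderiv U g x + dirderiv U f x * g x) x =
      f x * dirderiv U' (dirderiv U g) x + dirderiv U' f x * dirderiv U g x
      + (dirderiv U f x * dirderiv U' g x + dirderiv U' (dirderiv U f) x * g x)"
    if "polynomial_function U" for U U'
  proof -
    have "dirderiv U' (\<lambda>x. f x * dirderiv U g x + dirderiv U f x * g x) x =
      dirderiv U' (\<lambda>x. f x * dirderiv U g x) x + dirderiv U' (\<lambda>x. dirderiv U f x * g x) x"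
      using mult p[OF that]
      by (intro dirderiv_add) (auto simp: real_polynomial_function_eq[symmetric] intro: real_polynomial_function.intros(4))
    then show ?thesis
      using mult p[OF that] by (simp add: dirderiv_mult)
  qed
  show ?case
    \<comment> \<open>The mixed products, of a derivative of \<open>f\<close> along one field with a
      derivative of \<open>g\<close> along the other, are symmetric in \<open>V\<close> and
      \<open>W\<close> and cancel in the commutator.\<close>
    unfolding D D2[OF V] D2[OF W] mult.IH by (simp add: algebra_simps)
qed

lemma bracket_inner:
  assumes "polynomial_function V" "polynomial_function W"
  shows "bracket V W x \<bullet> b = dirderiv V (\<lambda>x. W x \<bullet> b) x - dirderiv W (\<lambda>x. V x \<bullet> b) x"
  using dirderiv_linear_compose[OF bounded_linear_inner_left assms(1), of W b x]
    dirderiv_linear_compose[OF bounded_linear_inner_left assms(2), of V b x]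
  by (simp add: bracket_def inner_diff_left)

text \<open>Tested against a vector \<open>b\<close>, both sides become iterated derivations of the
  component functions of \<open>U\<close>, \<open>V\<close> and \<open>W\<close>, which cancel
  termwise. On the right-hand side the second arguments are only \<open>V\<close> and
  \<open>W\<close>, the form that an induction over brackets can use.\<close>

lemma bracket_jacobi:
  fixes U V W :: "'a::euclidean_space \<Rightarrow> 'a"
  assumes U: "polynomial_function U" and V: "polynomial_function V" and W: "polynomial_function W"
  shows "bracket U (bracket V W) x = bracket (bracket U V) W x - bracket (bracket U W) V x"
proof (rule euclidean_eqI)
  fix b :: 'a
  have p: "real_polynomial_function (\<lambda>x. X x \<bullet> b)" if "polynomial_function X" for X :: "'a \<Rightarrow> 'a"
    using that bounded_linear_inner_left[of b] unfolding polynomial_function_def o_def by blast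
  have *: "dirderiv X (\<lambda>x. dirderiv Y (\<lambda>x. Z x \<bullet> b) x - dirderiv Z (\<lambda>x. Y x \<bullet> b) x) x =
      dirderiv X (dirderiv Y (\<lambda>x. Z x \<bullet> b)) x - dirderiv X (dirderiv Z (\<lambda>x. Y x \<bullet> b)) x"
    if "polynomial_function X" "polynomial_function Y" "polynomial_function Z" for X Y Z x
    by (rule dirderiv_diff)
       (auto simp: real_polynomial_function_eq[symmetric] intro!: real_polynomial_function_dirderiv p that)
  note pb = polynomial_function_bracket
  show "bracket U (bracket V W) x \<bullet> b = (bracket (bracket U V) W x - bracket (bracket U W) V x) \<bullet> b"
    by (simp add: inner_diff_left bracket_inner pb U V W * dirderiv_bracket p)
qed

section \<open>Taylor estimates on balls\<close>

text \<open>Size, Lipschitz bound and quadratic remainder are proved together because the product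
  step of the induction uses all three for both factors; no second derivative is formed.\<close>

lemma real_polynomial_function_taylor:
  fixes f :: "'a::euclidean_space \<Rightarrow> real"
  assumes "real_polynomial_function f"
  shows "\<exists>C. \<forall>x\<in>cball 0 R. \<forall>y\<in>cball 0 R. \<bar>f x\<bar> \<le> C \<and> \<bar>f y - f x\<bar> \<le> C * norm (y - x) \<and>
      \<bar>f y - f x - frechet_derivative f (at x) (y - x)\<bar> \<le> C * (norm (y - x))\<^sup>2"
  using assms
proof induction
  case (linear f)
  obtain K where K: "\<And>x. norm (f x) \<le> norm x * K" "K > 0"
    using bounded_linear.pos_bounded[OF linear] by blast
  have d: "frechet_derivative f (at x) = f" for x
    using bounded_linear_imp_has_derivative[OF linear] frechet_derivative_at by metis
  have f: "f (y - x) = f y - f x" for x y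
    by (simp add: linear_diff bounded_linear.linear[OF linear])
  show ?case
  \<comment> \<open>The first summand bounds the value on the ball, the second is the Lipschitz
    constant; the remainder of a linear form vanishes.\<close>
  proof (intro exI[of _ "K * \<bar>R\<bar> + K"] ballI)
    fix x y :: 'a assume "x \<in> cball 0 R" "y \<in> cball 0 R"
    then have R: "norm x \<le> R" "R \<ge> 0" by (auto intro: order_trans[OF norm_ge_zero])
    have "\<bar>f x\<bar> \<le> norm x * K" using K(1)[of x] by simp
    also have "\<dots> \<le> R * K" using R K(2) by (intro mult_right_mono) auto
    finally have 1: "\<bar>f x\<bar> \<le> K * \<bar>R\<bar> + K" using R K(2) by (simp add: mult.commute)
    have "\<bar>f y - f x\<bar> \<le> norm (y - x) * K" using K(1)[of "y - x"] by (simp add: f)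
    also have "\<dots> \<le> (K * \<bar>R\<bar> + K) * norm (y - x)" using K(2) by (simp add: algebra_simps)
    finally have 2: "\<bar>f y - f x\<bar> \<le> (K * \<bar>R\<bar> + K) * norm (y - x)" .
    show "\<bar>f x\<bar> \<le> K * \<bar>R\<bar> + K \<and> \<bar>f y - f x\<bar> \<le> (K * \<bar>R\<bar> + K) * norm (y - x) \<and>
      \<bar>f y - f x - frechet_derivative f (at x) (y - x)\<bar> \<le> (K * \<bar>R\<bar> + K) * (norm (y - x))\<^sup>2"
      using 1 2 K(2) by (simp add: d f)
  qed
next
  case (const c)
  have "frechet_derivative (\<lambda>x::'a. c) (at x) = (\<lambda>_. 0)" for x
    by simp
  then show ?case
    by (intro exI[of _ "\<bar>c\<bar>"]) simp
next
  case (add f g)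
  obtain C where C: "\<And>x y. x\<in>cball 0 R \<Longrightarrow> y\<in>cball 0 R \<Longrightarrow> \<bar>f x\<bar> \<le> C \<and> \<bar>f y - f x\<bar> \<le> C * norm (y - x) \<and>
      \<bar>f y - f x - frechet_derivative f (at x) (y - x)\<bar> \<le> C * (norm (y - x))\<^sup>2"
    using add.IH(1) by blast
  obtain D where D: "\<And>x y. x\<in>cball 0 R \<Longrightarrow> y\<in>cball 0 R \<Longrightarrow> \<bar>g x\<bar> \<le> D \<and> \<bar>g y - g x\<bar> \<le> D * norm (y - x) \<and>
      \<bar>g y - g x - frechet_derivative g (at x) (y - x)\<bar> \<le> D * (norm (y - x))\<^sup>2"
    using add.IH(2) by blast
  have d: "frechet_derivative (\<lambda>x. f x + g x) (at x) =
      (\<lambda>h. frechet_derivative f (at x) h + frechet_derivative g (at x) h)" for x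
    by (rule frechet_derivative_at[symmetric])
       (intro derivative_intros real_polynomial_function_has_derivative add.hyps)
  show ?case
  proof (intro exI[of _ "C + D"] ballI)
    fix x y :: 'a assume xy: "x \<in> cball 0 R" "y \<in> cball 0 R"
    from C[OF xy] D[OF xy] show "\<bar>f x + g x\<bar> \<le> C + D \<and> \<bar>f y + g y - (f x + g x)\<bar> \<le> (C + D) * norm (y - x) \<and>
      \<bar>f y + g y - (f x + g x) - frechet_derivative (\<lambda>x. f x + g x) (at x) (y - x)\<bar> \<le> (C + D) * (norm (y - x))\<^sup>2"
      unfolding d distrib_right by linarith
  qed
next
  case (mult f g)
  obtain C where C: "\<And>x y. x\<in>cball 0 R \<Longrightarrow> y\<in>cball 0 R \<Longrightarrow> \<bar>f x\<bar> \<le> C \<and> \<bar>f y - f x\<bar> \<le> C * norm (y - x) \<and>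
      \<bar>f y - f x - frechet_derivative f (at x) (y - x)\<bar> \<le> C * (norm (y - x))\<^sup>2"
    using mult.IH(1) by blast
  obtain D where D: "\<And>x y. x\<in>cball 0 R \<Longrightarrow> y\<in>cball 0 R \<Longrightarrow> \<bar>g x\<bar> \<le> D \<and> \<bar>g y - g x\<bar> \<le> D * norm (y - x) \<and>
      \<bar>g y - g x - frechet_derivative g (at x) (y - x)\<bar> \<le> D * (norm (y - x))\<^sup>2"
    using mult.IH(2) by blast
  have d: "frechet_derivative (\<lambda>x. f x * g x) (at x) =
      (\<lambda>h. f x * frechet_derivative g (at x) h + frechet_derivative f (at x) h * g x)" for x
    by (rule frechet_derivative_at[symmetric])
       (intro derivative_intros real_polynomial_function_has_derivative mult.hyps)
  show ?case
  \<comment> \<open>The remainder of a product consists of two terms of the form remainder times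
    value and of the product of the two increments; each is at most \<open>C * D\<close> times the
    squared distance.\<close>
  proof (intro exI[of _ "3 * (C * D)"] ballI)
    fix x y :: 'a assume xy: "x \<in> cball 0 R" "y \<in> cball 0 R"
    let ?n = "norm (y - x)"
    note c = C[OF xy] and e = D[OF xy] and c' = C[OF xy(2,1)] and e' = D[OF xy(2,1)]
    have CD: "0 \<le> C" "0 \<le> D" using c e by linarith+
    have "\<bar>f x\<bar> * \<bar>g x\<bar> \<le> C * D"
      using c e CD by (intro mult_mono) auto
    then have 1: "\<bar>f x * g x\<bar> \<le> C * D" by (simp add: abs_mult)
    have "\<bar>f x\<bar> * \<bar>g y - g x\<bar> \<le> C * (D * ?n)" "\<bar>f y - f x\<bar> * \<bar>g y\<bar> \<le> (C * ?n) * D"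
      using c e e' CD by (intro mult_mono; simp)+
    moreover have "f y * g y - f x * g x = f x * (g y - g x) + (f y - f x) * g y"
      by (simp add: algebra_simps)
    ultimately have "\<bar>f y * g y - f x * g x\<bar> \<le> C * (D * ?n) + (C * ?n) * D"
      using abs_triangle_ineq[of "f x * (g y - g x)" "(f y - f x) * g y"] unfolding abs_mult by linarith
    then have 2: "\<bar>f y * g y - f x * g x\<bar> \<le> 2 * (C * D) * ?n"
      by (simp add: algebra_simps)
    let ?rf = "f y - f x - frechet_derivative f (at x) (y - x)"
    let ?rg = "g y - g x - frechet_derivative g (at x) (y - x)"
    have "f y * g y - f x * g x - (f x * frechet_derivative g (at x) (y - x) + frechet_derivative f (at x) (y - x) * g x)
        = f x * ?rg + ?rf * g x + (f y - f x) * (g y - g x)"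
      by (simp add: algebra_simps)
    moreover have "\<bar>f x * ?rg\<bar> \<le> C * (D * ?n\<^sup>2)" "\<bar>?rf * g x\<bar> \<le> (C * ?n\<^sup>2) * D"
       "\<bar>(f y - f x) * (g y - g x)\<bar> \<le> (C * ?n) * (D * ?n)"
      unfolding abs_mult using c e CD by (intro mult_mono; simp)+
    ultimately have 3: "\<bar>f y * g y - f x * g x - (f x * frechet_derivative g (at x) (y - x) + frechet_derivative f (at x) (y - x) * g x)\<bar>
        \<le> C * (D * ?n\<^sup>2) + (C * ?n\<^sup>2) * D + (C * ?n) * (D * ?n)"
      by linarith
    have "0 \<le> C * D" "0 \<le> C * D * ?n" using CD by simp_all
    with 1 2 3 show "\<bar>f x * g x\<bar> \<le> 3 * (C * D) \<and> \<bar>f y * g y - f x * g x\<bar> \<le> 3 * (C * D) * ?n \<and>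
      \<bar>f y * g y - f x * g x - frechet_derivative (\<lambda>x. f x * g x) (at x) (y - x)\<bar> \<le> 3 * (C * D) * ?n\<^sup>2"
      unfolding d by (simp add: algebra_simps power2_eq_square)
  qed
qed

lemma polynomial_function_taylor:
  fixes f :: "'a::euclidean_space \<Rightarrow> 'b::euclidean_space"
  assumes "polynomial_function f"
  obtains C where "C > 0" "\<And>x. x \<in> cball 0 R \<Longrightarrow> norm (f x) \<le> C"
    "\<And>x y. x \<in> cball 0 R \<Longrightarrow> y \<in> cball 0 R \<Longrightarrow> norm (f y - f x) \<le> C * norm (y - x)"
    "\<And>x y. x \<in> cball 0 R \<Longrightarrow> y \<in> cball 0 R \<Longrightarrow>
       norm (f y - f x - frechet_derivative f (at x) (y - x)) \<le> C * (norm (y - x))\<^sup>2"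
proof -
  have p: "real_polynomial_function (\<lambda>x. f x \<bullet> b)" for b
    using assms bounded_linear_inner_left[of b] unfolding polynomial_function_def o_def by blast
  have d: "frechet_derivative (\<lambda>x. f x \<bullet> b) (at x) = (\<lambda>h. frechet_derivative f (at x) h \<bullet> b)" for b x
    by (rule frechet_derivative_at[symmetric])
       (intro derivative_intros polynomial_function_has_derivative assms)
  have "\<forall>b. \<exists>C. \<forall>x\<in>cball 0 R. \<forall>y\<in>cball 0 R. \<bar>f x \<bullet> b\<bar> \<le> C \<and> \<bar>f y \<bullet> b - f x \<bullet> b\<bar> \<le> C * norm (y - x) \<and>
      \<bar>f y \<bullet> b - f x \<bullet> b - frechet_derivative f (at x) (y - x) \<bullet> b\<bar> \<le> C * (norm (y - x))\<^sup>2"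
    using real_polynomial_function_taylor[OF p, unfolded d] by blast
  then obtain C where C: "\<And>b x y. x\<in>cball 0 R \<Longrightarrow> y\<in>cball 0 R \<Longrightarrow> \<bar>f x \<bullet> b\<bar> \<le> C b \<and> \<bar>(f y - f x) \<bullet> b\<bar> \<le> C b * norm (y - x) \<and>
      \<bar>(f y - f x - frechet_derivative f (at x) (y - x)) \<bullet> b\<bar> \<le> C b * (norm (y - x))\<^sup>2"
    unfolding inner_diff_left by metis
  define D where "D = (\<Sum>b\<in>Basis. C b)"
  have n: "norm z \<le> D * r" if "\<And>b. \<bar>z \<bullet> b\<bar> \<le> C b * r" for z r
  proof -
    have "norm z \<le> (\<Sum>b\<in>Basis. \<bar>z \<bullet> b\<bar>)" by (rule norm_le_l1)
    also have "\<dots> \<le> (\<Sum>b\<in>Basis. C b * r)" by (intro sum_mono that)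
    finally show ?thesis by (simp add: D_def sum_distrib_right)
  qed
  show thesis
  proof (rule that[of "\<bar>D\<bar> + 1"])
    have le: "D * r \<le> (\<bar>D\<bar> + 1) * r" if "r \<ge> 0" for r using that by (intro mult_right_mono) auto
    fix x y :: 'a assume x: "x \<in> cball 0 R"
    show "norm (f x) \<le> \<bar>D\<bar> + 1" using n[of "f x" 1] C[OF x x] by simp
    assume y: "y \<in> cball 0 R"
    show "norm (f y - f x) \<le> (\<bar>D\<bar> + 1) * norm (y - x)"
      using n[of "f y - f x" "norm (y - x)"] C[OF x y] le[of "norm (y - x)"] by simp
    show "norm (f y - f x - frechet_derivative f (at x) (y - x)) \<le> (\<bar>D\<bar> + 1) * (norm (y - x))\<^sup>2"
      using n[of "f y - f x - frechet_derivative f (at x) (y - x)" "(norm (y - x))\<^sup>2"] C[OF x y]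
        le[of "(norm (y - x))\<^sup>2"] by simp
  qed auto
qed

subsection \<open>Local flows\<close>

text \<open>Clamping time to \<open>{-\<delta>..\<delta>}\<close> with \<open>cl\<close> makes the
  Picard map act on bounded continuous functions on the whole line, a complete metric type on which
  the Banach fixed point theorem is available. The bound on \<open>L * \<delta>\<close> makes the
  map a contraction.\<close>

lemma picard_exists:
  fixes X :: "'a::euclidean_space \<Rightarrow> 'a"
  assumes X: "L-lipschitz_on UNIV X" and "\<delta> \<ge> 0" and L: "L * \<delta> \<le> 1/4"
  shows "\<exists>u. u 0 = x \<and> (\<forall>t\<in>{-\<delta>..\<delta>}. (u has_vector_derivative X (u t)) (at t within {-\<delta>..\<delta>}))"
proof -
  define cl where "cl t = max (-\<delta>) (min \<delta> t)" for t :: real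
  have cl: "cl t \<in> {-\<delta>..\<delta>}" "t \<in> {-\<delta>..\<delta>} \<Longrightarrow> cl t = t" for t
    using \<open>\<delta> \<ge> 0\<close> by (auto simp: cl_def)
  have cont_cl: "continuous_on UNIV cl"
    unfolding cl_def[abs_def] by (intro continuous_intros)
  have contX: "continuous_on UNIV X"
    using X lipschitz_on_continuous_on by blast
  define I where "I u t = integral {-\<delta>..t} (\<lambda>s. X (apply_bcontfun u s))" for u t
  have contXu: "continuous_on S (\<lambda>s. X (apply_bcontfun u s))" for u :: "real \<Rightarrow>\<^sub>C 'a" and S
    by (rule continuous_on_compose2[OF contX]) auto
  have contI: "continuous_on {-\<delta>..\<delta>} (I u)" for u
    unfolding I_def[abs_def] by (intro indefinite_integral_continuous_1 integrable_continuous_real contXu)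
  \<comment> \<open>\<open>I\<close> integrates from the left endpoint, so the difference from its
    value at 0 is the oriented integral from 0 to \<open>cl t\<close>, whatever the sign of
    \<open>t\<close>.\<close>
  define T where "T u t = x + (I u (cl t) - I u 0)" for u t
  have T: "T u \<in> bcontfun" for u
  proof -
    have "continuous_on UNIV (\<lambda>t. I u (cl t))"
      by (rule continuous_on_compose2[OF contI cont_cl]) (use cl in auto)
    then have c: "continuous_on UNIV (T u)"
      unfolding T_def[abs_def] by (intro continuous_intros)
    have "bounded (I u ` {-\<delta>..\<delta>})"
      by (intro compact_imp_bounded compact_continuous_image contI) auto
    then obtain B where "\<And>t. t \<in> {-\<delta>..\<delta>} \<Longrightarrow> norm (I u t) \<le> B"
      by (force simp: bounded_iff)
    then have "norm (T u t) \<le> norm x + (B + norm (I u 0))" for t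
      unfolding T_def by (meson add_mono cl(1) norm_triangle_le norm_triangle_le_diff order_refl)
    with c show ?thesis by (rule bcontfun_normI)
  qed
  have lip: "dist (Bcontfun (T u)) (Bcontfun (T v)) \<le> 1/2 * dist u v" for u v
  proof (rule dist_bound)
    fix t
    let ?d = "\<lambda>s. X (apply_bcontfun u s) - X (apply_bcontfun v s)"
    have I_eq: "I u r - I v r = integral {-\<delta>..r} ?d" for r
      unfolding I_def by (intro integral_diff[symmetric] integrable_continuous_real contXu)
    have "norm (integral {a..b} ?d) \<le> L * dist u v * (b - a)" if "a \<le> b" for a b
    proof (rule integral_bound[OF that])
      show "continuous_on {a..b} ?d" by (intro continuous_intros contXu)
      show "norm (?d s) \<le> L * dist u v" for s
        using lipschitz_onD[OF X, of "apply_bcontfun u s" "apply_bcontfun v s"] dist_bounded[of u s v]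
          mult_left_mono[OF dist_bounded[of u s v] lipschitz_on_nonneg[OF X]]
        by (simp add: dist_norm)
    qed
    moreover have "integral {-\<delta>..b} ?d - integral {-\<delta>..a} ?d = integral {a..b} ?d"
      if "-\<delta> \<le> a" "a \<le> b" for a b
    proof -
      have "integral {-\<delta>..a} ?d + integral {a..b} ?d = integral {-\<delta>..b} ?d"
        using that by (intro Henstock_Kurzweil_Integration.integral_combine integrable_continuous_real continuous_intros contXu) auto
      then show ?thesis by (simp add: algebra_simps)
    qed
    ultimately have "norm (integral {-\<delta>..b} ?d - integral {-\<delta>..a} ?d) \<le> L * dist u v * (b - a)"
      if "-\<delta> \<le> a" "a \<le> b" for a b using that by simp
    then have "norm (integral {-\<delta>..b} ?d - integral {-\<delta>..a} ?d) \<le> L * dist u v * \<bar>b - a\<bar>"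
      if "-\<delta> \<le> a" "-\<delta> \<le> b" for a b
      using that by (cases "a \<le> b") (fastforce simp: norm_minus_commute abs_if)+
    from this[of 0 "cl t"] have "norm (integral {-\<delta>..cl t} ?d - integral {-\<delta>..0} ?d) \<le> L * dist u v * \<bar>cl t\<bar>"
      using cl[of t] \<open>\<delta> \<ge> 0\<close> by simp
    also have "\<dots> \<le> L * dist u v * \<delta>"
      using cl[of t] lipschitz_on_nonneg[OF X] by (intro mult_left_mono) auto
    also have "\<dots> \<le> 1/2 * dist u v"
    proof -
      have "L * dist u v * \<delta> = (L * \<delta>) * dist u v" by simp
      also have "\<dots> \<le> 1/4 * dist u v" by (intro mult_right_mono L) simp
      also have "\<dots> \<le> 1/2 * dist u v" by simp
      finally show ?thesis .
    qed
    finally have "norm (integral {-\<delta>..cl t} ?d - integral {-\<delta>..0} ?d) \<le> 1/2 * dist u v" .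
    moreover have "T u t - T v t = integral {-\<delta>..cl t} ?d - integral {-\<delta>..0} ?d"
      using I_eq[of "cl t"] I_eq[of 0] by (simp add: T_def algebra_simps)
    ultimately show "dist (Bcontfun (T u) t) (Bcontfun (T v) t) \<le> 1/2 * dist u v"
      by (simp add: Bcontfun_inverse T dist_norm)
  qed
  obtain u where u: "Bcontfun (T u) = u"
    using banach_fix_type[of "1/2" "\<lambda>u. Bcontfun (T u)"] lip by auto
  then have uT: "apply_bcontfun u t = T u t" for t
    by (metis Bcontfun_inverse T)
  show ?thesis
  proof (intro exI[of _ "apply_bcontfun u"] conjI ballI)
    show "u 0 = x"
      using \<open>\<delta> \<ge> 0\<close> cl(2)[of 0] by (simp add: uT T_def)
    fix t assume t: "t \<in> {-\<delta>..\<delta>}"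
    have "(I u has_vector_derivative X (u t)) (at t within {-\<delta>..\<delta>})"
      unfolding I_def[abs_def] by (rule integral_has_vector_derivative[OF contXu t])
    then have "((\<lambda>t. x + (I u t - I u 0)) has_vector_derivative X (u t)) (at t within {-\<delta>..\<delta>})"
      by (auto intro!: derivative_eq_intros)
    then show "(apply_bcontfun u has_vector_derivative X (u t)) (at t within {-\<delta>..\<delta>})"
      by (rule has_vector_derivative_transform[OF t, rotated]) (simp add: uT T_def cl)
  qed
qed

lemma vector_derivative_bound:
  fixes f :: "real \<Rightarrow> 'a::euclidean_space"
  assumes "\<And>t. t \<in> S \<Longrightarrow> (f has_vector_derivative f' t) (at t within S)"
    and "\<And>t. t \<in> S \<Longrightarrow> norm (f' t) \<le> B" and "convex S" "s \<in> S" "t \<in> S"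
  shows "norm (f t - f s) \<le> B * \<bar>t - s\<bar>"
proof -
  have "B \<ge> 0" using assms(2)[OF assms(4)] norm_ge_zero order_trans by blast
  have "norm (f t - f s) \<le> B * norm (t - s)"
  proof (rule differentiable_bound[OF assms(3)])
    show "(f has_derivative (\<lambda>h. h *\<^sub>R f' r)) (at r within S)" if "r \<in> S" for r
      using assms(1)[OF that] by (simp add: has_vector_derivative_def)
    show "onorm (\<lambda>h. h *\<^sub>R f' r) \<le> B" if "r \<in> S" for r
      using assms(2)[OF that] \<open>B \<ge> 0\<close>
      by (intro onorm_bound) (auto simp: mult.commute[of B] intro: mult_left_mono)
  qed (use assms in auto)
  then show ?thesis by simp
qed

text \<open>A substitute for Gronwall's inequality on short intervals: at a time of maximal distance
  \<open>?m\<close> the difference of the curves has changed since time \<open>s\<close> by at most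
  \<open>L * ?m * (b - a)\<close>, hence by at most half of \<open>?m\<close>. For curves that meet
  at \<open>s\<close> this is uniqueness.\<close>

lemma integral_curves_dist:
  fixes X :: "'a::euclidean_space \<Rightarrow> 'a"
  assumes X: "L-lipschitz_on UNIV X" and L: "L * (b - a) \<le> 1/2"
    and u: "\<And>t. t \<in> {a..b} \<Longrightarrow> (u has_vector_derivative X (u t)) (at t within {a..b})"
    and v: "\<And>t. t \<in> {a..b} \<Longrightarrow> (v has_vector_derivative X (v t)) (at t within {a..b})"
    and s: "s \<in> {a..b}" and t: "t \<in> {a..b}"
  shows "norm (u t - v t) \<le> 2 * norm (u s - v s)"
proof -
  have "continuous_on {a..b} u" "continuous_on {a..b} v"
    using u v by (meson continuous_on_eq_continuous_within has_vector_derivative_continuous)+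
  then have "continuous_on {a..b} (\<lambda>t. norm (u t - v t))"
    by (intro continuous_intros)
  then obtain r where r: "r \<in> {a..b}" and max: "\<And>t. t \<in> {a..b} \<Longrightarrow> norm (u t - v t) \<le> norm (u r - v r)"
    using continuous_attains_sup[of "{a..b}" "\<lambda>t. norm (u t - v t)"] s by auto
  let ?m = "norm (u r - v r)"
  have L0: "L \<ge> 0" using lipschitz_on_nonneg[OF X] .
  have "norm ((u r - v r) - (u s - v s)) \<le> (L * ?m) * \<bar>r - s\<bar>"
  proof (rule vector_derivative_bound[where S="{a..b}"])
    show "((\<lambda>t. u t - v t) has_vector_derivative X (u t) - X (v t)) (at t within {a..b})" if "t \<in> {a..b}" for t
      using u[OF that] v[OF that] by (rule has_vector_derivative_diff)
    show "norm (X (u t) - X (v t)) \<le> L * ?m" if "t \<in> {a..b}" for t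
      using lipschitz_onD[OF X, of "u t" "v t"] mult_left_mono[OF max[OF that] L0] by (simp add: dist_norm)
  qed (use r s in auto)
  also have "\<dots> \<le> (L * ?m) * (b - a)"
    using r s L0 by (intro mult_left_mono) auto
  also have "\<dots> \<le> 1/2 * ?m"
    using mult_right_mono[OF L, of ?m] by (simp add: mult_ac)
  finally have "norm ((u r - v r) - (u s - v s)) \<le> 1/2 * ?m" .
  then have "?m \<le> 2 * norm (u s - v s)"
    using norm_triangle_ineq2[of "u r - v r" "u s - v s"] by linarith
  with max[OF t] show ?thesis by linarith
qed

text \<open>
  The Lipschitz bound on the second-order remainder in the last clause replaces differentiability of
  the flow in the initial point.
\<close>

definition is_local_flow ::
    "('a::euclidean_space \<Rightarrow> 'a) \<Rightarrow> real \<Rightarrow> real \<Rightarrow> real \<Rightarrow> (real \<Rightarrow> 'a \<Rightarrow> 'a) \<Rightarrow> bool" where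
  "is_local_flow Z R \<delta> C \<Psi> \<longleftrightarrow> \<delta> > 0 \<and> C > 0 \<and>
     (\<forall>x\<in>cball 0 R. \<Psi> 0 x = x) \<and>
     (\<forall>x\<in>cball 0 R. \<forall>s\<in>{-\<delta>..\<delta>}.
        ((\<lambda>t. \<Psi> t x) has_vector_derivative Z (\<Psi> s x)) (at s within {-\<delta>..\<delta>}) \<and>
        norm (\<Psi> s x - x) \<le> C * \<bar>s\<bar> \<and> norm (\<Psi> s x - x - s *\<^sub>R Z x) \<le> C * s\<^sup>2 \<and>
        (\<Psi> s x \<in> cball 0 R \<longrightarrow> \<Psi> (- s) (\<Psi> s x) = x) \<and>
        (\<forall>y\<in>cball 0 R. norm (\<Psi> s x - \<Psi> s y) \<le> C * norm (x - y) \<and>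
           norm ((\<Psi> s x - x - s *\<^sub>R Z x) - (\<Psi> s y - y - s *\<^sub>R Z y)) \<le> C * s\<^sup>2 * norm (x - y)))"

lemma polynomial_local_flow:
  fixes Z :: "'a::euclidean_space \<Rightarrow> 'a"
  assumes Z: "polynomial_function Z" and "R > 0"
  shows "\<exists>\<delta> C \<Psi>. is_local_flow Z R \<delta> C \<Psi>"
proof -
  let ?B = "cball 0 (R + 1) :: 'a set"
  obtain C1 where C1: "C1 > 0" "\<And>x. x \<in> ?B \<Longrightarrow> norm (Z x) \<le> C1"
    "\<And>x y. x \<in> ?B \<Longrightarrow> y \<in> ?B \<Longrightarrow> norm (Z y - Z x) \<le> C1 * norm (y - x)"
    using polynomial_function_taylor[OF Z] by metis
  \<comment> \<open>\<open>?W\<close> is the acceleration along integral curves of \<open>Z\<close>.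
    Its bound controls the second-order remainder of the flow, its Lipschitz constant the dependence
    of that remainder on the initial point.\<close>
  let ?W = "dirderiv Z Z"
  obtain C2 where C2: "C2 > 0" "\<And>x. x \<in> ?B \<Longrightarrow> norm (?W x) \<le> C2"
    "\<And>x y. x \<in> ?B \<Longrightarrow> y \<in> ?B \<Longrightarrow> norm (?W y - ?W x) \<le> C2 * norm (y - x)"
    using polynomial_function_taylor[OF polynomial_function_dirderiv[OF Z Z]] by metis
  \<comment> \<open>Projecting to a ball makes the field globally Lipschitz; short curves do not notice.\<close>
  define X where "X x = Z (closest_point ?B x)" for x
  have cp: "closest_point ?B x \<in> ?B" for x
    using \<open>R > 0\<close> by (intro closest_point_in_set) auto
  have XZ: "X x = Z x" if "x \<in> ?B" for x
    using that by (simp add: X_def closest_point_self)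
  have X: "C1-lipschitz_on UNIV X"
  proof (rule lipschitz_onI)
    fix x y :: 'a
    have "dist (closest_point ?B x) (closest_point ?B y) \<le> dist x y"
      using \<open>R > 0\<close> by (intro closest_point_lipschitz) auto
    then have "C1 * norm (closest_point ?B x - closest_point ?B y) \<le> C1 * dist x y"
      using C1(1) by (simp add: dist_norm)
    with C1(3)[OF cp cp, of x y] show "dist (X x) (X y) \<le> C1 * dist x y"
      by (simp add: X_def dist_norm)
  qed (use C1 in simp)
  have Xb: "norm (X x) \<le> C1" for x
    unfolding X_def by (rule C1(2)[OF cp])
  \<comment> \<open>In this time a curve of speed at most \<open>C1\<close> moves by at most 1/4, so
    from the ball of radius \<open>R\<close> it stays in the ball of radius \<open>R + 1\<close>,
    where \<open>X\<close> and \<open>Z\<close> agree. The same value meets the condition of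
    \<open>picard_exists\<close>.\<close>
  define \<delta> where "\<delta> = 1 / (4 * C1)"
  have \<delta>: "\<delta> > 0" "C1 * \<delta> = 1/4"
    using C1(1) by (simp_all add: \<delta>_def)
  let ?J = "{-\<delta>..\<delta>}"
  have "\<forall>x. \<exists>u. u 0 = x \<and> (\<forall>t\<in>?J. (u has_vector_derivative X (u t)) (at t within ?J))"
    using picard_exists[OF X] \<delta> by (simp add: less_imp_le)
  then obtain \<Phi> where \<Phi>0: "\<And>x. \<Phi> x 0 = x"
    and d\<Phi>: "\<And>x t. t \<in> ?J \<Longrightarrow> (\<Phi> x has_vector_derivative X (\<Phi> x t)) (at t within ?J)"
    by metis
  have J0: "0 \<in> ?J" using \<delta> by simp
  have near: "norm (\<Phi> x t - x) \<le> C1 * \<bar>t\<bar>" if "t \<in> ?J" for x t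
    using vector_derivative_bound[OF d\<Phi> Xb convex_real_interval(5) J0 that, of x] by (simp add: \<Phi>0)
  have stay: "\<Phi> x t \<in> ?B" if "x \<in> cball 0 R" "t \<in> ?J" for x t
  proof -
    have "C1 * \<bar>t\<bar> \<le> C1 * \<delta>"
      using that(2) C1(1) by (intro mult_left_mono) auto
    then have "norm (\<Phi> x t - x) \<le> 1"
      using near[OF that(2), of x] \<delta>(2) by linarith
    then show ?thesis
      using that(1) norm_triangle_sub[of "\<Phi> x t" x] by simp
  qed
  have dZ: "(\<Phi> x has_vector_derivative Z (\<Phi> x t)) (at t within ?J)" if "x \<in> cball 0 R" "t \<in> ?J" for x t
    using d\<Phi>[OF that(2), of x] XZ[OF stay[OF that]] by simp
  have dist: "norm (\<Phi> x t - \<Phi> y t) \<le> 2 * norm (x - y)" if "t \<in> ?J" for x y t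
    using integral_curves_dist[OF X _ d\<Phi> d\<Phi> J0 that, of x y] \<delta> by (simp add: \<Phi>0)
  have dW: "((\<lambda>t. Z (\<Phi> x t)) has_vector_derivative ?W (\<Phi> x t)) (at t within ?J)"
    if "x \<in> cball 0 R" "t \<in> ?J" for x t
  proof -
    have "((Z \<circ> \<Phi> x) has_derivative (frechet_derivative Z (at (\<Phi> x t)) \<circ> (\<lambda>h. h *\<^sub>R Z (\<Phi> x t)))) (at t within ?J)"
      by (intro diff_chain_within polynomial_function_has_derivative[OF Z])
         (use dZ[OF that] in \<open>simp add: has_vector_derivative_def\<close>)
    moreover have "frechet_derivative Z (at y) (h *\<^sub>R w) = h *\<^sub>R frechet_derivative Z (at y) w" for y h w
      using polynomial_function_has_derivative[OF Z, of y UNIV] has_derivative_linear linear_scale by blast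
    ultimately show ?thesis
      by (simp add: has_vector_derivative_def o_def dirderiv_def)
  qed
  have sJ: "{- \<bar>s\<bar>..\<bar>s\<bar>} \<subseteq> ?J" if "s \<in> ?J" for s using that by auto
  have second: "norm (\<Phi> x s - x - s *\<^sub>R Z x) \<le> C2 * s\<^sup>2" if x: "x \<in> cball 0 R" and s: "s \<in> ?J" for x s
  proof -
    have Zd: "norm (Z (\<Phi> x t) - Z x) \<le> C2 * \<bar>t\<bar>" if "t \<in> ?J" for t
      using vector_derivative_bound[OF dW[OF x] C2(2)[OF stay[OF x]] _ J0 that] by (simp add: \<Phi>0)
    have "norm ((\<Phi> x s - s *\<^sub>R Z x) - (\<Phi> x 0 - 0 *\<^sub>R Z x)) \<le> (C2 * \<bar>s\<bar>) * \<bar>s - 0\<bar>"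
    proof (rule vector_derivative_bound[where S="{-\<bar>s\<bar>..\<bar>s\<bar>}"])
      fix t assume t: "t \<in> {-\<bar>s\<bar>..\<bar>s\<bar>}"
      then have tJ: "t \<in> ?J" using sJ[OF s] by blast
      have "(\<Phi> x has_vector_derivative Z (\<Phi> x t)) (at t within {-\<bar>s\<bar>..\<bar>s\<bar>})"
        using dZ[OF x tJ] has_vector_derivative_within_subset sJ[OF s] by blast
      then show "((\<lambda>t. \<Phi> x t - t *\<^sub>R Z x) has_vector_derivative (Z (\<Phi> x t) - Z x)) (at t within {-\<bar>s\<bar>..\<bar>s\<bar>})"
        by (auto intro!: derivative_eq_intros)
      have "C2 * \<bar>t\<bar> \<le> C2 * \<bar>s\<bar>" using t C2(1) by (intro mult_left_mono) auto
      with Zd[OF tJ] show "norm (Z (\<Phi> x t) - Z x) \<le> C2 * \<bar>s\<bar>" by linarith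
    qed auto
    then show ?thesis by (simp add: \<Phi>0 algebra_simps power2_eq_square)
  qed
  \<comment> \<open>Subtracting the two curves before integrating twice keeps the factor
    \<open>norm (x - y)\<close>: their accelerations differ by at most \<open>C2\<close> times their
    distance, which is at most \<open>2 * norm (x - y)\<close>.\<close>
  have third: "norm ((\<Phi> x s - x - s *\<^sub>R Z x) - (\<Phi> y s - y - s *\<^sub>R Z y)) \<le> 2 * C2 * s\<^sup>2 * norm (x - y)"
    if x: "x \<in> cball 0 R" and y: "y \<in> cball 0 R" and s: "s \<in> ?J" for x y s
  proof -
    let ?n = "norm (x - y)"
    have Zd: "norm ((Z (\<Phi> x t) - Z (\<Phi> y t)) - (Z x - Z y)) \<le> (C2 * (2 * ?n)) * \<bar>t\<bar>" if "t \<in> ?J" for t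
    proof -
      have "norm ((Z (\<Phi> x t) - Z (\<Phi> y t)) - (Z (\<Phi> x 0) - Z (\<Phi> y 0))) \<le> (C2 * (2 * ?n)) * \<bar>t - 0\<bar>"
      proof (rule vector_derivative_bound[OF _ _ _ J0 that])
        fix t assume t: "t \<in> ?J"
        show "((\<lambda>t. Z (\<Phi> x t) - Z (\<Phi> y t)) has_vector_derivative ?W (\<Phi> x t) - ?W (\<Phi> y t)) (at t within ?J)"
          by (intro has_vector_derivative_diff dW x y t)
        have "C2 * norm (\<Phi> x t - \<Phi> y t) \<le> C2 * (2 * ?n)"
          using dist[OF t] C2(1) by (intro mult_left_mono) auto
        then show "norm (?W (\<Phi> x t) - ?W (\<Phi> y t)) \<le> C2 * (2 * ?n)"
          using C2(3)[OF stay[OF y t] stay[OF x t]] by linarith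
      qed simp
      then show ?thesis by (simp add: \<Phi>0)
    qed
    have "norm ((\<Phi> x s - \<Phi> y s - s *\<^sub>R (Z x - Z y)) - (\<Phi> x 0 - \<Phi> y 0 - 0 *\<^sub>R (Z x - Z y)))
        \<le> (C2 * (2 * ?n) * \<bar>s\<bar>) * \<bar>s - 0\<bar>"
    proof (rule vector_derivative_bound[where S="{-\<bar>s\<bar>..\<bar>s\<bar>}"])
      fix t assume t: "t \<in> {-\<bar>s\<bar>..\<bar>s\<bar>}"
      then have tJ: "t \<in> ?J" using sJ[OF s] by blast
      have "(\<Phi> z has_vector_derivative Z (\<Phi> z t)) (at t within {-\<bar>s\<bar>..\<bar>s\<bar>})" if "z \<in> cball 0 R" for z
        using dZ[OF that tJ] has_vector_derivative_within_subset sJ[OF s] by blast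
      from this[OF x] this[OF y] show "((\<lambda>t. \<Phi> x t - \<Phi> y t - t *\<^sub>R (Z x - Z y))
          has_vector_derivative (Z (\<Phi> x t) - Z (\<Phi> y t)) - (Z x - Z y)) (at t within {-\<bar>s\<bar>..\<bar>s\<bar>})"
        by (auto intro!: derivative_eq_intros)
      have "C2 * (2 * ?n) * \<bar>t\<bar> \<le> C2 * (2 * ?n) * \<bar>s\<bar>" using t C2(1) by (intro mult_left_mono) auto
      with Zd[OF tJ] show "norm ((Z (\<Phi> x t) - Z (\<Phi> y t)) - (Z x - Z y)) \<le> C2 * (2 * ?n) * \<bar>s\<bar>" by linarith
    qed auto
    then show ?thesis
      by (simp add: \<Phi>0 algebra_simps power2_eq_square)
  qed
  have inv: "\<Phi> (\<Phi> x s) (- s) = x" if s: "s \<in> ?J" for x s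
  proof -
    \<comment> \<open>The curve restarted at \<open>\<Phi> x s\<close> and the time-shifted curve
      through \<open>\<Phi> x (t + s)\<close> agree at time 0. They are compared on the interval
      between 0 and \<open>-s\<close>, where the shifted time also stays in
      \<open>?J\<close>.\<close>
    define a b where "a = min 0 (-s)" and "b = max 0 (-s)"
    have ab: "{a..b} \<subseteq> ?J" "(\<lambda>t. t + s) ` {a..b} \<subseteq> ?J" "0 \<in> {a..b}" "-s \<in> {a..b}" "b - a \<le> \<delta>"
      using s by (auto simp: a_def b_def min_def max_def)
    have "norm (\<Phi> (\<Phi> x s) (- s) - \<Phi> x (- s + s)) \<le> 2 * norm (\<Phi> (\<Phi> x s) 0 - \<Phi> x (0 + s))"
    proof (rule integral_curves_dist[OF X _ _ _ ab(3,4)])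
      show "C1 * (b - a) \<le> 1/2"
        using mult_left_mono[OF ab(5), of C1] C1(1) \<delta> by simp
      fix t assume t: "t \<in> {a..b}"
      show "(\<Phi> (\<Phi> x s) has_vector_derivative X (\<Phi> (\<Phi> x s) t)) (at t within {a..b})"
        using d\<Phi>[of t "\<Phi> x s"] t ab(1) has_vector_derivative_within_subset by blast
      have "((\<Phi> x \<circ> (\<lambda>t. t + s)) has_vector_derivative 1 *\<^sub>R X (\<Phi> x (t + s))) (at t within {a..b})"
      proof (rule vector_diff_chain_within)
        show "((\<lambda>t. t + s) has_vector_derivative 1) (at t within {a..b})"
          by (auto intro!: derivative_eq_intros)
        show "(\<Phi> x has_vector_derivative X (\<Phi> x (t + s))) (at (t + s) within (\<lambda>t. t + s) ` {a..b})"
          using d\<Phi>[of "t + s" x] t ab(2) has_vector_derivative_within_subset by blast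
      qed
      then show "((\<lambda>t. \<Phi> x (t + s)) has_vector_derivative X (\<Phi> x (t + s))) (at t within {a..b})"
        by (simp add: o_def)
    qed
    then show ?thesis by (simp add: \<Phi>0)
  qed
  define C where "C = C1 + 2 * C2 + 2"
  have C: "C > 0" "C1 \<le> C" "C2 \<le> C" "2 * C2 \<le> C" "2 \<le> C"
    using C1(1) C2(1) by (simp_all add: C_def)
  have "is_local_flow Z R \<delta> C (\<lambda>t x. \<Phi> x t)"
    unfolding is_local_flow_def
  proof (intro conjI ballI impI)
    fix x :: 'a and s assume x: "x \<in> cball 0 R" and s: "s \<in> ?J"
    show "(\<Phi> x has_vector_derivative Z (\<Phi> x s)) (at s within ?J)" by (rule dZ[OF x s])
    show "norm (\<Phi> x s - x) \<le> C * \<bar>s\<bar>"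
      using near[OF s, of x] mult_right_mono[OF C(2), of "\<bar>s\<bar>"] by linarith
    show "norm (\<Phi> x s - x - s *\<^sub>R Z x) \<le> C * s\<^sup>2"
      using second[OF x s] mult_right_mono[OF C(3), of "s\<^sup>2"] by simp
    show "\<Phi> (\<Phi> x s) (- s) = x" by (rule inv[OF s])
    fix y :: 'a assume y: "y \<in> cball 0 R"
    show "norm (\<Phi> x s - \<Phi> y s) \<le> C * norm (x - y)"
      using dist[OF s, of x y] mult_right_mono[OF C(5), of "norm (x - y)"] by simp
    have "2 * C2 * (s\<^sup>2 * norm (x - y)) \<le> C * (s\<^sup>2 * norm (x - y))"
      using C(4) by (intro mult_right_mono) auto
    then show "norm ((\<Phi> x s - x - s *\<^sub>R Z x) - (\<Phi> y s - y - s *\<^sub>R Z y)) \<le> C * s\<^sup>2 * norm (x - y)"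
      using third[OF x y s] by (simp add: mult.assoc)
  qed (use \<Phi>0 \<delta> C in auto)
  then show ?thesis by blast
qed

text \<open>Over a unit step in the direction of \<open>k\<close>, the increment of \<open>f\<close>
  and its Taylor remainder are both at most \<open>C\<close> on the ball of radius
  \<open>R + 1\<close>. The derivative is their difference, whence the factor 2.\<close>

lemma polynomial_function_derivative_bound:
  fixes f :: "'a::euclidean_space \<Rightarrow> 'b::euclidean_space"
  assumes "polynomial_function f"
  obtains C where "C > 0"
    "\<And>x k. x \<in> cball 0 R \<Longrightarrow> norm (frechet_derivative f (at x) k) \<le> C * norm k"
proof -
  obtain C where C: "C > 0"
    "\<And>x y. x \<in> cball 0 (R + 1) \<Longrightarrow> y \<in> cball 0 (R + 1) \<Longrightarrow> norm (f y - f x) \<le> C * norm (y - x)"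
    "\<And>x y. x \<in> cball 0 (R + 1) \<Longrightarrow> y \<in> cball 0 (R + 1) \<Longrightarrow>
       norm (f y - f x - frechet_derivative f (at x) (y - x)) \<le> C * (norm (y - x))\<^sup>2"
    using polynomial_function_taylor[OF assms] by metis
  show thesis
  proof (rule that[of "2 * C"])
    fix x :: 'a and k assume x: "x \<in> cball 0 R"
    let ?D = "frechet_derivative f (at x)"
    have lin: "?D (c *\<^sub>R k) = c *\<^sub>R ?D k" for c k
      using polynomial_function_has_derivative[OF assms, of x UNIV] has_derivative_linear linear_scale by blast
    show "norm (?D k) \<le> 2 * C * norm k"
    proof (cases "k = 0")
      case True
      then show ?thesis using lin[of 0 0] by simp
    next
      case False
      let ?y = "x + k /\<^sub>R norm k"
      have n1: "norm (k /\<^sub>R norm k) = 1" using False by simp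
      have x1: "x \<in> cball 0 (R + 1)" using x by simp
      have "norm ?y \<le> R + 1" using norm_triangle_mono[of x R "k /\<^sub>R norm k" 1] x n1 by simp
      then have y1: "?y \<in> cball 0 (R + 1)" by simp
      have "norm (f ?y - f x) \<le> C" using C(2)[OF x1 y1] n1 by simp
      moreover have "norm (f ?y - f x - ?D (k /\<^sub>R norm k)) \<le> C" using C(3)[OF x1 y1] n1 by simp
      ultimately have "norm (?D (k /\<^sub>R norm k)) \<le> 2 * C"
        using norm_triangle_ineq4[of "f ?y - f x" "f ?y - f x - ?D (k /\<^sub>R norm k)"] by simp
      then have "norm (?D k) / norm k \<le> 2 * C" by (simp add: lin divide_inverse mult.commute)
      then show ?thesis using False by (simp add: pos_divide_le_eq)
    qed
  qed (use C in simp)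
qed

lemma local_flowD:
  assumes "is_local_flow Z R \<delta> C \<Psi>" "x \<in> cball 0 R" "s \<in> {-\<delta>..\<delta>}"
  shows "((\<lambda>t. \<Psi> t x) has_vector_derivative Z (\<Psi> s x)) (at s within {-\<delta>..\<delta>})"
    "norm (\<Psi> s x - x) \<le> C * \<bar>s\<bar>" "norm (\<Psi> s x - x - s *\<^sub>R Z x) \<le> C * s\<^sup>2"
    "\<Psi> s x \<in> cball 0 R \<Longrightarrow> \<Psi> (- s) (\<Psi> s x) = x"
    "y \<in> cball 0 R \<Longrightarrow> norm (\<Psi> s x - \<Psi> s y) \<le> C * norm (x - y)"
    "y \<in> cball 0 R \<Longrightarrow>
       norm ((\<Psi> s x - x - s *\<^sub>R Z x) - (\<Psi> s y - y - s *\<^sub>R Z y)) \<le> C * s\<^sup>2 * norm (x - y)"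
proof -
  have 1: "((\<lambda>t. \<Psi> t x) has_vector_derivative Z (\<Psi> s x)) (at s within {-\<delta>..\<delta>}) \<and>
        norm (\<Psi> s x - x) \<le> C * \<bar>s\<bar> \<and> norm (\<Psi> s x - x - s *\<^sub>R Z x) \<le> C * s\<^sup>2 \<and>
        (\<Psi> s x \<in> cball 0 R \<longrightarrow> \<Psi> (- s) (\<Psi> s x) = x) \<and>
        (\<forall>y\<in>cball 0 R. norm (\<Psi> s x - \<Psi> s y) \<le> C * norm (x - y) \<and>
           norm ((\<Psi> s x - x - s *\<^sub>R Z x) - (\<Psi> s y - y - s *\<^sub>R Z y)) \<le> C * s\<^sup>2 * norm (x - y))"
    by (rule assms(1)[unfolded is_local_flow_def, THEN conjunct2, THEN conjunct2, THEN conjunct2,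
          THEN bspec, OF assms(2), THEN bspec, OF assms(3)])
  then show "((\<lambda>t. \<Psi> t x) has_vector_derivative Z (\<Psi> s x)) (at s within {-\<delta>..\<delta>})"
    "norm (\<Psi> s x - x) \<le> C * \<bar>s\<bar>" "norm (\<Psi> s x - x - s *\<^sub>R Z x) \<le> C * s\<^sup>2"
    "\<Psi> s x \<in> cball 0 R \<Longrightarrow> \<Psi> (- s) (\<Psi> s x) = x"
    by simp_all
  show "norm (\<Psi> s x - \<Psi> s y) \<le> C * norm (x - y)"
    "norm ((\<Psi> s x - x - s *\<^sub>R Z x) - (\<Psi> s y - y - s *\<^sub>R Z y)) \<le> C * s\<^sup>2 * norm (x - y)"
    if "y \<in> cball 0 R"
    using 1 that by (simp_all only: Ball_def)
qed

text \<open>Joint continuity comes from continuity in time at a fixed point together with a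
  Lipschitz bound in space that is uniform in time.\<close>

lemma local_flow_continuous:
  assumes "is_local_flow Z R \<delta> C \<Psi>"
  shows "continuous_on ({-\<delta>..\<delta>} \<times> cball 0 R) (\<lambda>(s, x). \<Psi> s x)"
  unfolding continuous_on_def
proof (clarify)
  fix s x assume s: "s \<in> {-\<delta>..\<delta>}" and x: "x \<in> cball (0::'a) R"
  let ?S = "{-\<delta>..\<delta>} \<times> cball 0 R" and ?F = "at (s, x) within {-\<delta>..\<delta>} \<times> cball 0 R"
  have "continuous_on {-\<delta>..\<delta>} (\<lambda>t. \<Psi> t x)"
    using local_flowD(1)[OF assms x]
    by (meson continuous_on_eq_continuous_within has_vector_derivative_continuous)
  then have "continuous_on ?S (\<lambda>p. \<Psi> (fst p) x)"
    by (rule continuous_on_compose2) (auto intro!: continuous_intros)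
  then have 1: "((\<lambda>p. \<Psi> (fst p) x) \<longlongrightarrow> \<Psi> s x) ?F"
    using s x unfolding continuous_on_def by (metis SigmaI fst_conv)
  have "((\<lambda>p. C * norm (snd p - x)) \<longlongrightarrow> C * norm (snd (s, x) - x)) ?F"
    by (intro tendsto_intros)
  then have "((\<lambda>p. C * norm (snd p - x)) \<longlongrightarrow> 0) ?F" by simp
  then have 2: "((\<lambda>p. \<Psi> (fst p) (snd p) - \<Psi> (fst p) x) \<longlongrightarrow> 0) ?F"
  proof (rule Lim_null_comparison[rotated])
    show "\<forall>\<^sub>F p in ?F. norm (\<Psi> (fst p) (snd p) - \<Psi> (fst p) x) \<le> C * norm (snd p - x)"
    proof (rule eventually_mono)
      show "\<forall>\<^sub>F p in ?F. p \<in> ?S" by (simp add: eventually_at_filter)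
      show "norm (\<Psi> (fst p) (snd p) - \<Psi> (fst p) x) \<le> C * norm (snd p - x)" if "p \<in> ?S" for p
        using local_flowD(5)[OF assms _ _ x] that by auto
    qed
  qed
  from tendsto_add[OF 2 1] show "((\<lambda>(s, x). \<Psi> s x) \<longlongrightarrow> \<Psi> s x) ?F"
    by (simp add: case_prod_unfold)
qed

lemma local_flow_reachable:
  assumes fl: "is_local_flow Z R \<delta> C \<Psi>" and "Z \<in> \<Z>" and x: "x \<in> cball 0 R" and s: "s \<in> {-\<delta>..\<delta>}"
    and M: "\<And>t. \<bar>t\<bar> \<le> \<bar>s\<bar> \<Longrightarrow> \<Psi> t x \<in> M"
  shows "reachable M \<Z> x (\<Psi> s x)"
proof -
  have "((\<lambda>t. \<Psi> (s * t) x) has_vector_derivative s *\<^sub>R Z (\<Psi> (s * t) x)) (at t within {0..1})"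
    if t: "t \<in> {0..1}" for t
  proof -
    have st: "s * r \<in> {-\<delta>..\<delta>}" if "r \<in> {0..1}" for r
    proof -
      have "\<bar>s * r\<bar> \<le> \<bar>s\<bar> * 1" unfolding abs_mult using that by (intro mult_left_mono) auto
      with s show ?thesis by auto
    qed
    have "(((\<lambda>r. \<Psi> r x) \<circ> (\<lambda>t. s * t)) has_vector_derivative s *\<^sub>R Z (\<Psi> (s * t) x)) (at t within {0..1})"
    proof (rule vector_diff_chain_within)
      show "((\<lambda>t. s * t) has_vector_derivative s) (at t within {0..1})"
        by (auto intro!: derivative_eq_intros)
      have "((\<lambda>r. \<Psi> r x) has_vector_derivative Z (\<Psi> (s * t) x)) (at (s * t) within {-\<delta>..\<delta>})"
        by (rule local_flowD(1)[OF fl x st[OF t]])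
      then show "((\<lambda>r. \<Psi> r x) has_vector_derivative Z (\<Psi> (s * t) x)) (at (s * t) within (\<lambda>t. s * t) ` {0..1})"
        by (rule has_vector_derivative_within_subset) (use st in auto)
    qed
    then show ?thesis by (simp add: o_def)
  qed
  moreover have "(\<lambda>t. \<Psi> (s * t) x) ` {0..1} \<subseteq> M"
    by (auto intro!: M simp: abs_mult mult_left_le)
  moreover have "\<Psi> 0 x = x" using fl x unfolding is_local_flow_def by blast
  ultimately have "flow_step M \<Z> x (\<Psi> s x)"
    unfolding flow_step_def using \<open>Z \<in> \<Z>\<close>
    by (intro bexI[of _ Z] exI[of _ s] exI[of _ "\<lambda>t. \<Psi> (s * t) x"]) auto
  then show ?thesis unfolding reachable_def by blast
qed

subsection \<open>Approximable fields\<close>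

text \<open>\<open>K\<close> is the set of uniformity and \<open>P\<close> a parameter space:
  \<open>{-1..1}\<close> for the multiples of one field, the unit ball when Brouwer's theorem is
  applied. The accuracy \<open>\<epsilon>\<close> is kept fixed because conjugation yields a field
  that depends on \<open>s\<close> and is approximated only up to a multiple of
  \<open>s\<^sup>2\<close>.\<close>

definition approx_on :: "'a::euclidean_space set \<Rightarrow> ('a \<Rightarrow> 'a) set \<Rightarrow> 'a set \<Rightarrow> real \<Rightarrow>
    'p::metric_space set \<Rightarrow> ('p \<Rightarrow> 'a \<Rightarrow> 'a) \<Rightarrow> bool" where
  "approx_on M \<Z> K \<epsilon> P V \<longleftrightarrow> (\<exists>\<delta>>0. \<forall>h. 0 < h \<and> h < \<delta> \<longrightarrow>
     (\<exists>\<Phi>. continuous_on (P \<times> K) (\<lambda>(p, x). \<Phi> p x) \<and>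
        (\<forall>p\<in>P. \<forall>x\<in>K. reachable M \<Z> x (\<Phi> p x) \<and> norm (\<Phi> p x - x - h *\<^sub>R V p x) \<le> \<epsilon> * h)))"

definition approximable :: "'a::euclidean_space set \<Rightarrow> ('a \<Rightarrow> 'a) set \<Rightarrow>
    'p::metric_space set \<Rightarrow> ('p \<Rightarrow> 'a \<Rightarrow> 'a) \<Rightarrow> bool" where
  "approximable M \<Z> P V \<longleftrightarrow> (\<forall>K \<epsilon>. compact K \<and> K \<subseteq> M \<and> \<epsilon> > 0 \<longrightarrow> approx_on M \<Z> K \<epsilon> P V)"

lemma approx_on_mono:
  assumes "approx_on M \<Z> K \<epsilon> P V" "\<epsilon> \<le> \<epsilon>'"
  shows "approx_on M \<Z> K \<epsilon>' P V"
proof -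
  obtain \<delta> where \<delta>: "\<delta> > 0" and a: "\<And>h. 0 < h \<and> h < \<delta> \<Longrightarrow> \<exists>\<Phi>. continuous_on (P \<times> K) (\<lambda>(p, x). \<Phi> p x) \<and>
        (\<forall>p\<in>P. \<forall>x\<in>K. reachable M \<Z> x (\<Phi> p x) \<and> norm (\<Phi> p x - x - h *\<^sub>R V p x) \<le> \<epsilon> * h)"
    using assms(1) unfolding approx_on_def by blast
  show ?thesis
    unfolding approx_on_def
  proof (intro exI[of _ \<delta>] conjI allI impI \<delta>)
    fix h assume h: "0 < h \<and> h < \<delta>"
    then have "\<epsilon> * h \<le> \<epsilon>' * h" using assms(2) by (intro mult_right_mono) auto
    with a[OF h] show "\<exists>\<Phi>. continuous_on (P \<times> K) (\<lambda>(p, x). \<Phi> p x) \<and>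
        (\<forall>p\<in>P. \<forall>x\<in>K. reachable M \<Z> x (\<Phi> p x) \<and> norm (\<Phi> p x - x - h *\<^sub>R V p x) \<le> \<epsilon>' * h)"
      by (meson order_trans)
  qed
qed

text \<open>The map for step \<open>h * c\<close> serves the field \<open>c *\<^sub>R V p x\<close>
  with step \<open>h\<close>. For \<open>c = 1 / s\<close> this turns an error of order
  \<open>s\<^sup>2\<close> into one of order \<open>s\<close>.\<close>

lemma approx_on_scale:
  assumes "approx_on M \<Z> K \<epsilon> P V" "c > 0"
  shows "approx_on M \<Z> K (c * \<epsilon>) P (\<lambda>p x. c *\<^sub>R V p x)"
proof -
  obtain \<delta> where \<delta>: "\<delta> > 0" and a: "\<And>h. 0 < h \<and> h < \<delta> \<Longrightarrow> \<exists>\<Phi>. continuous_on (P \<times> K) (\<lambda>(p, x). \<Phi> p x) \<and>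
        (\<forall>p\<in>P. \<forall>x\<in>K. reachable M \<Z> x (\<Phi> p x) \<and> norm (\<Phi> p x - x - h *\<^sub>R V p x) \<le> \<epsilon> * h)"
    using assms(1) unfolding approx_on_def by blast
  show ?thesis
    unfolding approx_on_def
  proof (intro exI[of _ "\<delta> / c"] conjI allI impI)
    show "0 < \<delta> / c" using \<delta> assms(2) by simp
    fix h assume h: "0 < h \<and> h < \<delta> / c"
    then have "0 < h * c \<and> h * c < \<delta>" using assms(2) by (simp add: pos_less_divide_eq)
    from a[OF this] show "\<exists>\<Phi>. continuous_on (P \<times> K) (\<lambda>(p, x). \<Phi> p x) \<and>
        (\<forall>p\<in>P. \<forall>x\<in>K. reachable M \<Z> x (\<Phi> p x) \<and> norm (\<Phi> p x - x - h *\<^sub>R (c *\<^sub>R V p x)) \<le> c * \<epsilon> * h)"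
      by (simp add: mult_ac)
  qed
qed

lemma approx_on_reparam:
  assumes "approx_on M \<Z> K \<epsilon> P V" "continuous_on Q c" "c ` Q \<subseteq> P"
  shows "approx_on M \<Z> K \<epsilon> Q (\<lambda>q. V (c q))"
proof -
  obtain \<delta> where \<delta>: "\<delta> > 0" and a: "\<And>h. 0 < h \<and> h < \<delta> \<Longrightarrow> \<exists>\<Phi>. continuous_on (P \<times> K) (\<lambda>(p, x). \<Phi> p x) \<and>
        (\<forall>p\<in>P. \<forall>x\<in>K. reachable M \<Z> x (\<Phi> p x) \<and> norm (\<Phi> p x - x - h *\<^sub>R V p x) \<le> \<epsilon> * h)"
    using assms(1) unfolding approx_on_def by blast
  show ?thesis
    unfolding approx_on_def
  proof (intro exI[of _ \<delta>] conjI allI impI \<delta>)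
    fix h assume h: "0 < h \<and> h < \<delta>"
    from a[OF h] obtain \<Phi> where \<Phi>: "continuous_on (P \<times> K) (\<lambda>(p, x). \<Phi> p x)"
      "\<And>p x. p \<in> P \<Longrightarrow> x \<in> K \<Longrightarrow> reachable M \<Z> x (\<Phi> p x) \<and> norm (\<Phi> p x - x - h *\<^sub>R V p x) \<le> \<epsilon> * h"
      by blast
    have "continuous_on (Q \<times> K) (\<lambda>q. (\<lambda>(p, x). \<Phi> p x) (c (fst q), snd q))"
      by (rule continuous_on_compose2[OF \<Phi>(1)])
         (use assms(3) in \<open>auto intro!: continuous_on_Pair continuous_on_compose2[OF assms(2)]
            continuous_on_fst continuous_on_snd continuous_on_id\<close>)
    then have "continuous_on (Q \<times> K) (\<lambda>(q, x). \<Phi> (c q) x)"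
      by (simp add: case_prod_unfold)
    with \<Phi>(2) assms(3) show "\<exists>\<Phi>. continuous_on (Q \<times> K) (\<lambda>(p, x). \<Phi> p x) \<and>
        (\<forall>p\<in>Q. \<forall>x\<in>K. reachable M \<Z> x (\<Phi> p x) \<and> norm (\<Phi> p x - x - h *\<^sub>R V (c p) x) \<le> \<epsilon> * h)"
      by (intro exI[of _ "\<lambda>q. \<Phi> (c q)"]) auto
  qed
qed

lemma approximable_reparam:
  assumes "approximable M \<Z> P V" "continuous_on Q c" "c ` Q \<subseteq> P"
  shows "approximable M \<Z> Q (\<lambda>q. V (c q))"
  unfolding approximable_def
  by (intro allI impI approx_on_reparam[OF _ assms(2,3)]) (use assms(1) in \<open>simp add: approximable_def\<close>)

text \<open>\<open>K1\<close> is the closed \<open>\<rho>\<close>-neighbourhood of \<open>K\<close>,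
  compact as a sum of two compact sets. It receives the points that short moves push out of
  \<open>K\<close>, and \<open>R\<close> gives a ball on which flows and Taylor constants can be
  taken.\<close>

lemma compact_neighbourhood:
  fixes K :: "'a::euclidean_space set"
  assumes "compact K" "open M" "K \<subseteq> M"
  obtains \<rho> K1 R where "\<rho> > 0" "compact K1" "K1 \<subseteq> M" "R > 0" "K1 \<subseteq> cball 0 R" "K \<subseteq> K1"
    "\<And>x y. x \<in> K \<Longrightarrow> norm (y - x) \<le> \<rho> \<Longrightarrow> y \<in> K1"
proof -
  obtain \<rho> where \<rho>: "\<rho> > 0" "(\<Union>x\<in>K. cball x \<rho>) \<subseteq> M"
    using compact_subset_open_imp_cball_epsilon_subset[OF assms] by blast
  have "(\<Union>x\<in>K. cball x \<rho>) = {x + y | x y. x \<in> K \<and> y \<in> cball 0 \<rho>}" (is "?K1 = _")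
  proof safe
    fix x y :: 'a assume "x \<in> K" "y \<in> cball x \<rho>"
    then show "\<exists>x' z. y = x' + z \<and> x' \<in> K \<and> z \<in> cball 0 \<rho>"
      by (intro exI[of _ x] exI[of _ "y - x"]) (auto simp: dist_norm norm_minus_commute)
  next
    fix x y :: 'a assume "x \<in> K" "y \<in> cball 0 \<rho>"
    then show "x + y \<in> ?K1" by (auto simp: dist_norm intro!: bexI[of _ x])
  qed
  then have c: "compact ?K1"
    using compact_sums[OF assms(1) compact_cball[of 0 \<rho>]] by simp
  then obtain R where R: "R > 0" "\<And>x. x \<in> ?K1 \<Longrightarrow> norm x \<le> R"
    using compact_imp_bounded bounded_pos by metis
  show thesis
  proof (rule that[OF \<rho>(1) c \<rho>(2) R(1)])
    show "?K1 \<subseteq> cball 0 R" using R(2) by (simp add: subset_eq)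
    show "K \<subseteq> ?K1" using \<rho>(1) by force
    show "y \<in> ?K1" if "x \<in> K" "norm (y - x) \<le> \<rho>" for x y
      using that by (auto simp: dist_norm norm_minus_commute)
  qed
qed

text \<open>The maps are composed, the one for \<open>W\<close> first. The fields enter unequally:
  \<open>W\<close> is known on \<open>K\<close> and with one accuracy only, whereas \<open>V\<close>
  is evaluated at points that have left \<open>K\<close>. Half of \<open>\<epsilon>\<^sub>2\<close>
  pays for approximating \<open>V\<close>, the other half for evaluating it at the moved
  point.\<close>

lemma approx_on_add:
  fixes V W :: "'p::metric_space \<Rightarrow> 'a::euclidean_space \<Rightarrow> 'a"
  assumes M: "open M" and K: "compact K" "K \<subseteq> M" and P: "compact P"
    and W: "approx_on M \<Z> K \<epsilon>\<^sub>1 P W" and "\<epsilon>\<^sub>1 \<ge> 0" and contW: "continuous_on (P \<times> K) (\<lambda>(p, x). W p x)"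
    and V: "approximable M \<Z> P V" and contV: "continuous_on (P \<times> M) (\<lambda>(p, x). V p x)"
    and "\<epsilon>\<^sub>2 > 0"
  shows "approx_on M \<Z> K (\<epsilon>\<^sub>1 + \<epsilon>\<^sub>2) P (\<lambda>p x. V p x + W p x)"
proof -
  obtain \<rho> K1 R where \<rho>: "\<rho> > 0" and K1: "compact K1" "K1 \<subseteq> M" "K \<subseteq> K1"
    and inK1: "\<And>x y. x \<in> K \<Longrightarrow> norm (y - x) \<le> \<rho> \<Longrightarrow> y \<in> K1"
    using compact_neighbourhood[OF K(1) M K(2)] by metis
  have "bounded ((\<lambda>(p, x). W p x) ` (P \<times> K))"
    by (intro compact_imp_bounded compact_continuous_image contW compact_Times P K)
  then obtain B where B: "B > 0" "\<And>p x. p \<in> P \<Longrightarrow> x \<in> K \<Longrightarrow> norm (W p x) \<le> B"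
    unfolding bounded_pos by force
  have "uniformly_continuous_on (P \<times> K1) (\<lambda>(p, x). V p x)"
    using K1(2) by (intro compact_uniformly_continuous continuous_on_subset[OF contV] compact_Times P K1) auto
  then obtain \<eta> where \<eta>: "\<eta> > 0" and
    uc: "\<And>z z'. z \<in> P \<times> K1 \<Longrightarrow> z' \<in> P \<times> K1 \<Longrightarrow> dist z' z < \<eta> \<Longrightarrow>
      dist ((\<lambda>(p, x). V p x) z') ((\<lambda>(p, x). V p x) z) < \<epsilon>\<^sub>2 / 2"
    using \<open>\<epsilon>\<^sub>2 > 0\<close> unfolding uniformly_continuous_on_def by (meson half_gt_zero)
  obtain \<delta>1 where \<delta>1: "\<delta>1 > 0" and aW: "\<And>h. 0 < h \<and> h < \<delta>1 \<Longrightarrow> \<exists>\<Phi>. continuous_on (P \<times> K) (\<lambda>(p, x). \<Phi> p x) \<and>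
        (\<forall>p\<in>P. \<forall>x\<in>K. reachable M \<Z> x (\<Phi> p x) \<and> norm (\<Phi> p x - x - h *\<^sub>R W p x) \<le> \<epsilon>\<^sub>1 * h)"
    using W unfolding approx_on_def by blast
  have "approx_on M \<Z> K1 (\<epsilon>\<^sub>2 / 2) P V"
    using V K1 \<open>\<epsilon>\<^sub>2 > 0\<close> unfolding approximable_def by simp
  then obtain \<delta>2 where \<delta>2: "\<delta>2 > 0" and aV: "\<And>h. 0 < h \<and> h < \<delta>2 \<Longrightarrow> \<exists>\<Phi>. continuous_on (P \<times> K1) (\<lambda>(p, x). \<Phi> p x) \<and>
        (\<forall>p\<in>P. \<forall>x\<in>K1. reachable M \<Z> x (\<Phi> p x) \<and> norm (\<Phi> p x - x - h *\<^sub>R V p x) \<le> (\<epsilon>\<^sub>2 / 2) * h)"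
    unfolding approx_on_def by blast
  \<comment> \<open>\<open>h * (B + \<epsilon>\<^sub>1)\<close> bounds the displacement by the first
    map. It must be below \<open>\<rho>\<close> to land in \<open>K1\<close> and below
    \<open>\<eta>\<close> for the uniform continuity of \<open>V\<close>.\<close>
  define \<delta> where "\<delta> = Min {\<delta>1, \<delta>2, \<rho> / (B + \<epsilon>\<^sub>1), \<eta> / (B + \<epsilon>\<^sub>1)}"
  have "B + \<epsilon>\<^sub>1 > 0" using B(1) \<open>\<epsilon>\<^sub>1 \<ge> 0\<close> by simp
  have \<delta>: "\<delta> > 0" using \<delta>1 \<delta>2 \<rho> \<eta> \<open>B + \<epsilon>\<^sub>1 > 0\<close> by (simp add: \<delta>_def)
  show ?thesis
    unfolding approx_on_def
  proof (intro exI[of _ \<delta>] conjI allI impI \<delta>)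
    fix h assume h: "0 < h \<and> h < \<delta>"
    then have h': "h < \<delta>1" "h < \<delta>2" "h * (B + \<epsilon>\<^sub>1) < \<rho>" "h * (B + \<epsilon>\<^sub>1) < \<eta>"
      using \<open>B + \<epsilon>\<^sub>1 > 0\<close> by (simp_all add: \<delta>_def pos_less_divide_eq)
    obtain \<Phi>1 where c1: "continuous_on (P \<times> K) (\<lambda>(p, x). \<Phi>1 p x)" and
      r1: "\<And>p x. p \<in> P \<Longrightarrow> x \<in> K \<Longrightarrow> reachable M \<Z> x (\<Phi>1 p x)" and
      n1: "\<And>p x. p \<in> P \<Longrightarrow> x \<in> K \<Longrightarrow> norm (\<Phi>1 p x - x - h *\<^sub>R W p x) \<le> \<epsilon>\<^sub>1 * h"
      using aW[of h] h h' by blast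
    obtain \<Phi>2 where c2: "continuous_on (P \<times> K1) (\<lambda>(p, x). \<Phi>2 p x)" and
      r2: "\<And>p x. p \<in> P \<Longrightarrow> x \<in> K1 \<Longrightarrow> reachable M \<Z> x (\<Phi>2 p x)" and
      n2: "\<And>p x. p \<in> P \<Longrightarrow> x \<in> K1 \<Longrightarrow> norm (\<Phi>2 p x - x - h *\<^sub>R V p x) \<le> (\<epsilon>\<^sub>2 / 2) * h"
      using aV[of h] h h' by blast
    have move: "norm (\<Phi>1 p x - x) \<le> h * (B + \<epsilon>\<^sub>1)" if px: "p \<in> P" "x \<in> K" for p x
    proof -
      have "norm (\<Phi>1 p x - x) \<le> norm (h *\<^sub>R W p x) + norm (\<Phi>1 p x - x - h *\<^sub>R W p x)"
        by (rule norm_triangle_sub)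
      also have "norm (h *\<^sub>R W p x) \<le> h * B"
        using B(2)[OF px] h by simp
      finally show ?thesis using n1[OF px] by (simp add: algebra_simps)
    qed
    have in1: "\<Phi>1 p x \<in> K1" if "p \<in> P" "x \<in> K" for p x
      using inK1[OF that(2)] move[OF that] h' by simp
    have c: "continuous_on (P \<times> K) (\<lambda>(p, x). \<Phi>2 p (\<Phi>1 p x))"
    proof -
      have "continuous_on (P \<times> K) (\<lambda>z. (\<lambda>(p, x). \<Phi>2 p x) (fst z, \<Phi>1 (fst z) (snd z)))"
        by (rule continuous_on_compose2[OF c2])
           (use c1 in1 in \<open>auto intro!: continuous_intros simp: case_prod_unfold\<close>)
      then show ?thesis by (simp add: case_prod_unfold)
    qed
    have "reachable M \<Z> x (\<Phi>2 p (\<Phi>1 p x)) \<and>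
        norm (\<Phi>2 p (\<Phi>1 p x) - x - h *\<^sub>R (V p x + W p x)) \<le> (\<epsilon>\<^sub>1 + \<epsilon>\<^sub>2) * h"
      if px: "p \<in> P" "x \<in> K" for p x
    proof
      let ?y = "\<Phi>1 p x"
      show "reachable M \<Z> x (\<Phi>2 p ?y)"
        using r1[OF px] r2[OF px(1) in1[OF px]] reachable_trans by blast
      have "dist (p, ?y) (p, x) < \<eta>"
        using move[OF px] h'(4) by (simp add: dist_Pair_Pair dist_norm)
      then have "dist (V p ?y) (V p x) < \<epsilon>\<^sub>2 / 2"
        using uc[of "(p, x)" "(p, ?y)"] px in1[OF px] K1(3) by auto
      then have 3: "norm (h *\<^sub>R (V p ?y - V p x)) \<le> h * (\<epsilon>\<^sub>2 / 2)"
        using h by (simp add: dist_norm)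
      have "\<Phi>2 p ?y - x - h *\<^sub>R (V p x + W p x) =
        (\<Phi>2 p ?y - ?y - h *\<^sub>R V p ?y) + (?y - x - h *\<^sub>R W p x) + h *\<^sub>R (V p ?y - V p x)"
        by (simp add: algebra_simps)
      also have "norm \<dots> \<le> (\<epsilon>\<^sub>2 / 2) * h + \<epsilon>\<^sub>1 * h + h * (\<epsilon>\<^sub>2 / 2)"
        by (intro norm_triangle_mono n1 n2 3 px in1)
      also have "\<dots> = (\<epsilon>\<^sub>1 + \<epsilon>\<^sub>2) * h" by (simp add: algebra_simps)
      finally show "norm (\<Phi>2 p ?y - x - h *\<^sub>R (V p x + W p x)) \<le> (\<epsilon>\<^sub>1 + \<epsilon>\<^sub>2) * h" .
    qed
    with c show "\<exists>\<Phi>. continuous_on (P \<times> K) (\<lambda>(p, x). \<Phi> p x) \<and>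
        (\<forall>p\<in>P. \<forall>x\<in>K. reachable M \<Z> x (\<Phi> p x) \<and> norm (\<Phi> p x - x - h *\<^sub>R (V p x + W p x)) \<le> (\<epsilon>\<^sub>1 + \<epsilon>\<^sub>2) * h)"
      by (intro exI[of _ "\<lambda>p x. \<Phi>2 p (\<Phi>1 p x)"]) blast
  qed
qed

lemma approximable_add:
  fixes V W :: "'p::metric_space \<Rightarrow> 'a::euclidean_space \<Rightarrow> 'a"
  assumes "open M" "compact P"
    and "approximable M \<Z> P V" "continuous_on (P \<times> M) (\<lambda>(p, x). V p x)"
    and "approximable M \<Z> P W" "continuous_on (P \<times> M) (\<lambda>(p, x). W p x)"
  shows "approximable M \<Z> P (\<lambda>p x. V p x + W p x)"
  unfolding approximable_def
proof (intro allI impI, elim conjE)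
  fix K :: "'a set" and \<epsilon> :: real assume K: "compact K" "K \<subseteq> M" and "\<epsilon> > 0"
  have "approx_on M \<Z> K (\<epsilon> / 2 + \<epsilon> / 2) P (\<lambda>p x. V p x + W p x)"
  proof (rule approx_on_add[OF assms(1) K assms(2)])
    show "approx_on M \<Z> K (\<epsilon> / 2) P W"
      using assms(5) K \<open>\<epsilon> > 0\<close> unfolding approximable_def by simp
    show "continuous_on (P \<times> K) (\<lambda>(p, x). W p x)"
      by (rule continuous_on_subset[OF assms(6)]) (use K in auto)
  qed (use assms \<open>\<epsilon> > 0\<close> in auto)
  then show "approx_on M \<Z> K \<epsilon> P (\<lambda>p x. V p x + W p x)" by simp
qed

lemma approximable_zero: "approximable M \<Z> P (\<lambda>p x. 0)"
  unfolding approximable_def approx_on_def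
  by (auto intro!: exI[of _ 1] exI[of _ "\<lambda>p x. x"] continuous_intros simp: case_prod_unfold)

lemma continuous_on_scaled_field:
  fixes V :: "'a::euclidean_space \<Rightarrow> 'a"
  assumes "polynomial_function V" "continuous_on P c"
  shows "continuous_on (P \<times> S) (\<lambda>(p, x). c p *\<^sub>R V x)"
  unfolding case_prod_unfold
  by (intro continuous_on_scaleR continuous_on_compose2[OF assms(2)]
      continuous_on_compose2[OF continuous_on_polymonial_function[OF assms(1), of S]]
      continuous_on_fst continuous_on_snd continuous_on_id) auto

text \<open>The flow of \<open>Z\<close> for the signed time \<open>l * h\<close> has error at most
  \<open>C * h\<^sup>2\<close>, which is below \<open>\<epsilon> * h\<close> once
  \<open>h < \<epsilon> / C\<close>.\<close>

lemma approximable_generator: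
  fixes Z :: "'a::euclidean_space \<Rightarrow> 'a"
  assumes M: "open M" and Z: "Z \<in> \<Z>" "polynomial_function Z"
  shows "approximable M \<Z> {-1..1::real} (\<lambda>l x. l *\<^sub>R Z x)"
  unfolding approximable_def
proof (intro allI impI, elim conjE)
  fix K :: "'a set" and \<epsilon> :: real assume K: "compact K" "K \<subseteq> M" and "\<epsilon> > 0"
  obtain \<rho> K1 R where \<rho>: "\<rho> > 0" and K1: "K1 \<subseteq> M" and R: "R > 0" "K1 \<subseteq> cball 0 R" "K \<subseteq> K1"
    and inK1: "\<And>x y. x \<in> K \<Longrightarrow> norm (y - x) \<le> \<rho> \<Longrightarrow> y \<in> K1"
    using compact_neighbourhood[OF K(1) M K(2)] by metis
  obtain \<delta>0 C \<Psi> where fl: "is_local_flow Z R \<delta>0 C \<Psi>"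
    using polynomial_local_flow[OF Z(2) R(1)] by blast
  then have pos: "\<delta>0 > 0" "C > 0" unfolding is_local_flow_def by blast+
  define \<delta> where "\<delta> = Min {\<delta>0, \<rho> / C, \<epsilon> / C}"
  have \<delta>: "\<delta> > 0" using pos \<rho> \<open>\<epsilon> > 0\<close> by (simp add: \<delta>_def)
  show "approx_on M \<Z> K \<epsilon> {-1..1} (\<lambda>l x. l *\<^sub>R Z x)"
    unfolding approx_on_def
  proof (intro exI[of _ \<delta>] conjI allI impI \<delta>)
    fix h assume h: "0 < h \<and> h < \<delta>"
    then have h': "0 < h" "h < \<delta>0" "C * h < \<rho>" "C * h < \<epsilon>"
      using pos by (simp_all add: \<delta>_def pos_less_divide_eq mult.commute)
    have small: "\<bar>l * h\<bar> \<le> h" if "l \<in> {-1..1}" for l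
      using that h'(1) by (simp add: abs_mult mult_left_le_one_le abs_le_iff)
    have J: "l * h \<in> {-\<delta>0..\<delta>0}" if "l \<in> {-1..1}" for l
      using small[OF that] h'(2) by (auto simp: abs_le_iff)
    have KR: "x \<in> cball 0 R" if "x \<in> K" for x using that R by blast
    have "continuous_on ({-1..1} \<times> K) (\<lambda>z. (\<lambda>(s, x). \<Psi> s x) (fst z * h, snd z))"
      by (rule continuous_on_compose2[OF local_flow_continuous[OF fl]])
         (use J KR in \<open>auto intro!: continuous_intros\<close>)
    then have c: "continuous_on ({-1..1} \<times> K) (\<lambda>(l, x). \<Psi> (l * h) x)"
      by (simp add: case_prod_unfold)
    have "reachable M \<Z> x (\<Psi> (l * h) x) \<and> norm (\<Psi> (l * h) x - x - h *\<^sub>R (l *\<^sub>R Z x)) \<le> \<epsilon> * h"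
      if l: "l \<in> {-1..1}" and x: "x \<in> K" for l x
    proof
      show "reachable M \<Z> x (\<Psi> (l * h) x)"
      proof (rule local_flow_reachable[OF fl Z(1) KR[OF x] J[OF l]])
        fix t assume t: "\<bar>t\<bar> \<le> \<bar>l * h\<bar>"
        then have th: "\<bar>t\<bar> \<le> h" using small[OF l] by linarith
        have "norm (\<Psi> t x - x) \<le> C * \<bar>t\<bar>"
          by (rule local_flowD(2)[OF fl KR[OF x]]) (use th h'(2) in auto)
        also have "\<dots> \<le> C * h" using th pos by (intro mult_left_mono) auto
        finally have "norm (\<Psi> t x - x) \<le> \<rho>" using h'(3) by linarith
        then show "\<Psi> t x \<in> M" using inK1[OF x] K1 by blast
      qed
      have "norm (\<Psi> (l * h) x - x - (l * h) *\<^sub>R Z x) \<le> C * (l * h)\<^sup>2"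
        by (rule local_flowD(3)[OF fl KR[OF x] J[OF l]])
      also have "\<dots> \<le> C * h\<^sup>2"
        using small[OF l] pos h'(1) by (intro mult_left_mono) (auto simp: abs_le_square_iff[symmetric])
      also have "\<dots> \<le> \<epsilon> * h"
        using mult_right_mono[of "C * h" \<epsilon> h] h' by (simp add: power2_eq_square)
      finally show "norm (\<Psi> (l * h) x - x - h *\<^sub>R (l *\<^sub>R Z x)) \<le> \<epsilon> * h"
        by (simp add: mult.commute)
    qed
    with c show "\<exists>\<Phi>. continuous_on ({-1..1} \<times> K) (\<lambda>(p, x). \<Phi> p x) \<and>
        (\<forall>p\<in>{-1..1}. \<forall>x\<in>K. reachable M \<Z> x (\<Phi> p x) \<and> norm (\<Phi> p x - x - h *\<^sub>R (p *\<^sub>R Z x)) \<le> \<epsilon> * h)"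
      by (intro exI[of _ "\<lambda>l x. \<Psi> (l * h) x"]) blast
  qed
qed

section \<open>Brackets by conjugation with a flow\<close>

text \<open>The map is \<open>\<Psi> (- s)\<close>, then \<open>\<Phi> l\<close>, then
  \<open>\<Psi> s\<close>. To first order in \<open>h\<close> it adds the push-forward of
  \<open>V\<close> along the flow of \<open>Z\<close>, whose expansion in \<open>s\<close> begins
  with \<open>V\<close> and \<open>s\<close> times \<open>bracket V Z\<close>.\<close>

lemma approximable_conjugate:
  fixes V Z :: "'a::euclidean_space \<Rightarrow> 'a"
  assumes M: "open M" and Z: "Z \<in> \<Z>" "polynomial_function Z" and V: "polynomial_function V"
    and aV: "approximable M \<Z> {-1..1::real} (\<lambda>l x. l *\<^sub>R V x)" and K: "compact K" "K \<subseteq> M"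
  shows "\<exists>C s0. C > 0 \<and> s0 > 0 \<and> (\<forall>s. 0 < s \<and> s < s0 \<longrightarrow>
    approx_on M \<Z> K (C * s\<^sup>2) {-1..1::real} (\<lambda>l x. l *\<^sub>R (V x + s *\<^sub>R bracket V Z x)))"
proof -
  obtain \<rho> K1 R where \<rho>: "\<rho> > 0" and K1: "compact K1" "K1 \<subseteq> M" and R: "R > 0" "K1 \<subseteq> cball 0 R" "K \<subseteq> K1"
    and inK1: "\<And>x y. x \<in> K \<Longrightarrow> norm (y - x) \<le> \<rho> \<Longrightarrow> y \<in> K1"
    using compact_neighbourhood[OF K(1) M K(2)] by metis
  obtain \<delta>0 C0 \<Psi> where fl: "is_local_flow Z R \<delta>0 C0 \<Psi>"
    using polynomial_local_flow[OF Z(2) R(1)] by blast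
  then have pos: "\<delta>0 > 0" "C0 > 0" unfolding is_local_flow_def by blast+
  obtain C1 where C1: "C1 > 0" "\<And>x. x \<in> cball 0 R \<Longrightarrow> norm (V x) \<le> C1"
    "\<And>x y. x \<in> cball 0 R \<Longrightarrow> y \<in> cball 0 R \<Longrightarrow>
       norm (V y - V x - frechet_derivative V (at x) (y - x)) \<le> C1 * (norm (y - x))\<^sup>2"
    using polynomial_function_taylor[OF V] by metis
  obtain C2 where C2: "C2 > 0"
    "\<And>x y. x \<in> cball 0 R \<Longrightarrow> y \<in> cball 0 R \<Longrightarrow>
       norm (Z y - Z x - frechet_derivative Z (at x) (y - x)) \<le> C2 * (norm (y - x))\<^sup>2"
    using polynomial_function_taylor[OF Z(2)] by metis
  obtain C3 where C3: "C3 > 0"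
    "\<And>x y. x \<in> cball 0 R \<Longrightarrow> y \<in> cball 0 R \<Longrightarrow> norm (dirderiv V Z y - dirderiv V Z x) \<le> C3 * norm (y - x)"
    using polynomial_function_taylor[OF polynomial_function_dirderiv[OF Z(2) V]] by metis
  obtain C4 where C4: "C4 > 0" "\<And>x k. x \<in> cball 0 R \<Longrightarrow> norm (frechet_derivative V (at x) k) \<le> C4 * norm k"
    using polynomial_function_derivative_bound[OF V] by metis
  obtain C5 where C5: "C5 > 0" "\<And>x k. x \<in> cball 0 R \<Longrightarrow> norm (frechet_derivative Z (at x) k) \<le> C5 * norm k"
    using polynomial_function_derivative_bound[OF Z(2)] by metis
  define A where "A = C0 + C1 + C2 + C3 + C4 + C5 + 1"
  have A: "A \<ge> 1" "C0 \<le> A" "C1 \<le> A" "C2 \<le> A" "C3 \<le> A" "C4 \<le> A" "C5 \<le> A"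
    unfolding A_def using pos(2) C1(1) C2(1) C3(1) C4(1) C5(1) by simp_all
  then have A0: "A \<ge> 0" by simp
  \<comment> \<open>The coefficient of \<open>s\<^sup>2 * h\<close> in the sum of the six error
    terms estimated below.\<close>
  define C where "C = 5 * A ^ 3 + 4 * A\<^sup>2 + A + 1"
  \<comment> \<open>For \<open>s < s0\<close>, flowing for a time of modulus at most
    \<open>s\<close> moves a point by less than \<open>\<rho> / 3\<close>, a third of the room
    around \<open>K\<close>.\<close>
  define s0 where "s0 = Min {1, \<delta>0, \<rho> / (3 * A)}"
  have "approx_on M \<Z> K (C * s\<^sup>2) {-1..1::real} (\<lambda>l x. l *\<^sub>R (V x + s *\<^sub>R bracket V Z x))"
    if s: "0 < s \<and> s < s0" for s
  proof -
    have s': "0 < s" "s < 1" "s < \<delta>0" "A * s < \<rho> / 3"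
      using s A by (simp_all add: s0_def pos_less_divide_eq mult.commute mult.left_commute)
    have "approx_on M \<Z> K1 (s\<^sup>2) {-1..1::real} (\<lambda>l x. l *\<^sub>R V x)"
      using aV K1 s' unfolding approximable_def by simp
    then obtain \<delta>1 where \<delta>1: "\<delta>1 > 0" and a: "\<And>h. 0 < h \<and> h < \<delta>1 \<Longrightarrow> \<exists>\<Phi>.
        continuous_on ({-1..1::real} \<times> K1) (\<lambda>(p, x). \<Phi> p x) \<and>
        (\<forall>p\<in>{-1..1}. \<forall>x\<in>K1. reachable M \<Z> x (\<Phi> p x) \<and> norm (\<Phi> p x - x - h *\<^sub>R (p *\<^sub>R V x)) \<le> s\<^sup>2 * h)"
      unfolding approx_on_def by blast
    \<comment> \<open>The bound \<open>s\<^sup>2\<close> turns terms quadratic in \<open>h\<close>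
      into multiples of \<open>s\<^sup>2 * h\<close>. The last bound makes the middle move shorter
      than \<open>\<rho> / 3\<close>, so the three moves together stay within
      \<open>\<rho>\<close>.\<close>
    define \<delta> where "\<delta> = Min {\<delta>1, s\<^sup>2, \<rho> / (6 * A)}"
    have \<delta>: "\<delta> > 0" using \<delta>1 s' \<rho> A by (simp add: \<delta>_def)
    show ?thesis
      unfolding approx_on_def
    proof (intro exI[of _ \<delta>] conjI allI impI \<delta>)
      fix h assume h: "0 < h \<and> h < \<delta>"
      then have h': "0 < h" "h < \<delta>1" "h < s\<^sup>2" "2 * A * h < \<rho> / 3"
        using A by (simp_all add: \<delta>_def pos_less_divide_eq mult.commute mult.left_commute)
      obtain \<Phi> where cont: "continuous_on ({-1..1::real} \<times> K1) (\<lambda>(p, x). \<Phi> p x)"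
        and reach: "\<And>l x. l \<in> {-1..1} \<Longrightarrow> x \<in> K1 \<Longrightarrow> reachable M \<Z> x (\<Phi> l x)"
        and near: "\<And>l x. l \<in> {-1..1} \<Longrightarrow> x \<in> K1 \<Longrightarrow> norm (\<Phi> l x - x - h *\<^sub>R (l *\<^sub>R V x)) \<le> s\<^sup>2 * h"
        using a[of h] h' by blast
      have sJ: "s \<in> {-\<delta>0..\<delta>0}" "-s \<in> {-\<delta>0..\<delta>0}" using s' by auto
      have flow_near: "norm (\<Psi> t x - x) \<le> A * s" if "x \<in> cball 0 R" "\<bar>t\<bar> \<le> s" for x t
      proof -
        have "norm (\<Psi> t x - x) \<le> C0 * \<bar>t\<bar>"
          by (rule local_flowD(2)[OF fl that(1)]) (use that s' in auto)
        also have "\<dots> \<le> A * s" using that A by (intro mult_mono) auto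
        finally show ?thesis .
      qed
      define y where "y x = \<Psi> (-s) x" for x
      define z where "z l x = \<Phi> l (y x)" for l x
      have KR: "x \<in> cball 0 R" if "x \<in> K" for x using that R by blast
      have yx: "norm (y x - x) \<le> A * s" if "x \<in> K" for x
        unfolding y_def using KR[OF that] s' by (intro flow_near) auto
      have yK1: "y x \<in> K1" if "x \<in> K" for x
        using inK1[OF that] yx[OF that] s'(4) \<rho> by simp
      have yR: "y x \<in> cball 0 R" if "x \<in> K" for x
        using yK1[OF that] R by blast
      have zy: "norm (z l x - y x) \<le> 2 * A * h" if l: "l \<in> {-1..1}" and x: "x \<in> K" for l x
      proof -
        have "norm (z l x - y x) \<le> norm (h *\<^sub>R (l *\<^sub>R V (y x))) + norm (z l x - y x - h *\<^sub>R (l *\<^sub>R V (y x)))"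
          by (rule norm_triangle_sub)
        moreover have "norm (z l x - y x - h *\<^sub>R (l *\<^sub>R V (y x))) \<le> s\<^sup>2 * h"
          unfolding z_def by (rule near[OF l yK1[OF x]])
        moreover have "s\<^sup>2 * h \<le> 1 * h"
          using s' h' by (intro mult_right_mono) (auto simp: power_le_one)
        moreover have "1 * h \<le> A * h" using A h' by (intro mult_right_mono) auto
        moreover have "\<bar>l\<bar> * norm (V (y x)) \<le> 1 * A"
          using l C1(2)[OF yR[OF x]] A by (intro mult_mono) (auto simp: abs_le_iff)
        then have "h * (\<bar>l\<bar> * norm (V (y x))) \<le> h * (1 * A)"
          using h' by (intro mult_left_mono) auto
        then have "norm (h *\<^sub>R (l *\<^sub>R V (y x))) \<le> h * A"
          unfolding norm_scaleR using h' by simp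
        ultimately show ?thesis by (simp add: algebra_simps)
      qed
      have zx: "norm (z l x - x) \<le> 2 * \<rho> / 3" if "l \<in> {-1..1}" "x \<in> K" for l x
        using norm_triangle_ineq[of "z l x - y x" "y x - x"] zy[OF that] yx[OF that(2)] s'(4) h'(4) by simp
      have zR: "z l x \<in> cball 0 R" if "l \<in> {-1..1}" "x \<in> K" for l x
        using inK1[OF that(2), of "z l x"] zx[OF that] \<rho> R by auto
      have inM: "\<Psi> t w \<in> M" if "w \<in> cball 0 R" "x \<in> K" "norm (w - x) \<le> 2 * \<rho> / 3" "\<bar>t\<bar> \<le> s" for w x t
      proof -
        have "norm (\<Psi> t w - x) \<le> \<rho>"
          using norm_triangle_ineq[of "\<Psi> t w - w" "w - x"] flow_near[OF that(1,4)] that(3) s'(4) by simp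
        then show ?thesis using inK1[OF that(2)] K1 by blast
      qed
      have c: "continuous_on ({-1..1} \<times> K) (\<lambda>(l, x). \<Psi> s (z l x))"
      proof -
        have fc: "continuous_on (cball 0 R) (\<Psi> t)" if "t \<in> {-\<delta>0..\<delta>0}" for t
        proof -
          have "continuous_on (cball 0 R) (\<lambda>x. (\<lambda>(s, x). \<Psi> s x) (t, x))"
            by (rule continuous_on_compose2[OF local_flow_continuous[OF fl]])
               (use that in \<open>auto intro!: continuous_intros\<close>)
          then show ?thesis by simp
        qed
        have cy: "continuous_on K y"
          unfolding y_def[abs_def] by (rule continuous_on_subset[OF fc[OF sJ(2)]]) (use KR in auto)
        have "continuous_on ({-1..1} \<times> K) (\<lambda>q. (\<lambda>(p, x). \<Phi> p x) (fst q, y (snd q)))"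
          by (rule continuous_on_compose2[OF cont])
             (use yK1 in \<open>auto intro!: continuous_on_Pair continuous_on_compose2[OF cy]
                continuous_on_fst continuous_on_snd continuous_on_id\<close>)
        then have cz: "continuous_on ({-1..1} \<times> K) (\<lambda>q. z (fst q) (snd q))"
          by (simp add: z_def)
        have "continuous_on ({-1..1} \<times> K) (\<lambda>q. \<Psi> s (z (fst q) (snd q)))"
          by (rule continuous_on_compose2[OF fc[OF sJ(1)] cz]) (use zR in auto)
        then show ?thesis by (simp add: case_prod_unfold)
      qed
      have "reachable M \<Z> x (\<Psi> s (z l x)) \<and>
          norm (\<Psi> s (z l x) - x - h *\<^sub>R (l *\<^sub>R (V x + s *\<^sub>R bracket V Z x))) \<le> C * s\<^sup>2 * h"
        if l: "l \<in> {-1..1}" and x: "x \<in> K" for l x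
      proof
        let ?y = "y x" and ?z = "z l x"
        have "reachable M \<Z> x ?y"
          unfolding y_def
          by (rule local_flow_reachable[OF fl Z(1) KR[OF x] sJ(2)])
             (use \<rho> s' in \<open>auto intro!: inM[OF KR[OF x] x]\<close>)
        moreover have "reachable M \<Z> ?y ?z"
          unfolding z_def by (rule reach[OF l yK1[OF x]])
        moreover have "reachable M \<Z> ?z (\<Psi> s ?z)"
          by (rule local_flow_reachable[OF fl Z(1) zR[OF l x] sJ(1)])
             (use s' in \<open>auto intro!: inM[OF zR[OF l x] x zx[OF l x]]\<close>)
        ultimately show "reachable M \<Z> x (\<Psi> s ?z)"
          using reachable_trans by blast
        have inv: "\<Psi> s ?y = x"
          using local_flowD(4)[OF fl KR[OF x] sJ(2)] yR[OF x] by (simp add: y_def)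
        let ?DV = "frechet_derivative V (at x)" and ?DZ = "frechet_derivative Z (at ?y)"
        have linV: "linear ?DV" and linZ: "linear ?DZ"
          using polynomial_function_has_derivative[OF V] polynomial_function_has_derivative[OF Z(2)]
            has_derivative_linear by blast+
        \<comment> \<open>Each of the two flow remainders is only of order \<open>s\<^sup>2\<close>;
          their difference gains the factor \<open>norm (?z - ?y)\<close>, which is of order
          \<open>h\<close>. This is the use of the last clause of
          \<open>is_local_flow\<close>.\<close>
        define r where "r = (\<Psi> s ?z - ?z - s *\<^sub>R Z ?z) - (\<Psi> s ?y - ?y - s *\<^sub>R Z ?y)"
        define e where "e = ?z - ?y - h *\<^sub>R (l *\<^sub>R V ?y)"
        define e1 where "e1 = V ?y - V x - ?DV (?y - x)"
        define e2 where "e2 = ?y - x - (-s) *\<^sub>R Z x"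
        define e4 where "e4 = Z ?z - Z ?y - ?DZ (?z - ?y)"
        define e5 where "e5 = dirderiv V Z ?y - dirderiv V Z x"
        have a1: "?DV (?y - x) = ?DV e2 - s *\<^sub>R dirderiv Z V x"
        proof -
          have "?y - x = e2 - s *\<^sub>R Z x" by (simp add: e2_def)
          then show ?thesis by (simp add: linear_diff[OF linV] linear_scale[OF linV] dirderiv_def)
        qed
        have a2: "?DZ (?z - ?y) = ?DZ e + (h * l) *\<^sub>R dirderiv V Z ?y"
        proof -
          have "?z - ?y = e + (h * l) *\<^sub>R V ?y" by (simp add: e_def)
          then show ?thesis by (simp add: linear_add[OF linZ] linear_scale[OF linZ] dirderiv_def)
        qed
        \<comment> \<open>The two halves of the bracket have different origins:
          \<open>dirderiv Z V\<close> comes from evaluating \<open>V\<close> at \<open>?y\<close>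
          instead of \<open>x\<close>, and \<open>dirderiv V Z\<close> from the outer flow moving
          \<open>?z\<close> and \<open>?y\<close> differently. Every term left over is of order
          \<open>s\<^sup>2 * h\<close>.\<close>
        have "\<Psi> s ?z - x - h *\<^sub>R (l *\<^sub>R (V x + s *\<^sub>R bracket V Z x)) =
          (h * l) *\<^sub>R (e1 + ?DV e2) + e + (s * (h * l)) *\<^sub>R e5 + s *\<^sub>R ?DZ e + s *\<^sub>R e4 + r"
        proof -
          have b1: "V ?y = V x + e1 + ?DV e2 - s *\<^sub>R dirderiv Z V x"
            using a1 by (simp add: e1_def)
          have b2: "Z ?z - Z ?y = ?DZ e + (h * l) *\<^sub>R (dirderiv V Z x + e5) + e4"
            using a2 by (simp add: e4_def e5_def)
          have b3: "?z - ?y = (h * l) *\<^sub>R V ?y + e" by (simp add: e_def)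
          have "\<Psi> s ?z - x = (?z - ?y) + s *\<^sub>R (Z ?z - Z ?y) + r"
            by (simp add: r_def inv algebra_simps)
          also have "\<dots> = (h * l) *\<^sub>R (V x + e1 + ?DV e2 - s *\<^sub>R dirderiv Z V x) + e
              + s *\<^sub>R (?DZ e + (h * l) *\<^sub>R (dirderiv V Z x + e5) + e4) + r"
            unfolding b3 b2 unfolding b1 by (rule refl)
          finally have "\<Psi> s ?z - x = (h * l) *\<^sub>R (V x + e1 + ?DV e2 - s *\<^sub>R dirderiv Z V x) + e
              + s *\<^sub>R (?DZ e + (h * l) *\<^sub>R (dirderiv V Z x + e5) + e4) + r" .
          then show ?thesis
            by (simp add: bracket_def algebra_simps)
        qed
        moreover have "norm ((h * l) *\<^sub>R (e1 + ?DV e2)) \<le> h * ((A ^ 3 + A\<^sup>2) * s\<^sup>2)"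
        proof -
          have "norm e1 \<le> C1 * (norm (?y - x))\<^sup>2"
            unfolding e1_def by (rule C1(3)[OF KR[OF x] yR[OF x]])
          also have "\<dots> \<le> A * (A * s)\<^sup>2"
            using A yx[OF x] C1(1) by (intro mult_mono power_mono) auto
          finally have n1: "norm e1 \<le> A * (A * s)\<^sup>2" .
          have "norm e2 \<le> C0 * s\<^sup>2"
            using local_flowD(3)[OF fl KR[OF x] sJ(2)] by (simp add: e2_def y_def)
          also have "\<dots> \<le> A * s\<^sup>2" using A by (intro mult_right_mono) auto
          finally have n2: "norm e2 \<le> A * s\<^sup>2" .
          have "norm (?DV e2) \<le> C4 * norm e2" by (rule C4(2)[OF KR[OF x]])
          also have "\<dots> \<le> A * (A * s\<^sup>2)" using A n2 C4(1) by (intro mult_mono) auto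
          finally have "norm (?DV e2) \<le> A * (A * s\<^sup>2)" .
          with n1 have n3: "norm (e1 + ?DV e2) \<le> (A ^ 3 + A\<^sup>2) * s\<^sup>2"
            using norm_triangle_ineq[of e1 "?DV e2"]
            by (simp add: algebra_simps power2_eq_square power3_eq_cube)
          have "\<bar>h * l\<bar> \<le> h" using l h' by (simp add: abs_mult mult_left_le abs_le_iff)
          then show ?thesis using n3 h' unfolding norm_scaleR by (intro mult_mono) auto
        qed
        moreover have ne: "norm e \<le> s\<^sup>2 * h"
          unfolding e_def z_def by (rule near[OF l yK1[OF x]])
        moreover have "norm ((s * (h * l)) *\<^sub>R e5) \<le> (s * h) * (A * (A * s))"
        proof -
          have "norm e5 \<le> C3 * norm (?y - x)" unfolding e5_def by (rule C3(2)[OF KR[OF x] yR[OF x]])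
          also have "\<dots> \<le> A * (A * s)" using A yx[OF x] C3(1) by (intro mult_mono) auto
          finally have n: "norm e5 \<le> A * (A * s)" .
          have "\<bar>s * (h * l)\<bar> \<le> s * h" using l h' s' by (simp add: abs_mult mult_left_le abs_le_iff)
          then show ?thesis using n h' s' unfolding norm_scaleR by (intro mult_mono) auto
        qed
        moreover have "norm (s *\<^sub>R ?DZ e) \<le> 1 * (A * (s\<^sup>2 * h))"
        proof -
          have "norm (?DZ e) \<le> C5 * norm e" by (rule C5(2)[OF yR[OF x]])
          also have "\<dots> \<le> A * (s\<^sup>2 * h)" using A ne C5(1) by (intro mult_mono) auto
          finally show ?thesis using s' unfolding norm_scaleR by (intro mult_mono) auto
        qed
        moreover have "norm (s *\<^sub>R e4) \<le> 1 * (A * (4 * A\<^sup>2 * (s\<^sup>2 * h)))"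
        proof -
          have "norm e4 \<le> C2 * (norm (?z - ?y))\<^sup>2" unfolding e4_def by (rule C2(2)[OF yR[OF x] zR[OF l x]])
          also have "\<dots> \<le> A * (2 * A * h)\<^sup>2"
            using A zy[OF l x] C2(1) by (intro mult_mono power_mono) auto
          also have "(2 * A * h)\<^sup>2 = 4 * A\<^sup>2 * (h * h)" by (simp add: power2_eq_square)
          also have "A * (4 * A\<^sup>2 * (h * h)) \<le> A * (4 * A\<^sup>2 * (s\<^sup>2 * h))"
            using h' A0 by (intro mult_left_mono mult_right_mono) auto
          finally show ?thesis using s' unfolding norm_scaleR by (intro mult_mono) auto
        qed
        moreover have "norm r \<le> A * s\<^sup>2 * (2 * A * h)"
        proof -
          have "norm r \<le> C0 * s\<^sup>2 * norm (?z - ?y)"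
            unfolding r_def by (rule local_flowD(6)[OF fl zR[OF l x] sJ(1) yR[OF x]])
          also have "\<dots> \<le> A * s\<^sup>2 * (2 * A * h)"
            using A zy[OF l x] pos by (intro mult_mono) auto
          finally show ?thesis .
        qed
        ultimately have "norm (\<Psi> s ?z - x - h *\<^sub>R (l *\<^sub>R (V x + s *\<^sub>R bracket V Z x))) \<le>
          h * ((A ^ 3 + A\<^sup>2) * s\<^sup>2) + s\<^sup>2 * h + (s * h) * (A * (A * s)) + 1 * (A * (s\<^sup>2 * h))
          + 1 * (A * (4 * A\<^sup>2 * (s\<^sup>2 * h))) + A * s\<^sup>2 * (2 * A * h)"
          by (simp only:) (intro norm_triangle_mono)
        also have "\<dots> = C * s\<^sup>2 * h"
          by (simp add: C_def algebra_simps power2_eq_square power3_eq_cube)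
        finally show "norm (\<Psi> s ?z - x - h *\<^sub>R (l *\<^sub>R (V x + s *\<^sub>R bracket V Z x))) \<le> C * s\<^sup>2 * h" .
      qed
      with c show "\<exists>\<Phi>. continuous_on ({-1..1} \<times> K) (\<lambda>(p, x). \<Phi> p x) \<and>
        (\<forall>p\<in>{-1..1}. \<forall>x\<in>K. reachable M \<Z> x (\<Phi> p x) \<and>
          norm (\<Phi> p x - x - h *\<^sub>R (p *\<^sub>R (V x + s *\<^sub>R bracket V Z x))) \<le> C * s\<^sup>2 * h)"
        by (intro exI[of _ "\<lambda>l x. \<Psi> s (z l x)"]) blast
    qed
  qed
  moreover have "C > 0" using A by (simp add: C_def add_pos_nonneg)
  moreover have "s0 > 0" using A \<rho> pos by (simp add: s0_def)
  ultimately show ?thesis by blast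
qed

text \<open>Following the conjugated map by the approximation of \<open>- V\<close> cancels
  \<open>V\<close> and leaves \<open>h * s\<close> times the bracket with error
  \<open>2 * C * s\<^sup>2 * h\<close>. Rescaling by \<open>1 / s\<close> makes the accuracy
  \<open>2 * C * s\<close>, and \<open>s\<close> is chosen small enough for
  \<open>\<epsilon>\<close>.\<close>

lemma approximable_bracket:
  fixes V Z :: "'a::euclidean_space \<Rightarrow> 'a"
  assumes M: "open M" and Z: "Z \<in> \<Z>" "polynomial_function Z" and V: "polynomial_function V"
    and aV: "approximable M \<Z> {-1..1::real} (\<lambda>l x. l *\<^sub>R V x)"
  shows "approximable M \<Z> {-1..1::real} (\<lambda>l x. l *\<^sub>R bracket V Z x)"
  unfolding approximable_def
proof (intro allI impI, elim conjE)
  fix K :: "'a set" and \<epsilon> :: real assume K: "compact K" "K \<subseteq> M" and "\<epsilon> > 0"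
  obtain C s0 where C: "C > 0" "s0 > 0" and
    conj: "\<And>s. 0 < s \<and> s < s0 \<Longrightarrow>
      approx_on M \<Z> K (C * s\<^sup>2) {-1..1::real} (\<lambda>l x. l *\<^sub>R (V x + s *\<^sub>R bracket V Z x))"
    using approximable_conjugate[OF M Z V aV K] by blast
  define s where "s = min (s0 / 2) (\<epsilon> / (2 * C))"
  have s: "0 < s" "s < s0" using C \<open>\<epsilon> > 0\<close> by (simp_all add: s_def min_less_iff_disj)
  have sC: "2 * C * s \<le> \<epsilon>" using C by (simp add: s_def min_def field_simps)
  have pW: "polynomial_function (\<lambda>x. V x + s *\<^sub>R bracket V Z x)"
    using V polynomial_function_bracket[OF V Z(2)] by (intro polynomial_function_add polynomial_function_cmul)
  have pV: "polynomial_function (\<lambda>x. - V x)" using V by blast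
  have neg: "approximable M \<Z> {-1..1::real} (\<lambda>l x. l *\<^sub>R (- V x))"
    using approximable_reparam[OF aV, of "{-1..1}" uminus] by (simp add: continuous_on_minus)
  have "approx_on M \<Z> K (C * s\<^sup>2 + C * s\<^sup>2) {-1..1::real}
      (\<lambda>l x. l *\<^sub>R (- V x) + l *\<^sub>R (V x + s *\<^sub>R bracket V Z x))"
  proof (rule approx_on_add[OF M K _ conj _ _ neg])
    show "continuous_on ({-1..1} \<times> K) (\<lambda>(l, x). l *\<^sub>R (V x + s *\<^sub>R bracket V Z x))"
      "continuous_on ({-1..1} \<times> M) (\<lambda>(l, x). l *\<^sub>R (- V x))"
      by (rule continuous_on_scaled_field[OF pW continuous_on_id] continuous_on_scaled_field[OF pV continuous_on_id])+
  qed (use s C in auto)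
  then have "approx_on M \<Z> K (2 * C * s\<^sup>2) {-1..1::real} (\<lambda>l x. s *\<^sub>R (l *\<^sub>R bracket V Z x))"
    by (simp add: algebra_simps)
  from approx_on_scale[OF this, of "1 / s"] s
  have "approx_on M \<Z> K (2 * C * s) {-1..1::real} (\<lambda>l x. l *\<^sub>R bracket V Z x)"
    by (simp add: power2_eq_square mult.assoc)
  then show "approx_on M \<Z> K \<epsilon> {-1..1::real} (\<lambda>l x. l *\<^sub>R bracket V Z x)"
    by (rule approx_on_mono[OF _ sC])
qed

lemma bracket_add_right:
  assumes "polynomial_function U" "polynomial_function V" "polynomial_function W"
  shows "bracket U (\<lambda>x. V x + W x) x = bracket U V x + bracket U W x"
proof -
  have "dirderiv (\<lambda>x. V x + W x) U x = dirderiv V U x + dirderiv W U x"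
    using linear_add[OF has_derivative_linear[OF polynomial_function_has_derivative[OF assms(1), of x UNIV]]]
    by (simp add: dirderiv_def)
  with assms show ?thesis
    by (simp add: bracket_def dirderiv_add)
qed

lemma bracket_scaleR_right:
  assumes "polynomial_function U" "polynomial_function V"
  shows "bracket U (\<lambda>x. c *\<^sub>R V x) x = c *\<^sub>R bracket U V x"
proof -
  have "dirderiv (\<lambda>x. c *\<^sub>R V x) U x = c *\<^sub>R dirderiv V U x"
    using linear_scale[OF has_derivative_linear[OF polynomial_function_has_derivative[OF assms(1), of x UNIV]]]
    by (simp add: dirderiv_def)
  with assms show ?thesis
    by (simp add: bracket_def dirderiv_scaleR scaleR_diff_right)
qed

text \<open>Coefficients that depend continuously on \<open>p\<close> combine single fields into one
  family that can move in all directions; values in \<open>{-1..1}\<close> are those accepted by the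
  approximation of each single field.\<close>

lemma approximable_sum:
  fixes V :: "'b \<Rightarrow> 'a::euclidean_space \<Rightarrow> 'a" and P :: "'p::metric_space set"
  assumes M: "open M" and P: "compact P" and "finite B"
    and V: "\<And>b. b \<in> B \<Longrightarrow> polynomial_function (V b)"
    and aV: "\<And>b. b \<in> B \<Longrightarrow> approximable M \<Z> {-1..1::real} (\<lambda>l x. l *\<^sub>R V b x)"
    and c: "\<And>b. b \<in> B \<Longrightarrow> continuous_on P (c b)" "\<And>b p. b \<in> B \<Longrightarrow> p \<in> P \<Longrightarrow> c b p \<in> {-1..1}"
  shows "approximable M \<Z> P (\<lambda>p x. \<Sum>b\<in>B. c b p *\<^sub>R V b x)"
  using assms(3-)
proof (induction B)
  case empty
  then show ?case by (simp add: approximable_zero)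
next
  case (insert b B)
  have "approximable M \<Z> P (\<lambda>p x. c b p *\<^sub>R V b x + (\<Sum>b\<in>B. c b p *\<^sub>R V b x))"
  proof (rule approximable_add[OF M P])
    show "approximable M \<Z> P (\<lambda>p x. c b p *\<^sub>R V b x)"
      by (rule approximable_reparam[OF insert.prems(2)]) (use insert.prems in auto)
    show "continuous_on (P \<times> M) (\<lambda>(p, x). c b p *\<^sub>R V b x)"
      by (rule continuous_on_scaled_field) (use insert.prems in auto)
    show "approximable M \<Z> P (\<lambda>p x. \<Sum>b\<in>B. c b p *\<^sub>R V b x)"
      using insert by simp
    show "continuous_on (P \<times> M) (\<lambda>(p, x). \<Sum>b\<in>B. c b p *\<^sub>R V b x)"
      using continuous_on_scaled_field[OF insert.prems(1,3)] unfolding case_prod_unfold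
      by (intro continuous_on_sum) auto
  qed
  then show ?case using insert by simp
qed

subsection \<open>The Lie algebra generated by polynomial fields\<close>

inductive_set lie_hull :: "('a::euclidean_space \<Rightarrow> 'a) set \<Rightarrow> ('a \<Rightarrow> 'a) set"
  for \<Z> :: "('a \<Rightarrow> 'a) set" where
  generator: "Z \<in> \<Z> \<Longrightarrow> Z \<in> lie_hull \<Z>"
| add: "V \<in> lie_hull \<Z> \<Longrightarrow> W \<in> lie_hull \<Z> \<Longrightarrow> (\<lambda>x. V x + W x) \<in> lie_hull \<Z>"
| scaleR: "V \<in> lie_hull \<Z> \<Longrightarrow> (\<lambda>x. c *\<^sub>R V x) \<in> lie_hull \<Z>"
| bracket: "V \<in> lie_hull \<Z> \<Longrightarrow> W \<in> lie_hull \<Z> \<Longrightarrow> bracket V W \<in> lie_hull \<Z>"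

lemma polynomial_function_lie_hull:
  assumes "V \<in> lie_hull \<Z>" "\<And>Z. Z \<in> \<Z> \<Longrightarrow> polynomial_function Z"
  shows "polynomial_function V"
  using assms(1)
  by induction (auto intro: assms(2) polynomial_function_bracket)

lemma approximable_field_add:
  fixes V W :: "'a::euclidean_space \<Rightarrow> 'a"
  assumes "open M" "polynomial_function V" "polynomial_function W"
    and "approximable M \<Z> {-1..1::real} (\<lambda>l x. l *\<^sub>R V x)"
    and "approximable M \<Z> {-1..1::real} (\<lambda>l x. l *\<^sub>R W x)"
  shows "approximable M \<Z> {-1..1::real} (\<lambda>l x. l *\<^sub>R (V x + W x))"
  unfolding scaleR_add_right
  by (intro approximable_add continuous_on_scaled_field continuous_on_id assms compact_Icc)

text \<open>The modulus of \<open>c\<close> is absorbed by the step size, its sign by the parameter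
  \<open>l\<close>.\<close>

lemma approximable_field_scaleR:
  fixes V :: "'a::euclidean_space \<Rightarrow> 'a"
  assumes "approximable M \<Z> {-1..1::real} (\<lambda>l x. l *\<^sub>R V x)"
  shows "approximable M \<Z> {-1..1::real} (\<lambda>l x. l *\<^sub>R (c *\<^sub>R V x))"
proof (cases "c = 0")
  case True
  then show ?thesis by (simp add: approximable_zero)
next
  case False
  have sgn: "approximable M \<Z> {-1..1::real} (\<lambda>l x. (sgn c * l) *\<^sub>R V x)"
    by (rule approximable_reparam[OF assms]) (auto intro!: continuous_intros simp: sgn_if)
  show ?thesis
    unfolding approximable_def
  proof (intro allI impI, elim conjE)
    fix K :: "'a set" and \<epsilon> :: real assume K: "compact K" "K \<subseteq> M" and "\<epsilon> > 0"
    have "approx_on M \<Z> K (\<epsilon> / \<bar>c\<bar>) {-1..1::real} (\<lambda>l x. (sgn c * l) *\<^sub>R V x)"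
      using sgn K \<open>\<epsilon> > 0\<close> False unfolding approximable_def by simp
    from approx_on_scale[OF this, of "\<bar>c\<bar>"] False
    have "approx_on M \<Z> K \<epsilon> {-1..1::real} (\<lambda>l x. (\<bar>c\<bar> * (sgn c * l)) *\<^sub>R V x)" by simp
    moreover have "\<bar>c\<bar> * (sgn c * l) = l * c" for l by (simp add: sgn_if)
    ultimately show "approx_on M \<Z> K \<epsilon> {-1..1::real} (\<lambda>l x. l *\<^sub>R (c *\<^sub>R V x))" by simp
  qed
qed

lemma approximable_lie_hull:
  fixes V :: "'a::euclidean_space \<Rightarrow> 'a"
  assumes M: "open M" and Z: "\<And>Z. Z \<in> \<Z> \<Longrightarrow> polynomial_function Z" and V: "V \<in> lie_hull \<Z>"
  shows "approximable M \<Z> {-1..1::real} (\<lambda>l x. l *\<^sub>R V x)"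
proof -
  let ?A = "\<lambda>V. approximable M \<Z> {-1..1::real} (\<lambda>l x. l *\<^sub>R V x)"
  have pl: "polynomial_function V" if "V \<in> lie_hull \<Z>" for V
    using polynomial_function_lie_hull[OF that] Z by blast
  \<comment> \<open>Brackets need the stronger invariant that \<open>V\<close> also normalizes the approximable fields.\<close>
  have "?A V \<and> (\<forall>W. polynomial_function W \<longrightarrow> ?A W \<longrightarrow> ?A (bracket W V))"
    using V
  proof induction
    case (generator Z)
    then show ?case using approximable_generator[OF M] approximable_bracket[OF M] Z by blast
  next
    case (add V W)
    show ?case
    proof (intro conjI allI impI)
      show "?A (\<lambda>x. V x + W x)"
        using add pl by (intro approximable_field_add[OF M]) auto
      fix U :: "'a \<Rightarrow> 'a" assume U: "polynomial_function U" "?A U"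
      show "?A (bracket U (\<lambda>x. V x + W x))"
        unfolding bracket_add_right[OF U(1) pl[OF add.hyps(1)] pl[OF add.hyps(2)]]
        using add U pl by (intro approximable_field_add[OF M] polynomial_function_bracket) auto
    qed
  next
    case (scaleR V c)
    show ?case
    proof (intro conjI allI impI)
      show "?A (\<lambda>x. c *\<^sub>R V x)"
        using scaleR by (intro approximable_field_scaleR) auto
      fix U :: "'a \<Rightarrow> 'a" assume U: "polynomial_function U" "?A U"
      show "?A (bracket U (\<lambda>x. c *\<^sub>R V x))"
        unfolding bracket_scaleR_right[OF U(1) pl[OF scaleR.hyps]]
        using scaleR U by (intro approximable_field_scaleR) auto
    qed
  next
    case (bracket V W)
    note p = pl[OF bracket.hyps(1)] pl[OF bracket.hyps(2)]
    show ?case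
    proof (intro conjI allI impI)
      show "?A (bracket V W)"
        using bracket p by blast
      fix U :: "'a \<Rightarrow> 'a" assume U: "polynomial_function U" "?A U"
      \<comment> \<open>Each induction hypothesis is applied twice: once to \<open>U\<close>, and
        once to the bracket of \<open>U\<close> with the other field.\<close>
      have 1: "?A (bracket (bracket U V) W)" "?A (bracket (bracket U W) V)"
        using bracket U p polynomial_function_bracket by blast+
      have "?A (\<lambda>x. bracket (bracket U V) W x + (-1) *\<^sub>R bracket (bracket U W) V x)"
        using 1 U p
        by (intro approximable_field_add[OF M] approximable_field_scaleR polynomial_function_bracket
            polynomial_function_cmul)
      then show "?A (bracket U (bracket V W))"
        by (simp add: bracket_jacobi[OF U(1) p])
    qed
  qed
  then show ?thesis by blast
qed

section \<open>Orbits contain neighbourhoods\<close>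

text \<open>The field \<open>W b\<close> takes the value \<open>b\<close> at \<open>q\<close>, so
  the parameter \<open>p\<close> moves \<open>q\<close> by about \<open>h *\<^sub>R p\<close>. After
  rescaling by a single fixed \<open>h\<close>, the endpoint map on the unit ball is within 1/2 of
  the identity and therefore covers the ball of radius 1/2.\<close>

lemma reachable_neighbourhood:
  fixes q :: "'a::euclidean_space"
  assumes M: "open M" and Z: "\<And>Z. Z \<in> \<Z> \<Longrightarrow> polynomial_function Z" and q: "q \<in> M"
    and span: "\<And>w. \<exists>W\<in>lie_hull \<Z>. W q = w"
  shows "\<exists>r>0. \<forall>p\<in>ball q r. reachable M \<Z> q p"
proof -
  obtain W where W: "\<And>w. W w \<in> lie_hull \<Z>" "\<And>w. W w q = w"
    using span by metis
  have "approximable M \<Z> (cball (0::'a) 1) (\<lambda>p x. \<Sum>b\<in>Basis. (p \<bullet> b) *\<^sub>R W b x)"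
  proof (rule approximable_sum[OF M compact_cball finite_Basis])
    show "p \<bullet> b \<in> {-1..1}" if "b \<in> Basis" "p \<in> cball 0 1" for b p :: 'a
    proof -
      have "\<bar>p \<bullet> b\<bar> \<le> 1" using Basis_le_norm[OF that(1), of p] that(2) by simp
      then show ?thesis by (simp add: abs_le_iff)
    qed
    show "polynomial_function (W b)" "approximable M \<Z> {-1..1} (\<lambda>l x. l *\<^sub>R W b x)" for b
      using polynomial_function_lie_hull[OF W(1)] approximable_lie_hull[OF M _ W(1)] Z by blast+
  qed (intro continuous_intros)
  then have "approx_on M \<Z> {q} (1/2) (cball (0::'a) 1) (\<lambda>p x. \<Sum>b\<in>Basis. (p \<bullet> b) *\<^sub>R W b x)"
    using q unfolding approximable_def by simp
  then obtain \<delta> where \<delta>: "\<delta> > 0" and a: "\<And>h. 0 < h \<and> h < \<delta> \<Longrightarrow> \<exists>\<Phi>.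
      continuous_on (cball 0 1 \<times> {q}) (\<lambda>(p, x). \<Phi> p x) \<and>
      (\<forall>p\<in>cball 0 1. \<forall>x\<in>{q}. reachable M \<Z> x (\<Phi> p x) \<and>
        norm (\<Phi> p x - x - h *\<^sub>R (\<Sum>b\<in>Basis. (p \<bullet> b) *\<^sub>R W b x)) \<le> 1/2 * h)"
    unfolding approx_on_def by blast
  define h where "h = \<delta> / 2"
  have h: "0 < h" "h < \<delta>" using \<delta> by (simp_all add: h_def)
  obtain \<Phi> where c: "continuous_on (cball 0 1 \<times> {q}) (\<lambda>(p, x). \<Phi> p x)"
    and reach: "\<And>p. p \<in> cball 0 1 \<Longrightarrow> reachable M \<Z> q (\<Phi> p q)"
    and near: "\<And>p. p \<in> cball 0 1 \<Longrightarrow> norm (\<Phi> p q - q - h *\<^sub>R p) \<le> 1/2 * h"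
    using a[of h] h by (auto simp: W(2) euclidean_representation)
  define f where "f p = (\<Phi> p q - q) /\<^sub>R h" for p
  have "continuous_on (cball 0 1) (\<lambda>p. (\<lambda>(p, x). \<Phi> p x) (p, q))"
    by (rule continuous_on_compose2[OF c]) (auto intro!: continuous_on_Pair continuous_on_id continuous_on_const)
  then have contf: "continuous_on (cball 0 1) f"
    unfolding f_def[abs_def] by (intro continuous_intros) simp
  have fp: "norm (p - f p) \<le> 1/2" if "p \<in> cball 0 1" for p
  proof -
    have "p - f p = - ((\<Phi> p q - q - h *\<^sub>R p) /\<^sub>R h)"
      using h by (simp add: f_def algebra_simps)
    then have "norm (p - f p) = norm (\<Phi> p q - q - h *\<^sub>R p) / h"
      using h by (simp add: divide_inverse mult.commute)
    then show ?thesis using near[OF that] h by (simp add: pos_divide_le_eq)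
  qed
  have "reachable M \<Z> q p" if p: "p \<in> ball q (h / 2)" for p
  proof -
    have "(p - q) /\<^sub>R h \<in> cball 0 (1/2)"
    proof -
      have "norm ((p - q) /\<^sub>R h) = norm (p - q) / h"
        using h by (simp add: divide_inverse mult.commute)
      with p h show ?thesis by (simp add: dist_norm norm_minus_commute pos_divide_le_eq)
    qed
    then have "\<exists>w\<in>cball 0 1. f w = (p - q) /\<^sub>R h"
    proof (rule brouwer_surjective_cball[OF contf zero_less_one])
      fix x y :: 'a assume "x \<in> cball 0 (1/2)" "y \<in> cball 0 1"
      then show "x + (y - f y) \<in> cball 0 1"
        using norm_triangle_mono[of x "1/2" "y - f y" "1/2"] fp by simp
    qed
    then obtain w where w: "w \<in> cball 0 1" "f w = (p - q) /\<^sub>R h" by blast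
    then have "\<Phi> w q = p" using h by (simp add: f_def)
    with reach[OF w(1)] show ?thesis by simp
  qed
  moreover have "h / 2 > 0" using h by simp
  ultimately show ?thesis by blast
qed

theorem polynomial_chow_rashevskii:
  fixes M :: "'a::euclidean_space set"
  assumes M: "open M" "connected M" and Z: "\<And>Z. Z \<in> \<Z> \<Longrightarrow> polynomial_function Z"
    and span: "\<And>q w. q \<in> M \<Longrightarrow> \<exists>W\<in>lie_hull \<Z>. W q = w"
    and "p \<in> M" "q \<in> M"
  shows "reachable M \<Z> p q"
proof (rule connected_equivalence_relation[OF M(2) \<open>p \<in> M\<close> \<open>q \<in> M\<close>])
  fix a assume a: "a \<in> M"
  obtain r where r: "r > 0" "\<And>p. p \<in> ball a r \<Longrightarrow> reachable M \<Z> a p"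
    using reachable_neighbourhood[OF M(1) _ a span[OF a]] Z by blast
  have "openin (top_of_set M) (M \<inter> ball a r)"
    by (simp add: openin_open_Int)
  then show "\<exists>T. openin (top_of_set M) T \<and> a \<in> T \<and> (\<forall>x\<in>T. reachable M \<Z> a x)"
    using a r by (intro exI[of _ "M \<inter> ball a r"]) auto
qed (blast intro: reachable_trans reachable_sym)+

subsection \<open>The Lie algebra of the first coordinate field and the cubic field\<close>

text \<open>Once both derivatives are supplied, membership of a bracket becomes a pointwise
  algebraic identity. The computations with the cubic field all go through this rule.\<close>

lemma lie_hull_bracketI:
  fixes V W :: "'a::euclidean_space \<Rightarrow> 'a"
  assumes "V \<in> lie_hull \<Z>" "W \<in> lie_hull \<Z>"
    and "\<And>x. (V has_derivative V' x) (at x)" "\<And>x. (W has_derivative W' x) (at x)"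
    and "\<And>x. W' x (V x) - V' x (W x) = U x"
  shows "U \<in> lie_hull \<Z>"
proof -
  have "U = bracket V W"
    using assms(5) by (simp add: fun_eq_iff bracket_def dirderiv_eq[OF assms(3)] dirderiv_eq[OF assms(4)])
  then show ?thesis
    using lie_hull.bracket[OF assms(1,2)] by simp
qed

lemma lie_hull_scaleD:
  assumes "(\<lambda>x. c *\<^sub>R V x) \<in> lie_hull \<Z>" "c \<noteq> 0"
  shows "V \<in> lie_hull \<Z>"
  using lie_hull.scaleR[OF assms(1), of "1 / c"] assms(2) by simp

lemma lie_hull_diff:
  assumes "V \<in> lie_hull \<Z>" "W \<in> lie_hull \<Z>"
  shows "(\<lambda>x. V x - W x) \<in> lie_hull \<Z>"
  using lie_hull.add[OF assms(1) lie_hull.scaleR[OF assms(2), of "-1"]] by simp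

lemma lie_hull_zero:
  assumes "\<Z> \<noteq> {}"
  shows "(\<lambda>x. 0) \<in> lie_hull \<Z>"
  using assms lie_hull.scaleR[OF lie_hull.generator, of _ \<Z> 0] by auto

lemma lie_hull_sum:
  assumes "\<Z> \<noteq> {}" "\<And>i. i \<in> I \<Longrightarrow> V i \<in> lie_hull \<Z>"
  shows "(\<lambda>x. \<Sum>i\<in>I. V i x) \<in> lie_hull \<Z>"
proof (cases "finite I")
  case True
  then show ?thesis
    using assms(2) by induction (auto intro: lie_hull_zero[OF assms(1)] lie_hull.add)
qed (simp add: lie_hull_zero[OF assms(1)])

text \<open>Two vectors span a proper subspace in dimension at least three. The vector obtained is
  used to make one half of a bracket vanish while the other half survives.\<close>

lemma exists_orthogonal_to_two:
  fixes u v :: "'a::euclidean_space"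
  assumes "DIM('a) \<ge> 3"
  obtains w where "w \<noteq> 0" "u \<bullet> w = 0" "v \<bullet> w = 0"
proof -
  have "dim {u, v} \<le> card {u, v}" by (rule dim_le_card') simp
  also have "\<dots> < DIM('a)" using assms by (simp add: card_insert_if)
  finally obtain w where "w \<noteq> 0" "\<And>y. y \<in> span {u, v} \<Longrightarrow> orthogonal w y"
    using orthogonal_to_subspace_exists by blast
  then show thesis
    using that[of w] by (simp add: orthogonal_def span_base inner_commute)
qed

text \<open>An orthonormal basis indexed by all natural numbers with period \<open>d\<close>: the
  cyclic shift of indices is then \<open>Suc\<close>, wrap-around is contained in
  \<open>b_periodic\<close>, and the last basis vector \<open>b d\<close> is also
  \<open>b 0\<close>.\<close>

locale cyclic_basis =
  fixes b :: "nat \<Rightarrow> 'a::euclidean_space" and d :: nat and S :: "'a \<Rightarrow> 'a"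
  assumes d: "d \<ge> 3" "d = DIM('a)"
    and b_inner: "b i \<bullet> b j = (if i mod d = j mod d then 1 else 0)"
    and b_periodic: "b (k + d) = b k"
    and expansion: "v = (\<Sum>k<d. (v \<bullet> b k) *\<^sub>R b k)"
    and linear_S: "linear S"
    and S_b: "S (b k) = b (Suc k)"
begin

abbreviation L :: "('a \<Rightarrow> 'a) set" where
  "L \<equiv> lie_hull {\<lambda>x. b (Suc 0), \<lambda>x. (x \<bullet> x) *\<^sub>R S x}"

lemmas L_sum = lie_hull_sum[of "{\<lambda>x. b (Suc 0), \<lambda>x. (x \<bullet> x) *\<^sub>R S x}", OF insert_not_empty]
lemmas L_zero = lie_hull_zero[of "{\<lambda>x. b (Suc 0), \<lambda>x. (x \<bullet> x) *\<^sub>R S x}", OF insert_not_empty]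

lemma b_orthogonal: "0 < k \<Longrightarrow> k < d \<Longrightarrow> b i \<bullet> b (i + k) = 0"
proof -
  assume k: "0 < k" "k < d"
  have "i mod d \<noteq> (i + k) mod d"
  proof
    assume "i mod d = (i + k) mod d"
    then have "d dvd (i + k) - i" by (metis mod_eq_dvd_iff_nat le_add1)
    with k show False by (auto dest: dvd_imp_le)
  qed
  then show ?thesis by (simp add: b_inner)
qed

lemma b_norm: "b i \<bullet> b i = 1"
  by (simp add: b_inner)

lemma S_derivative: "(S has_derivative S) F"
  by (rule bounded_linear_imp_has_derivative) (simp add: linear_S linear_conv_bounded_linear[symmetric])

lemmas S_simps = linear_add[OF linear_S] linear_scale[OF linear_S]

lemma derivative_constant_quadratic:
  "((\<lambda>x. (2 * (a \<bullet> x)) *\<^sub>R S x + (x \<bullet> x) *\<^sub>R S a) has_derivative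
     (\<lambda>h. (2 * (a \<bullet> h)) *\<^sub>R S x + (2 * (a \<bullet> x)) *\<^sub>R S h + (2 * (x \<bullet> h)) *\<^sub>R S a)) (at x)"
  by (rule has_derivative_eq_rhs, (rule derivative_intros S_derivative)+)
     (simp add: fun_eq_iff algebra_simps inner_commute)

text \<open>Bracketing with a constant field is differentiation along it, here applied to the cubic
  field.\<close>

lemma first_derivative_in_L:
  assumes "(\<lambda>x. a) \<in> L"
  shows "(\<lambda>x. (2 * (a \<bullet> x)) *\<^sub>R S x + (x \<bullet> x) *\<^sub>R S a) \<in> L"
proof (rule lie_hull_bracketI[OF assms lie_hull.generator])
  show "(\<lambda>x. (x \<bullet> x) *\<^sub>R S x) \<in> {\<lambda>x. b (Suc 0), \<lambda>x. (x \<bullet> x) *\<^sub>R S x}" by simp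
  show "((\<lambda>x. (x \<bullet> x) *\<^sub>R S x) has_derivative (\<lambda>h. (2 * (x \<bullet> h)) *\<^sub>R S x + (x \<bullet> x) *\<^sub>R S h)) (at x)" for x
    by (rule has_derivative_eq_rhs, (rule derivative_intros S_derivative)+)
       (simp add: fun_eq_iff algebra_simps inner_commute)
  show "((\<lambda>x. a) has_derivative (\<lambda>h. 0)) (at x)" for x by simp
qed (simp add: inner_commute)

lemma second_derivative_in_L:
  assumes "(\<lambda>x. a) \<in> L" "(\<lambda>x. c) \<in> L"
  shows "(\<lambda>x. (2 * (a \<bullet> c)) *\<^sub>R S x + (2 * (a \<bullet> x)) *\<^sub>R S c + (2 * (c \<bullet> x)) *\<^sub>R S a) \<in> L"
proof (rule lie_hull_bracketI[OF assms(2) first_derivative_in_L[OF assms(1)] _ derivative_constant_quadratic])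
  show "((\<lambda>x. c) has_derivative (\<lambda>h. 0)) (at x)" for x by simp
qed (simp add: inner_commute)

lemma constants_in_L: "(\<lambda>x. a) \<in> L"
proof -
  have shift: "(\<lambda>x. S a) \<in> L" if a: "(\<lambda>x. a) \<in> L" "a \<noteq> 0" for a
  proof -
    have "(\<lambda>x. (6 * (a \<bullet> a)) *\<^sub>R S a) \<in> L"
    proof (rule lie_hull_bracketI[OF a(1) second_derivative_in_L[OF a(1) a(1)]])
      show "((\<lambda>x. (2 * (a \<bullet> a)) *\<^sub>R S x + (2 * (a \<bullet> x)) *\<^sub>R S a + (2 * (a \<bullet> x)) *\<^sub>R S a) has_derivative
         (\<lambda>h. (2 * (a \<bullet> a)) *\<^sub>R S h + (2 * (a \<bullet> h)) *\<^sub>R S a + (2 * (a \<bullet> h)) *\<^sub>R S a)) (at x)" for x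
        by (rule has_derivative_eq_rhs, (rule derivative_intros S_derivative)+) (simp add: fun_eq_iff)
      show "((\<lambda>x. a) has_derivative (\<lambda>h. 0)) (at x)" for x by simp
    qed (simp flip: scaleR_add_left)
    then show ?thesis using a(2) lie_hull_scaleD[of "6 * (a \<bullet> a)" "\<lambda>x. S a"] by simp
  qed
  have b: "(\<lambda>x. b (Suc k)) \<in> L" for k
  proof (induction k)
    case 0
    show ?case by (rule lie_hull.generator) simp
  next
    case (Suc k)
    have "b (Suc k) \<noteq> 0" using b_norm[of "Suc k"] by auto
    from shift[OF Suc this] show ?case by (simp add: S_b)
  qed
  \<comment> \<open>The induction reaches only successor indices; by periodicity the index
    \<open>k + d - 1\<close> covers \<open>b 0\<close> as well.\<close>
  have "(\<lambda>x. b k) \<in> L" for k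
    using b[of "k + d - 1"] b_periodic[of k] d(1) by simp
  then have "(\<lambda>x. \<Sum>k<d. (a \<bullet> b k) *\<^sub>R b k) \<in> L"
    by (intro L_sum lie_hull.scaleR)
  then show ?thesis using expansion[of a] by simp
qed

text \<open>The Laplacian of the cubic field, the sum of its second derivatives along the basis, is
  a multiple of \<open>S\<close>: each of the \<open>d\<close> terms contributes
  \<open>2 *\<^sub>R S x\<close>, and the other parts add up to \<open>4 *\<^sub>R S x\<close> by
  the basis expansion.\<close>

lemma S_in_L: "S \<in> L"
proof -
  have "(\<lambda>x. \<Sum>k<d. (2 * (b k \<bullet> b k)) *\<^sub>R S x + (2 * (b k \<bullet> x)) *\<^sub>R S (b k) + (2 * (b k \<bullet> x)) *\<^sub>R S (b k)) \<in> L"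
    by (intro L_sum second_derivative_in_L constants_in_L)
  moreover have "(\<Sum>k<d. (2 * (b k \<bullet> b k)) *\<^sub>R S x + (2 * (b k \<bullet> x)) *\<^sub>R S (b k) + (2 * (b k \<bullet> x)) *\<^sub>R S (b k))
      = (2 * real d + 4) *\<^sub>R S x" for x
  proof -
    have "S x = (\<Sum>k<d. (x \<bullet> b k) *\<^sub>R S (b k))"
      using expansion[of x] linear_sum[OF linear_S] by (metis (no_types, lifting) linear_scale[OF linear_S] sum.cong)
    then have "4 *\<^sub>R S x = (\<Sum>k<d. (4 * (b k \<bullet> x)) *\<^sub>R S (b k))"
      by (simp add: scaleR_sum_right inner_commute)
    moreover have "(2 * (b k \<bullet> b k)) *\<^sub>R S x + (2 * (b k \<bullet> x)) *\<^sub>R S (b k) + (2 * (b k \<bullet> x)) *\<^sub>R S (b k)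
        = 2 *\<^sub>R S x + (4 * (b k \<bullet> x)) *\<^sub>R S (b k)" for k
      by (simp add: b_norm flip: scaleR_add_left)
    ultimately show ?thesis
      by (simp add: sum.distrib scaleR_add_left scaleR_left.sum[symmetric] sum_constant_scaleR mult.commute)
  qed
  ultimately have "(\<lambda>x. (2 * real d + 4) *\<^sub>R S x) \<in> L" by simp
  then show ?thesis by (rule lie_hull_scaleD) simp
qed

lemma linear_symmetric_in_L: "(\<lambda>x. (a \<bullet> x) *\<^sub>R S c + (c \<bullet> x) *\<^sub>R S a) \<in> L"
proof -
  have "(\<lambda>x. ((2 * (a \<bullet> c)) *\<^sub>R S x + (2 * (a \<bullet> x)) *\<^sub>R S c + (2 * (c \<bullet> x)) *\<^sub>R S a) - (2 * (a \<bullet> c)) *\<^sub>R S x) \<in> L"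
    by (intro lie_hull_diff second_derivative_in_L constants_in_L lie_hull.scaleR S_in_L)
  then have "(\<lambda>x. 2 *\<^sub>R ((a \<bullet> x) *\<^sub>R S c + (c \<bullet> x) *\<^sub>R S a)) \<in> L"
    by (simp add: scaleR_add_right)
  then show ?thesis by (rule lie_hull_scaleD) simp
qed

lemma rank_one_derivative:
  "((\<lambda>x. (u \<bullet> x) *\<^sub>R v) has_derivative (\<lambda>h. (u \<bullet> h) *\<^sub>R v)) (at x)" for u v x :: 'a
  by (auto intro!: derivative_eq_intros)

text \<open>With equal arguments \<open>b i\<close> the symmetric field is twice the elementary map
  from \<open>b i\<close> to \<open>b (Suc i)\<close>. Brackets of such maps travel around the cycle
  and give every off-diagonal elementary map; a mixed symmetric field then isolates a diagonal
  one.\<close>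

lemma rank_one_in_L: "(\<lambda>x. (u \<bullet> x) *\<^sub>R v) \<in> L"
proof -
  have succ: "(\<lambda>x. (b i \<bullet> x) *\<^sub>R b (Suc i)) \<in> L" for i
  proof (rule lie_hull_scaleD)
    show "(\<lambda>x. 2 *\<^sub>R ((b i \<bullet> x) *\<^sub>R b (Suc i))) \<in> L"
      using linear_symmetric_in_L[of "b i" "b i"] by (simp add: S_b flip: scaleR_add_left)
  qed simp
  have off: "(\<lambda>x. (b i \<bullet> x) *\<^sub>R b (i + Suc k)) \<in> L" if "Suc k < d" for i k
    using that
  proof (induction k)
    case 0
    then show ?case using succ[of i] by simp
  next
    case (Suc k)
    then have 1: "(\<lambda>x. (b i \<bullet> x) *\<^sub>R b (i + Suc k)) \<in> L" by simp
    show ?case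
    proof (rule lie_hull_bracketI[OF 1 succ[of "i + Suc k"] rank_one_derivative rank_one_derivative])
      show "(b (i + Suc k) \<bullet> (b i \<bullet> x) *\<^sub>R b (i + Suc k)) *\<^sub>R b (Suc (i + Suc k)) -
          (b i \<bullet> (b (i + Suc k) \<bullet> x) *\<^sub>R b (Suc (i + Suc k))) *\<^sub>R b (i + Suc k) =
          (b i \<bullet> x) *\<^sub>R b (i + Suc (Suc k))" for x
        \<comment> \<open>The second product vanishes because the path has not yet closed up:
          \<open>Suc (Suc k) < d\<close>.\<close>
        using b_orthogonal[of "Suc (Suc k)" i] Suc.prems by (simp add: b_norm)
    qed
  qed
  \<comment> \<open>The symmetric field of \<open>b i\<close> and \<open>b (Suc i)\<close> is this
    diagonal map plus the map from \<open>b i\<close> to \<open>b (i + 2)\<close>, which is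
    off-diagonal since \<open>d \<ge> 3\<close>.\<close>
  have diag: "(\<lambda>x. (b (Suc i) \<bullet> x) *\<^sub>R b (Suc i)) \<in> L" for i
  proof -
    have "(\<lambda>x. ((b i \<bullet> x) *\<^sub>R S (b (Suc i)) + (b (Suc i) \<bullet> x) *\<^sub>R S (b i)) - (b i \<bullet> x) *\<^sub>R b (i + Suc 1)) \<in> L"
      by (intro lie_hull_diff linear_symmetric_in_L off) (use d in simp)
    then show ?thesis by (simp add: S_b)
  qed
  have "(\<lambda>x. (b i \<bullet> x) *\<^sub>R b j) \<in> L" if ij: "i < d" "j < d" for i j
  proof -
    consider "i < j" | "j < i" | "i = j" by linarith
    then show ?thesis
    proof cases
      case 1
      then show ?thesis using off[of "j - i - 1" i] ij by simp
    next
      case 2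
      then have "i + Suc (j + d - i - 1) = j + d" using ij by simp
      then show ?thesis using off[of "j + d - i - 1" i] ij 2 by (simp add: b_periodic)
    next
      case 3
      then show ?thesis using diag[of "i + d - 1"] ij by (simp add: b_periodic)
    qed
  qed
  then have "(\<lambda>x. \<Sum>i<d. \<Sum>j<d. ((u \<bullet> b i) * (v \<bullet> b j)) *\<^sub>R ((b i \<bullet> x) *\<^sub>R b j)) \<in> L"
    by (intro L_sum lie_hull.scaleR) auto
  moreover have "(\<Sum>i<d. \<Sum>j<d. ((u \<bullet> b i) * (v \<bullet> b j)) *\<^sub>R ((b i \<bullet> x) *\<^sub>R b j)) = (u \<bullet> x) *\<^sub>R v" for x
  proof -
    have "u \<bullet> x = (\<Sum>i<d. (u \<bullet> b i) * (b i \<bullet> x))"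
      by (subst expansion[of u]) (simp add: inner_sum_left)
    moreover have "v = (\<Sum>j<d. (v \<bullet> b j) *\<^sub>R b j)" by (rule expansion)
    ultimately have "(u \<bullet> x) *\<^sub>R v = (\<Sum>i<d. (u \<bullet> b i) * (b i \<bullet> x)) *\<^sub>R (\<Sum>j<d. (v \<bullet> b j) *\<^sub>R b j)"
      by metis
    also have "\<dots> = (\<Sum>i<d. \<Sum>j<d. ((u \<bullet> b i) * (b i \<bullet> x)) *\<^sub>R ((v \<bullet> b j) *\<^sub>R b j))"
      by (subst scaleR_sum_left) (simp only: scaleR_sum_right)
    finally show ?thesis
      by (simp add: mult_ac)
  qed
  ultimately show ?thesis by simp
qed

section \<open>Quadratic shears and shears of higher degree\<close>

text \<open>The linear field \<open>(u \<bullet> x) *\<^sub>R v\<close> is nilpotent. Bracketing the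
  derivative of the cubic field along \<open>u\<close> twice with it trades factors
  \<open>v \<bullet> x\<close> for \<open>u \<bullet> x\<close> and eliminates the terms along
  \<open>w\<close>, until a pure shear remains. That \<open>u\<close> and \<open>w\<close> are
  orthogonal uses \<open>d \<ge> 3\<close>.\<close>

lemma exists_quadratic_in_L: "\<exists>u v. u \<noteq> 0 \<and> v \<noteq> 0 \<and> (\<lambda>x. ((u \<bullet> x) * (u \<bullet> x)) *\<^sub>R v) \<in> L"
proof -
  define u v w where "u = b 0" and "v = b 1" and "w = b 2"
  have S: "S u = v" "S v = w" by (simp_all add: S_b u_def v_def w_def numeral_eq_Suc)
  have o: "u \<bullet> v = 0" "u \<bullet> w = 0" "v \<bullet> v = 1" "v \<bullet> u = 0" "u \<bullet> u = 1"
    using b_orthogonal[of 1 0] b_orthogonal[of 2 0] d b_norm[of 1] b_norm[of 0]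
    by (simp_all add: u_def v_def w_def inner_commute numeral_2_eq_2)
  have 1: "(\<lambda>x. (2 * ((u \<bullet> x) * (u \<bullet> x))) *\<^sub>R w + (2 * ((v \<bullet> x) * (u \<bullet> x))) *\<^sub>R v
      - (2 * ((u \<bullet> x) * (u \<bullet> S x))) *\<^sub>R v) \<in> L" (is "?q \<in> L")
    by (rule lie_hull_bracketI[OF rank_one_in_L[of u v] first_derivative_in_L[OF constants_in_L[of u]]
          rank_one_derivative derivative_constant_quadratic])
       (simp add: S o S_simps inner_add_right inner_commute[of _ v] mult_ac)
  have "(\<lambda>x. 2 *\<^sub>R (((u \<bullet> x) * (u \<bullet> x)) *\<^sub>R v)) \<in> L"
  proof (rule lie_hull_bracketI[OF rank_one_in_L[of u v] 1 rank_one_derivative])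
    show "(?q has_derivative (\<lambda>h. (4 * (u \<bullet> x) * (u \<bullet> h)) *\<^sub>R w
        + (2 * (v \<bullet> h) * (u \<bullet> x) + 2 * (v \<bullet> x) * (u \<bullet> h)) *\<^sub>R v
        - (2 * (u \<bullet> h) * (u \<bullet> S x) + 2 * (u \<bullet> x) * (u \<bullet> S h)) *\<^sub>R v)) (at x)" for x
      by (rule has_derivative_eq_rhs, (rule derivative_intros S_derivative)+)
         (simp add: fun_eq_iff algebra_simps)
  qed (simp add: S o S_simps inner_add_right inner_diff_right)
  then have "(\<lambda>x. ((u \<bullet> x) * (u \<bullet> x)) *\<^sub>R v) \<in> L" by (rule lie_hull_scaleD) simp
  moreover have "u \<noteq> 0" "v \<noteq> 0" using o by auto
  ultimately show ?thesis by blast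
qed

lemma quadratic_derivative:
  "((\<lambda>x. ((u \<bullet> x) * (w \<bullet> x)) *\<^sub>R v) has_derivative
     (\<lambda>h. ((u \<bullet> h) * (w \<bullet> x) + (u \<bullet> x) * (w \<bullet> h)) *\<^sub>R v)) (at x)" for u v w x :: 'a
  by (rule has_derivative_eq_rhs, (rule derivative_intros)+) (simp add: fun_eq_iff algebra_simps)

text \<open>The rank-one field sends \<open>v\<close> to \<open>v'\<close>; the other half of the
  bracket differentiates the square along \<open>v'\<close> and vanishes because
  \<open>u \<bullet> v' = 0\<close>.\<close>

lemma quadratic_change_vector:
  assumes "(\<lambda>x. ((u \<bullet> x) * (u \<bullet> x)) *\<^sub>R v) \<in> L" "v \<noteq> 0" "u \<bullet> v' = 0"
  shows "(\<lambda>x. ((u \<bullet> x) * (u \<bullet> x)) *\<^sub>R v') \<in> L"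
  by (rule lie_hull_bracketI[OF assms(1) rank_one_in_L[of "v /\<^sub>R (v \<bullet> v)" v'] quadratic_derivative rank_one_derivative])
     (use assms(2,3) in simp)

text \<open>Differentiating the square along \<open>u /\<^sub>R (u \<bullet> u)\<close>, weighted by
  \<open>w \<bullet> x\<close>, replaces one factor \<open>u \<bullet> x\<close>; the condition
  \<open>w \<bullet> v = 0\<close> removes the other half of the bracket.\<close>

lemma quadratic_polarize:
  assumes "(\<lambda>x. ((u \<bullet> x) * (u \<bullet> x)) *\<^sub>R v) \<in> L" "u \<noteq> 0" "w \<bullet> v = 0"
  shows "(\<lambda>x. ((u \<bullet> x) * (w \<bullet> x)) *\<^sub>R v) \<in> L"
proof (rule lie_hull_scaleD)
  show "(\<lambda>x. 2 *\<^sub>R (((u \<bullet> x) * (w \<bullet> x)) *\<^sub>R v)) \<in> L"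
    by (rule lie_hull_bracketI[OF rank_one_in_L[of w "u /\<^sub>R (u \<bullet> u)"] assms(1) rank_one_derivative quadratic_derivative])
       (use assms(2,3) in \<open>simp add: mult.commute flip: mult_2\<close>)
qed simp

text \<open>A second bracket of the same kind replaces the remaining factor. Its by-product is a
  multiple of the polarized field, already in \<open>L\<close>, and is subtracted.\<close>

lemma quadratic_change_form:
  assumes "(\<lambda>x. ((u \<bullet> x) * (u \<bullet> x)) *\<^sub>R v) \<in> L" "u \<noteq> 0" "w \<bullet> v = 0"
  shows "(\<lambda>x. ((w \<bullet> x) * (w \<bullet> x)) *\<^sub>R v) \<in> L"
proof -
  let ?a = "u /\<^sub>R (u \<bullet> u)"
  note P = quadratic_polarize[OF assms]
  have "(\<lambda>x. ((w \<bullet> x) * (w \<bullet> x)) *\<^sub>R v + (w \<bullet> ?a) *\<^sub>R (((u \<bullet> x) * (w \<bullet> x)) *\<^sub>R v)) \<in> L"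
    by (rule lie_hull_bracketI[OF rank_one_in_L[of w ?a] P rank_one_derivative quadratic_derivative])
       (use assms(2,3) in \<open>simp add: mult_ac flip: scaleR_add_left\<close>)
  from lie_hull_diff[OF this lie_hull.scaleR[OF P, of "w \<bullet> ?a"]] show ?thesis by simp
qed

text \<open>Changing the form requires the vector to be orthogonal to the new form. So the vector is
  first replaced by some \<open>w\<close> orthogonal to both \<open>u0\<close> and \<open>u\<close>,
  then the form is changed, and only then \<open>w\<close> becomes \<open>v\<close>.\<close>

lemma quadratic_in_L:
  assumes "u \<bullet> v = 0"
  shows "(\<lambda>x. ((u \<bullet> x) * (u \<bullet> x)) *\<^sub>R v) \<in> L"
proof -
  obtain u0 v0 where 0: "u0 \<noteq> 0" "v0 \<noteq> 0" "(\<lambda>x. ((u0 \<bullet> x) * (u0 \<bullet> x)) *\<^sub>R v0) \<in> L"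
    using exists_quadratic_in_L by blast
  obtain w where w: "w \<noteq> 0" "u0 \<bullet> w = 0" "u \<bullet> w = 0"
    using exists_orthogonal_to_two d by metis
  have "(\<lambda>x. ((u0 \<bullet> x) * (u0 \<bullet> x)) *\<^sub>R w) \<in> L"
    using quadratic_change_vector 0 w(2) by blast
  then have "(\<lambda>x. ((u \<bullet> x) * (u \<bullet> x)) *\<^sub>R w) \<in> L"
    using quadratic_change_form 0(1) w(3) by blast
  then show ?thesis
    using quadratic_change_vector w(1) assms by blast
qed

text \<open>The quadratic field with forms \<open>u\<close>, \<open>?w\<close> and direction
  \<open>v'\<close>, differentiated along the shear of degree \<open>m\<close> in direction
  \<open>v\<close>, gains one factor \<open>u \<bullet> x\<close> because
  \<open>u \<bullet> v = 0\<close> and \<open>?w \<bullet> v = 1\<close>. The direction changes from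
  \<open>v\<close> to \<open>v'\<close>, so the induction is general in the vector.\<close>

lemma shear_in_L:
  assumes "u \<bullet> v = 0"
  shows "(\<lambda>x. (u \<bullet> x) ^ m *\<^sub>R v) \<in> L"
  using assms
proof (induction m arbitrary: v)
  case 0
  then show ?case by (simp add: constants_in_L)
next
  case (Suc m v')
  show ?case
  proof (cases "u = 0")
    case True
    then show ?thesis by (simp add: L_zero)
  next
    case False
    obtain v where v: "v \<noteq> 0" "u \<bullet> v = 0" "v' \<bullet> v = 0"
      using exists_orthogonal_to_two d by metis
    let ?w = "v /\<^sub>R (v \<bullet> v)"
    have w: "?w \<bullet> v' = 0" using v(3) by (simp add: inner_commute)
    show ?thesis
    proof (rule lie_hull_bracketI[OF Suc.IH[OF v(2)] quadratic_polarize[OF quadratic_in_L[OF Suc.prems] False w]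
          _ quadratic_derivative])
      show "((\<lambda>x. (u \<bullet> x) ^ m *\<^sub>R v) has_derivative (\<lambda>h. (of_nat m * (u \<bullet> h) * (u \<bullet> x) ^ (m - 1)) *\<^sub>R v)) (at x)" for x
        by (rule has_derivative_eq_rhs, (rule derivative_intros)+) simp
    qed (use v Suc.prems in simp)
  qed
qed

end

subsection \<open>Landmarks\<close>

lemma polynomial_function_landmark_lift:
  fixes V :: "real ^ 'd::finite \<Rightarrow> real ^ 'd"
  assumes "polynomial_function V"
  shows "polynomial_function (landmark_lift V :: (real ^ 'd) ^ 'n::finite \<Rightarrow> _)"
proof -
  have "polynomial_function (\<lambda>x. landmark_lift V x \<bullet> b)" if "b \<in> Basis" for b :: "(real ^ 'd) ^ 'n"
  proof -
    obtain i c where b: "b = axis i c"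
      using \<open>b \<in> Basis\<close> unfolding Basis_vec_def by blast
    have "real_polynomial_function (\<lambda>y. V y \<bullet> c)"
      using assms bounded_linear_inner_left[of c] unfolding polynomial_function_def o_def by blast
    then have "real_polynomial_function ((\<lambda>y. V y \<bullet> c) \<circ> (\<lambda>x::(real ^ 'd) ^ 'n. x $ i))"
      by (intro real_polynomial_function_compose polynomial_function_bounded_linear bounded_linear_vec_nth)
    then show ?thesis
      by (simp add: b inner_axis landmark_lift_def o_def real_polynomial_function_eq)
  qed
  then show ?thesis
    by (simp add: polynomial_function_iff_Basis_inner)
qed

lemma has_derivative_landmark_lift:
  fixes V :: "real ^ 'd::finite \<Rightarrow> real ^ 'd" and x :: "(real ^ 'd) ^ 'n::finite"
  assumes "\<And>y. (V has_derivative V' y) (at y)"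
  shows "(landmark_lift V has_derivative (\<lambda>h. \<chi> i. V' (x $ i) (h $ i))) (at x)"
proof (subst has_derivative_componentwise_within, rule ballI)
  fix b :: "(real ^ 'd) ^ 'n" assume "b \<in> Basis"
  then obtain i c where b: "b = axis i c"
    unfolding Basis_vec_def by blast
  have "((\<lambda>x. x $ i) has_derivative (\<lambda>h. h $ i)) (at x)"
    by (rule bounded_linear_imp_has_derivative[OF bounded_linear_vec_nth])
  from has_derivative_compose[OF this assms]
  have "((\<lambda>x. V (x $ i) \<bullet> c) has_derivative (\<lambda>h. V' (x $ i) (h $ i) \<bullet> c)) (at x)"
    by (rule has_derivative_inner_left)
  then show "((\<lambda>x. landmark_lift V x \<bullet> b) has_derivative (\<lambda>h. (\<chi> i. V' (x $ i) (h $ i)) \<bullet> b)) (at x)"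
    by (simp add: b inner_axis landmark_lift_def)
qed

lemma dirderiv_landmark_lift:
  assumes "polynomial_function W"
  shows "dirderiv (landmark_lift V) (landmark_lift W) x = landmark_lift (dirderiv V W) x"
  by (subst dirderiv_eq[OF has_derivative_landmark_lift[OF polynomial_function_has_derivative[OF assms]]])
     (simp add: landmark_lift_def dirderiv_def)

text \<open>A lift acts on every landmark separately, so its derivative is block diagonal and the
  bracket can be formed block by block.\<close>

lemma landmark_lift_bracket:
  assumes "polynomial_function V" "polynomial_function W"
  shows "landmark_lift (bracket V W) = bracket (landmark_lift V) (landmark_lift W)"
  by (rule ext)
     (simp add: bracket_def dirderiv_landmark_lift assms, simp add: landmark_lift_def bracket_def vec_eq_iff)

lemma landmark_lift_add: "landmark_lift (\<lambda>x. V x + W x) = (\<lambda>x. landmark_lift V x + landmark_lift W x)"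
  by (simp add: landmark_lift_def fun_eq_iff vec_eq_iff)

lemma landmark_lift_scaleR: "landmark_lift (\<lambda>x. c *\<^sub>R V x) = (\<lambda>x. c *\<^sub>R landmark_lift V x)"
  by (simp add: landmark_lift_def fun_eq_iff vec_eq_iff)

lemma landmark_lift_lie_hull:
  assumes "V \<in> lie_hull \<Z>" and Z: "\<And>Z. Z \<in> \<Z> \<Longrightarrow> polynomial_function Z"
  shows "landmark_lift V \<in> lie_hull (landmark_lift ` \<Z>)"
  using assms(1)
proof induction
  case (generator Z)
  then show ?case by (intro lie_hull.generator imageI)
next
  case (add V W)
  then show ?case by (simp add: landmark_lift_add lie_hull.add)
next
  case (scaleR V c)
  then show ?case by (simp add: landmark_lift_scaleR lie_hull.scaleR)
next
  case (bracket V W)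
  have "polynomial_function V" "polynomial_function W"
    using polynomial_function_lie_hull[OF bracket.hyps(1)] polynomial_function_lie_hull[OF bracket.hyps(2)] Z
    by blast+
  with bracket.IH show ?case by (simp add: landmark_lift_bracket lie_hull.bracket)
qed

section \<open>Topology of the landmark manifold\<close>

text \<open>Proper subspaces have measure zero, and so does a finite union of them.\<close>

lemma exists_avoiding_proper_subspaces:
  fixes F :: "'a::euclidean_space set set"
  assumes "finite F" "\<And>S. S \<in> F \<Longrightarrow> subspace S \<and> S \<noteq> UNIV"
  shows "\<exists>x. \<forall>S\<in>F. x \<notin> S"
proof -
  have "negligible S" if "S \<in> F" for S
  proof (rule negligible_lowdim)
    have "span S \<noteq> UNIV" using assms(2)[OF that] by (metis span_eq_iff)
    then show "dim S < DIM('a)"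
      using dim_eq_full[of S] dim_subset_UNIV[of S] by linarith
  qed
  then have "negligible (\<Union>F)" using assms(1) by (intro negligible_Union) auto
  then have "\<Union>F \<noteq> UNIV" using non_negligible_UNIV by metis
  then show ?thesis by blast
qed

lemma span_singleton_neq_UNIV:
  fixes v :: "'a::euclidean_space"
  assumes "DIM('a) \<ge> 2"
  shows "span {v} \<noteq> UNIV"
proof -
  have "dim {v} \<le> card {v}" by (rule dim_le_card') simp
  then show ?thesis using assms dim_eq_full[of "{v}"] by auto
qed

lemma open_landmark_manifold: "open (landmark_manifold :: ((real ^ 'd::finite) ^ 'n::finite) set)"
proof -
  have eq: "landmark_manifold = (\<Inter>z\<in>{z. fst z \<noteq> snd z}. {x :: (real ^ 'd) ^ 'n. x $ fst z \<noteq> x $ snd z})"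
    by (auto simp: landmark_manifold_def)
  show ?thesis
    unfolding eq by (intro open_INT ballI open_Collect_neq continuous_intros) simp
qed

text \<open>Both configurations are joined by straight segments to a generic \<open>r\<close>.
  Landmarks cannot collide on the way if no difference \<open>r $ i - r $ j\<close> is parallel to
  the corresponding difference in \<open>p\<close> or \<open>q\<close>, and a line is a proper
  subspace in dimension at least two.\<close>

lemma connected_landmark_manifold:
  assumes "CARD('d::finite) \<ge> 2"
  shows "connected (landmark_manifold :: ((real ^ 'd) ^ 'n::finite) set)"
  unfolding connected_iff_connected_component
proof (intro ballI)
  fix p q :: "(real ^ 'd) ^ 'n" assume p: "p \<in> landmark_manifold" and q: "q \<in> landmark_manifold"
  define H where "H = (\<lambda>(i, j, x). {r :: (real ^ 'd) ^ 'n. r $ i - r $ j \<in> span {x $ i - x $ j :: real ^ 'd}})"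
  let ?F = "H ` {(i, j, x). i \<noteq> j \<and> x \<in> {p, q}}"
  have "\<exists>r. \<forall>S\<in>?F. r \<notin> S"
  proof (rule exists_avoiding_proper_subspaces)
    have "{(i :: 'n, j :: 'n, x). i \<noteq> j \<and> x \<in> {p, q}} \<subseteq> UNIV \<times> UNIV \<times> {p, q}" by auto
    then have "finite {(i :: 'n, j :: 'n, x). i \<noteq> j \<and> x \<in> {p, q}}"
      by (rule finite_subset) simp
    then show "finite ?F" by (rule finite_imageI)
    fix S assume "S \<in> ?F"
    then obtain i j x where S: "S = H (i, j, x)" and ij: "i \<noteq> j" by auto
    have "linear (\<lambda>r :: (real ^ 'd) ^ 'n. r $ i - r $ j)"
      by (rule linearI) (simp_all add: algebra_simps)
    then have "subspace ((\<lambda>r :: (real ^ 'd) ^ 'n. r $ i - r $ j) -` span {x $ i - x $ j})"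
      by (intro linear_subspace_vimage subspace_span)
    then have "subspace S" by (simp add: S H_def vimage_def)
    moreover have "S \<noteq> UNIV"
    proof -
      have "span {x $ i - x $ j} \<noteq> UNIV"
        by (rule span_singleton_neq_UNIV) (use assms in simp)
      then obtain z where "z \<notin> span {x $ i - x $ j}" by blast
      \<comment> \<open>\<open>axis i z\<close> puts \<open>z\<close> at landmark \<open>i\<close>
        and 0 at all others, so its difference at \<open>i\<close> and \<open>j\<close> is
        \<open>z\<close>.\<close>
      then have "axis i z \<notin> S" using ij by (simp add: S H_def axis_def)
      then show ?thesis by blast
    qed
    ultimately show "subspace S \<and> S \<noteq> UNIV" by blast
  qed
  then obtain r where "\<And>S. S \<in> ?F \<Longrightarrow> r \<notin> S" by blast
  then have r: "r $ i - r $ j \<notin> span {x $ i - x $ j}" if "i \<noteq> j" "x \<in> {p, q}" for i j x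
  proof -
    have "H (i, j, x) \<in> ?F" using that by blast
    with \<open>\<And>S. S \<in> ?F \<Longrightarrow> r \<notin> S\<close> have "r \<notin> H (i, j, x)" by blast
    then show ?thesis by (simp add: H_def)
  qed
  have seg: "closed_segment x r \<subseteq> landmark_manifold" if x: "x \<in> {p, q}" for x
  proof
    fix y assume "y \<in> closed_segment x r"
    then obtain t where y: "y = (1 - t) *\<^sub>R x + t *\<^sub>R r" by (auto simp: in_segment)
    have "y $ i \<noteq> y $ j" if ij: "i \<noteq> j" for i j
    proof
      assume "y $ i = y $ j"
      then have eq: "t *\<^sub>R (r $ i - r $ j) = (t - 1) *\<^sub>R (x $ i - x $ j)"
        by (simp add: y algebra_simps)
      show False
      proof (cases "t = 0")
        case True
        then have "x $ i = x $ j" using eq by simp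
        then show False using x p q ij by (auto simp: landmark_manifold_def)
      next
        case False
        then have "r $ i - r $ j = ((t - 1) / t) *\<^sub>R (x $ i - x $ j)"
          using arg_cong[OF eq, of "\<lambda>v. v /\<^sub>R t"] by (simp add: divide_inverse mult.commute)
        then show False using r[OF ij x] by (metis insertI1 span_base span_scale)
      qed
    qed
    then show "y \<in> landmark_manifold" by (simp add: landmark_manifold_def)
  qed
  have "connected (closed_segment p r \<union> closed_segment q r)"
    by (intro connected_Un connected_segment) auto
  moreover have "closed_segment p r \<union> closed_segment q r \<subseteq> landmark_manifold"
    using seg by simp
  ultimately show "connected_component landmark_manifold p q"
    unfolding connected_component_def
    by (intro exI[of _ "closed_segment p r \<union> closed_segment q r"]) auto
qed

section \<open>Interpolation of velocities\<close>

text \<open>The witness is the Lagrange basis polynomial of the node \<open>t i\<close>; injectivity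
  keeps its denominators nonzero.\<close>

lemma exists_interpolating_polynomial:
  fixes t :: "'n::finite \<Rightarrow> real"
  assumes "inj t"
  shows "\<exists>p :: real poly. \<forall>j. poly p (t j) = (if j = i then 1 else 0)"
proof -
  define p where "p = (\<Prod>k\<in>UNIV - {i}. smult (1 / (t i - t k)) [:- t k, 1:])"
  have p: "poly p (t j) = (\<Prod>k\<in>UNIV - {i}. (t j - t k) / (t i - t k))" for j
    by (simp add: p_def poly_prod diff_divide_distrib)
  have "poly p (t j) = (if j = i then 1 else 0)" for j
  proof (cases "j = i")
    case True
    have "t i - t k \<noteq> 0" if "k \<noteq> i" for k
      using injD[OF assms, of i k] that by auto
    then have "poly p (t i) = 1" unfolding p by (intro prod.neutral) auto
    with True show ?thesis by simp
  next
    case False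
    then have "poly p (t j) = 0" unfolding p by (intro prod_zero) auto
    with False show ?thesis by simp
  qed
  then show ?thesis by blast
qed

context cyclic_basis
begin

lemma polynomial_shear_in_L:
  assumes "u \<bullet> v = 0"
  shows "(\<lambda>x. poly p (u \<bullet> x) *\<^sub>R v) \<in> L"
proof -
  have "(\<lambda>x. \<Sum>m\<le>degree p. coeff p m *\<^sub>R ((u \<bullet> x) ^ m *\<^sub>R v)) \<in> L"
    by (intro L_sum lie_hull.scaleR shear_in_L assms)
  then show ?thesis by (simp add: poly_altdef scaleR_sum_left)
qed

text \<open>A linear form takes distinct values at the points if it avoids the hyperplanes
  orthogonal to their differences. Avoiding one more line makes the second form independent of the
  first.\<close>

lemma exists_separating_pair:
  fixes x :: "'n::finite \<Rightarrow> 'a"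
  assumes "inj x"
  shows "\<exists>u u'. u \<noteq> 0 \<and> u' \<notin> span {u} \<and> inj (\<lambda>i. u \<bullet> x i) \<and> inj (\<lambda>i. u' \<bullet> x i)"
proof -
  let ?H = "(\<lambda>z. {u. (x (fst z) - x (snd z)) \<bullet> u = 0}) ` {z. fst z \<noteq> snd z}"
  have fin: "finite ?H" by simp
  have H: "subspace S \<and> S \<noteq> UNIV" if "S \<in> ?H" for S
  proof -
    note S_in = that
    obtain i j where S: "S = {u. (x i - x j) \<bullet> u = 0}" and ij: "i \<noteq> j" using S_in by blast
    have "x i - x j \<noteq> 0" using injD[OF assms] ij by auto
    then have "x i - x j \<notin> S" by (simp add: S)
    then have "S \<noteq> UNIV" by blast
    moreover have "subspace S" unfolding S by (rule subspace_hyperplane)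
    ultimately show ?thesis by blast
  qed
  have inj: "inj (\<lambda>i. u \<bullet> x i)" if u: "\<forall>S\<in>?H. u \<notin> S" for u
  proof (rule injI, rule ccontr)
    fix i j assume "u \<bullet> x i = u \<bullet> x j" "i \<noteq> j"
    then have "u \<in> {u. (x i - x j) \<bullet> u = 0}" by (simp add: inner_commute[of _ u] inner_diff_right)
    moreover have "{u. (x i - x j) \<bullet> u = 0} \<in> ?H"
      using \<open>i \<noteq> j\<close> by (intro image_eqI[of _ _ "(i, j)"]) auto
    ultimately show False using u by blast
  qed
  have D: "DIM('a) \<ge> 2" using d by simp
  have avoid: "\<exists>w. w \<notin> span {v} \<and> (\<forall>S\<in>?H. w \<notin> S)" for v
  proof -
    have "\<exists>w. \<forall>S\<in>insert (span {v}) ?H. w \<notin> S"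
    proof (rule exists_avoiding_proper_subspaces)
      show "finite (insert (span {v}) ?H)" using fin by (rule finite.insertI)
      show "subspace S \<and> S \<noteq> UNIV" if "S \<in> insert (span {v}) ?H" for S
        using that H[of S] span_singleton_neq_UNIV[OF D, of v] subspace_span[of "{v}"] by blast
    qed
    then show ?thesis by (simp only: ball_simps)
  qed
  \<comment> \<open>For \<open>v = 0\<close> the extra line is the zero subspace, which yields
    \<open>u \<noteq> 0\<close>.\<close>
  obtain u where u: "u \<notin> span {0}" "\<forall>S\<in>?H. u \<notin> S" using avoid by blast
  then have "u \<noteq> 0" by (metis span_zero)
  obtain u' where "u' \<notin> span {u}" "\<forall>S\<in>?H. u' \<notin> S" using avoid by blast
  with u(2) \<open>u \<noteq> 0\<close> inj show ?thesis by blast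
qed

text \<open>Shears with form \<open>u\<close> move points only orthogonally to \<open>u\<close>.
  Each velocity is therefore split into a part orthogonal to \<open>u\<close> and a part orthogonal
  to \<open>u'\<close>, and Lagrange polynomials in the two forms realise the parts.\<close>

lemma interpolation_in_L:
  fixes x :: "'n::finite \<Rightarrow> 'a"
  assumes "inj x"
  shows "\<exists>V\<in>L. \<forall>i. V (x i) = w i"
proof -
  obtain u u' where u: "u \<noteq> 0" "u' \<notin> span {u}" "inj (\<lambda>i. u \<bullet> x i)" "inj (\<lambda>i. u' \<bullet> x i)"
    using exists_separating_pair[OF assms] by blast
  \<comment> \<open>The component of \<open>u'\<close> orthogonal to \<open>u\<close>, nonzero by
    independence.\<close>
  define z where "z = u' - ((u \<bullet> u') / (u \<bullet> u)) *\<^sub>R u"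
  have uz: "u \<bullet> z = 0" using u(1) by (simp add: z_def inner_diff_right)
  have "z \<noteq> 0"
  proof
    assume "z = 0"
    then have "u' = ((u \<bullet> u') / (u \<bullet> u)) *\<^sub>R u" by (simp add: z_def)
    then show False using u(2) by (metis insertI1 span_base span_scale)
  qed
  moreover have "u' \<bullet> z = z \<bullet> z"
    using uz by (simp add: z_def inner_diff_left inner_diff_right inner_commute)
  ultimately have u'z: "u' \<bullet> z \<noteq> 0" by simp
  \<comment> \<open>The multiple of \<open>z\<close> that has the same inner product with
    \<open>u'\<close> as \<open>w i\<close>, so that \<open>w i - a i\<close> is orthogonal to
    \<open>u'\<close>.\<close>
  define a where "a i = ((u' \<bullet> w i) / (u' \<bullet> z)) *\<^sub>R z" for i
  have a: "u \<bullet> a i = 0" "u' \<bullet> (w i - a i) = 0" for i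
    using uz u'z by (simp_all add: a_def inner_diff_right)
  obtain p where p: "\<And>i j. poly (p i) (u \<bullet> x j) = (if j = i then 1 else 0)"
    using exists_interpolating_polynomial[OF u(3)] by metis
  obtain p' where p': "\<And>i j. poly (p' i) (u' \<bullet> x j) = (if j = i then 1 else 0)"
    using exists_interpolating_polynomial[OF u(4)] by metis
  let ?V = "\<lambda>y. \<Sum>i\<in>UNIV. poly (p i) (u \<bullet> y) *\<^sub>R a i + poly (p' i) (u' \<bullet> y) *\<^sub>R (w i - a i)"
  have "?V \<in> L"
    by (intro L_sum lie_hull.add polynomial_shear_in_L a)
  moreover have "?V (x j) = w j" for j
  proof -
    have "?V (x j) = (\<Sum>i\<in>UNIV. if j = i then w i else 0)"
      by (intro sum.cong) (simp_all add: p p')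
    then show ?thesis by simp
  qed
  ultimately show ?thesis by (intro bexI[of _ ?V]) auto
qed

end

section \<open>The cubic field in coordinates\<close>

definition cyclic_axis :: "(nat \<Rightarrow> 'd::finite) \<Rightarrow> nat \<Rightarrow> real ^ 'd" where
  "cyclic_axis e k = axis (e (k mod CARD('d))) 1"

definition cyclic_shift :: "(nat \<Rightarrow> 'd::finite) \<Rightarrow> real ^ 'd \<Rightarrow> real ^ 'd" where
  "cyclic_shift e x = (\<Sum>k<CARD('d). (x \<bullet> cyclic_axis e k) *\<^sub>R cyclic_axis e (Suc k))"

lemma cyclic_basis_axis:
  fixes e :: "nat \<Rightarrow> 'd::finite"
  assumes "CARD('d) \<ge> 3" "cyclic_numbering e"
  shows "cyclic_basis (cyclic_axis e) CARD('d) (cyclic_shift e)"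
proof (rule cyclic_basis.intro)
  let ?d = "CARD('d)"
  have bij: "bij_betw e {..<?d} UNIV" using assms(2) by (simp add: cyclic_numbering_def)
  show "?d \<ge> 3" by fact
  show "?d = DIM(real ^ 'd)" by simp
  have eq: "e (i mod ?d) = e (j mod ?d) \<longleftrightarrow> i mod ?d = j mod ?d" for i j
    using bij_betw_imp_inj_on[OF bij] by (auto simp: inj_on_def)
  show inner: "cyclic_axis e i \<bullet> cyclic_axis e j = (if i mod ?d = j mod ?d then 1 else 0)" for i j
    by (simp add: cyclic_axis_def inner_axis_axis eq)
  show per: "cyclic_axis e (k + ?d) = cyclic_axis e k" for k
    by (simp add: cyclic_axis_def)
  show "v = (\<Sum>k<?d. (v \<bullet> cyclic_axis e k) *\<^sub>R cyclic_axis e k)" for v :: "real ^ 'd"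
  proof -
    have "v = (\<Sum>i\<in>UNIV. v $ i *\<^sub>R axis i 1)"
      using basis_expansion[of v] by (simp add: scalar_mult_eq_scaleR)
    also have "\<dots> = (\<Sum>k<?d. v $ e k *\<^sub>R axis (e k) 1)"
      by (rule sum.reindex_bij_betw[OF bij, symmetric])
    finally show ?thesis by (simp add: cyclic_axis_def inner_axis)
  qed
  show "linear (cyclic_shift e)"
    by (rule linearI) (simp_all add: cyclic_shift_def inner_add_left scaleR_add_left sum.distrib scaleR_sum_right)
  show "cyclic_shift e (cyclic_axis e k) = cyclic_axis e (Suc k)" for k
  proof -
    have "cyclic_shift e (cyclic_axis e k) = (\<Sum>j<?d. if j = k mod ?d then cyclic_axis e (Suc j) else 0)"
      unfolding cyclic_shift_def by (intro sum.cong) (auto simp: inner)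
    also have "\<dots> = cyclic_axis e (Suc (k mod ?d))" by simp
    finally show ?thesis by (simp add: cyclic_axis_def mod_Suc_eq)
  qed
qed

lemma Y_field_eq:
  fixes e :: "nat \<Rightarrow> 'd::finite"
  assumes "CARD('d) \<ge> 3" "cyclic_numbering e"
  shows "Y_field e = (\<lambda>x. (x \<bullet> x) *\<^sub>R cyclic_shift e x)"
proof
  fix x :: "real ^ 'd"
  let ?d = "CARD('d)"
  interpret cyclic_basis "cyclic_axis e" ?d "cyclic_shift e"
    by (rule cyclic_basis_axis[OF assms])
  \<comment> \<open>The sums in \<open>Y_field\<close> run from 1 to \<open>d\<close>, those of the
    locale over the residues from 0; a summand with equal values at 0 and \<open>d\<close> has the
    same sum over both.\<close>
  have rot: "(\<Sum>k = 1..?d. f k) = (\<Sum>k<?d. f k)" if "f ?d = f 0" for f :: "nat \<Rightarrow> 'z::ab_group_add"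
  proof -
    have "f 0 + (\<Sum>k<?d. f (Suc k)) = (\<Sum>k<?d. f k) + f ?d"
      using sum.lessThan_Suc_shift[of f ?d] sum.lessThan_Suc[of f ?d] by simp
    then show ?thesis using that by (simp add: sum.atLeast1_atMost_eq)
  qed
  have c: "coord e k x = x \<bullet> cyclic_axis e k" for k
    by (simp add: coord_def cyclic_axis_def inner_axis)
  have "x \<bullet> x = (\<Sum>k<?d. (x \<bullet> cyclic_axis e k)\<^sup>2)"
    by (subst (2) expansion[of x]) (simp add: inner_sum_right power2_eq_square)
  moreover have "(\<Sum>j = 1..?d. (coord e j x)\<^sup>2) = (\<Sum>k<?d. (x \<bullet> cyclic_axis e k)\<^sup>2)"
    unfolding c by (rule rot) (simp add: cyclic_axis_def)
  ultimately have n: "(\<Sum>j = 1..?d. (coord e j x)\<^sup>2) = x \<bullet> x" by simp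
  have "Y_field e x = (\<Sum>k = 1..?d. (x \<bullet> x) *\<^sub>R ((x \<bullet> cyclic_axis e k) *\<^sub>R cyclic_axis e (Suc k)))"
    unfolding Y_field_def n by (simp add: c coord_field_def cyclic_axis_def)
  also have "\<dots> = (\<Sum>k<?d. (x \<bullet> x) *\<^sub>R ((x \<bullet> cyclic_axis e k) *\<^sub>R cyclic_axis e (Suc k)))"
    by (rule rot) (simp add: cyclic_axis_def mod_Suc_eq[symmetric, of ?d])
  finally show "Y_field e x = (x \<bullet> x) *\<^sub>R cyclic_shift e x"
    by (simp add: cyclic_shift_def scaleR_sum_right)
qed

theorem theorem4p1:
  fixes e :: "nat \<Rightarrow> 'd::finite"
  assumes "CARD('d) \<ge> 3"
    and "cyclic_numbering e"
  shows "completely_controllable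
           (landmark_manifold :: ((real ^ 'd) ^ 'n::finite) set)
           (\<lambda>x. span {landmark_lift (coord_field e 1) x, landmark_lift (Y_field e) x})"
proof -
  interpret cyclic_basis "cyclic_axis e" "CARD('d)" "cyclic_shift e"
    by (rule cyclic_basis_axis[OF assms])
  let ?\<Z> = "{coord_field e 1, Y_field e}"
  let ?M = "landmark_manifold :: ((real ^ 'd) ^ 'n) set"
  have L_eq: "L = lie_hull ?\<Z>"
    by (simp add: Y_field_eq[OF assms] coord_field_def[abs_def] cyclic_axis_def)
  have "polynomial_function (\<lambda>x::real ^ 'd. \<Sum>i\<in>Basis. (x \<bullet> i) *\<^sub>R (x \<bullet> i))"
    by (intro polynomial_function_sum polynomial_function_mult polynomial_function_bounded_linear
        bounded_linear_inner_left finite_Basis)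
  then have "polynomial_function (\<lambda>x::real ^ 'd. x \<bullet> x)"
    by (simp add: euclidean_inner[symmetric])
  moreover have "polynomial_function (cyclic_shift e)"
    using linear_S by (intro polynomial_function_bounded_linear) (simp add: linear_conv_bounded_linear)
  ultimately have "polynomial_function (\<lambda>x. (x \<bullet> x) *\<^sub>R cyclic_shift e x)"
    by (rule polynomial_function_mult)
  then have poly: "polynomial_function Z" if "Z \<in> ?\<Z>" for Z
    using that by (auto simp: Y_field_eq[OF assms] coord_field_def[abs_def])
  have polyl: "polynomial_function Z" if "Z \<in> landmark_lift ` ?\<Z>" for Z :: "(real ^ 'd) ^ 'n \<Rightarrow> _"
    using that polynomial_function_landmark_lift poly by blast
  have span: "\<exists>W\<in>lie_hull (landmark_lift ` ?\<Z>). W q = w" if q: "q \<in> ?M" for q w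
  proof -
    \<comment> \<open>Distinctness of the landmarks is the injectivity that interpolation requires,
      and the components of the tangent vector \<open>w\<close> are the velocities to be
      interpolated.\<close>
    have "inj (\<lambda>i. q $ i)" using q by (auto simp: landmark_manifold_def inj_def)
    then obtain V where V: "V \<in> L" "\<And>i. V (q $ i) = w $ i"
      using interpolation_in_L[of "\<lambda>i. q $ i" "\<lambda>i. w $ i"] by blast
    have "landmark_lift V \<in> lie_hull (landmark_lift ` ?\<Z>)"
      using V(1) poly unfolding L_eq by (rule landmark_lift_lie_hull)
    moreover have "landmark_lift V q = w" by (simp add: landmark_lift_def V(2) vec_eq_iff)
    ultimately show ?thesis by blast
  qed
  have "p \<in> horizontal_orbit ?M (\<lambda>x. span {landmark_lift (coord_field e 1) x, landmark_lift (Y_field e) x}) q"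
    if "q \<in> ?M" "p \<in> ?M" for p q
  proof -
    have "connected ?M" using assms(1) by (intro connected_landmark_manifold) simp
    then have "reachable ?M (landmark_lift ` ?\<Z>) q p"
      using polynomial_chow_rashevskii[OF open_landmark_manifold _ polyl span that] by blast
    moreover have "continuous_on ?M Z" if "Z \<in> landmark_lift ` ?\<Z>" for Z
      using continuous_on_polymonial_function[OF polyl[OF that]] .
    ultimately show ?thesis
      using reachable_imp_horizontal_orbit[of ?M "landmark_lift ` ?\<Z>" q p] that(1) by simp
  qed
  then show ?thesis
    unfolding completely_controllable_def horizontal_orbit_def by blast
qed

end
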